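(* Let $T$ be a lush hedge of height $H\ge8$ and write $\ell_i=\ell_i(T)$. (1) There exist a matrix $A\in\mathcal S(T)$ and eight distinct reals $\alpha_1,\alpha_2,\beta_2,\beta_3,\beta_4,\lambda_{3,7},\lambda_{4,8},\lambda_{4,9}$ such that $\alpha_1,\alpha_2,\beta_2,\beta_3,\beta_4$ witness that $A$ has a critical multiplicity list and $\mathrm{mult}(\lambda_{3,7},A)\ge\ell_3+\ell_7$, $\mathrm{mult}(\lambda_{4,8},A)\ge\ell_4+\ell_8$, $\mathrm{mult}(\lambda_{4,9},A)\ge\ell_4+\ell_9$. Set $\mathbf m_{\mathrm{rig}}(T):=\mathbf m(A)$. (2) If $B\in\mathcal S(T)$ has the same property as in (1) (a critical multiplicity list witnessed by five distinct reals, plus three further distinct eigenvalues, different from those five, of multiplicities at least $\ell_3+\ell_7$, $\ell_4+\ell_8$, $\ell_4+\ell_9$ respectively), then $\mathbf m(B)=\mathbf m_{\mathrm{rig}}(T)$ or $\mathbf m(-B)=\mathbf m_{\mathrm{rig}}(T)$. (3) If $B\in\mathcal S(T)$ satisfies $\mathbf m(B)=\mathbf m_{\mathrm{rig}}(T)$, then there are real $a>0$ and $b$ with $\sigma(B)=\{a\mu+b:\mu\in\sigma(A)\}$ as multisets; equivalently, $\mathrm{RS}(T,\mathbf m_{\mathrm{rig}}(T))$ consists of a single point.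
   Context: Hedges: a rooted tree has a distinguished root; $y$ is a child of adjacent $z$ if the root-to-$y$ path passes through $z$; a leaf is a non-root vertex of degree 1. A hedge is a rooted tree that is $P_1$ or in which all leaves are at equal distance from the root. $\mathrm h(u)$ is the distance from $u$ to a nearest leaf; the height of the hedge is that of the root; $V_i(T)$ is the set of vertices of height $i$; $\ell_i(T)=|V_{i-1}(T)|-|V_i(T)|$ for $i\ge1$. A hedge is lush if every vertex of height $\ge2$ has at least three children and every vertex of height $1$ at least two. $\mathcal R(T)$: real matrices indexed by $V(T)$ with $a_{ij}\ne0$ iff $\{i,j\}\in E(T)$ ($i\ne j$), $a_{ij}a_{ji}>0$ on edges, arbitrary diagonal; $\mathcal S(T)$: its symmetric members. Critical multiplicity list: $A\in\mathcal R(T)$ has one if there exist five distinct reals $\alpha_1,\alpha_2,\beta_2,\beta_3,\beta_4$ (witnesses) with $\mathrm{mult}(\alpha_j,A)\ge\sum_{i\ge j,\ i\equiv j\ (2)}\ell_i(T)$ ($j=1,2$), $\mathrm{mult}(\beta_j,A)\ge\sum_{i\ge j,\ i\equiv j\ (3)}\ell_i(T)$ ($j=2,3,4$), and $\mathrm{mult}(\beta_4,A)<\ell_3(T)$ (multiplicity $0$ allowed). The ordered multiplicity list of a matrix with distinct eigenvalues $\lambda_1<\dots<\lambda_k$ of multiplicities $m_1,\dots,m_k$ is $\mathbf m(A)=(m_1,\dots,m_k)$. For a graph $G$ and ordered list $\mathbf m=(m_1,\dots,m_k)$ with $k\ge2$, $\mathrm{RS}(G,\mathbf m)$ is the set of points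 $\bigl(\frac{\lambda_2-\lambda_1}{\lambda_k-\lambda_1},\dots,\frac{\lambda_k-\lambda_{k-1}}{\lambda_k-\lambda_1}\bigr)$ over all matrices in $\mathcal S(G)$ with spectrum $\{\lambda_1^{(m_1)},\dots,\lambda_k^{(m_k)}\}$, $\lambda_1<\dots<\lambda_k$. *)

theory Defs
  imports "Jordan_Normal_Form.Char_Poly"
begin

text \<open>A graph on the vertex set {0..<n} is given by an edge predicate E.
  The rooted tree T is the triple (n, E, r).\<close>

definition adj_rel :: "nat \<Rightarrow> (nat \<Rightarrow> nat \<Rightarrow> bool) \<Rightarrow> (nat \<times> nat) set" where
  "adj_rel n E = {(u, v). u < n \<and> v < n \<and> E u v}"

definition gdist :: "nat \<Rightarrow> (nat \<Rightarrow> nat \<Rightarrow> bool) \<Rightarrow> nat \<Rightarrow> nat \<Rightarrow> nat" where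
  "gdist n E u v = (LEAST k. (u, v) \<in> (adj_rel n E) ^^ k)"

definition edges :: "nat \<Rightarrow> (nat \<Rightarrow> nat \<Rightarrow> bool) \<Rightarrow> (nat \<times> nat) set" where
  "edges n E = {(u, v). u < v \<and> v < n \<and> E u v}"

definition is_tree :: "nat \<Rightarrow> (nat \<Rightarrow> nat \<Rightarrow> bool) \<Rightarrow> bool" where
  "is_tree n E \<longleftrightarrow> n \<ge> 1
     \<and> (\<forall>u v. E u v \<longrightarrow> u < n \<and> v < n \<and> u \<noteq> v \<and> E v u)
     \<and> (\<forall>u<n. \<forall>v<n. \<exists>k. (u, v) \<in> (adj_rel n E) ^^ k)
     \<and> card (edges n E) = n - 1"

definition is_rooted_tree :: "nat \<Rightarrow> (nat \<Rightarrow> nat \<Rightarrow> bool) \<Rightarrow> nat \<Rightarrow> bool" where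
  "is_rooted_tree n E r \<longleftrightarrow> is_tree n E \<and> r < n"

definition degree :: "nat \<Rightarrow> (nat \<Rightarrow> nat \<Rightarrow> bool) \<Rightarrow> nat \<Rightarrow> nat" where
  "degree n E v = card {u. u < n \<and> E v u}"

definition is_leaf :: "nat \<Rightarrow> (nat \<Rightarrow> nat \<Rightarrow> bool) \<Rightarrow> nat \<Rightarrow> nat \<Rightarrow> bool" where
  "is_leaf n E r v \<longleftrightarrow> v < n \<and> v \<noteq> r \<and> degree n E v = 1"

text \<open>y is a child of the adjacent vertex z: the (unique) root-to-y path passes
  through z, i.e. z is adjacent to y and closer to the root.\<close>
definition is_child :: "nat \<Rightarrow> (nat \<Rightarrow> nat \<Rightarrow> bool) \<Rightarrow> nat \<Rightarrow> nat \<Rightarrow> nat \<Rightarrow> bool" where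
  "is_child n E r y z \<longleftrightarrow> y < n \<and> z < n \<and> E z y \<and> gdist n E r z < gdist n E r y"

definition children :: "nat \<Rightarrow> (nat \<Rightarrow> nat \<Rightarrow> bool) \<Rightarrow> nat \<Rightarrow> nat \<Rightarrow> nat set" where
  "children n E r z = {y. is_child n E r y z}"

definition is_hedge :: "nat \<Rightarrow> (nat \<Rightarrow> nat \<Rightarrow> bool) \<Rightarrow> nat \<Rightarrow> bool" where
  "is_hedge n E r \<longleftrightarrow> is_rooted_tree n E r \<and>
     (n = 1 \<or> (\<forall>u v. is_leaf n E r u \<and> is_leaf n E r v \<longrightarrow> gdist n E r u = gdist n E r v))"

definition hgt :: "nat \<Rightarrow> (nat \<Rightarrow> nat \<Rightarrow> bool) \<Rightarrow> nat \<Rightarrow> nat \<Rightarrow> nat" where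
  "hgt n E r u = Min {gdist n E u v | v. is_leaf n E r v}"

definition hedge_height :: "nat \<Rightarrow> (nat \<Rightarrow> nat \<Rightarrow> bool) \<Rightarrow> nat \<Rightarrow> nat" where
  "hedge_height n E r = hgt n E r r"

definition Vlev :: "nat \<Rightarrow> (nat \<Rightarrow> nat \<Rightarrow> bool) \<Rightarrow> nat \<Rightarrow> nat \<Rightarrow> nat set" where
  "Vlev n E r i = {u. u < n \<and> hgt n E r u = i}"

definition ell :: "nat \<Rightarrow> (nat \<Rightarrow> nat \<Rightarrow> bool) \<Rightarrow> nat \<Rightarrow> nat \<Rightarrow> int" where
  "ell n E r i = int (card (Vlev n E r (i - 1))) - int (card (Vlev n E r i))"

definition is_lush :: "nat \<Rightarrow> (nat \<Rightarrow> nat \<Rightarrow> bool) \<Rightarrow> nat \<Rightarrow> bool" where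
  "is_lush n E r \<longleftrightarrow> is_hedge n E r \<and>
     (\<forall>u<n. hgt n E r u \<ge> 2 \<longrightarrow> card (children n E r u) \<ge> 3) \<and>
     (\<forall>u<n. hgt n E r u = 1 \<longrightarrow> card (children n E r u) \<ge> 2)"

text \<open>sum of ell_i over i >= j with i congruent j mod p.  Since heights are < n,
  ell_i = 0 for i > n + 1, so the sum is truncated at n + 1 without loss.\<close>
definition ell_sum :: "nat \<Rightarrow> (nat \<Rightarrow> nat \<Rightarrow> bool) \<Rightarrow> nat \<Rightarrow> nat \<Rightarrow> nat \<Rightarrow> int" where
  "ell_sum n E r p j = (\<Sum>i\<in>{i. j \<le> i \<and> i \<le> n + 1 \<and> i mod p = j mod p}. ell n E r i)"

definition S_T :: "nat \<Rightarrow> (nat \<Rightarrow> nat \<Rightarrow> bool) \<Rightarrow> real mat set" where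
  "S_T n E = {A. A \<in> carrier_mat n n \<and> A\<^sup>T = A \<and>
      (\<forall>i<n. \<forall>j<n. i \<noteq> j \<longrightarrow> (A $$ (i, j) \<noteq> 0 \<longleftrightarrow> E i j))}"

definition spec_mset :: "real mat \<Rightarrow> real multiset" where
  "spec_mset A = proots (char_poly A)"

definition mult :: "real \<Rightarrow> real mat \<Rightarrow> nat" where
  "mult x A = count (spec_mset A) x"

definition mult_list :: "real mat \<Rightarrow> nat list" where
  "mult_list A = map (\<lambda>x. mult x A) (sorted_list_of_set (set_mset (spec_mset A)))"

definition crit_witness :: "nat \<Rightarrow> (nat \<Rightarrow> nat \<Rightarrow> bool) \<Rightarrow> nat \<Rightarrow> real mat
     \<Rightarrow> real \<Rightarrow> real \<Rightarrow> real \<Rightarrow> real \<Rightarrow> real \<Rightarrow> bool" where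
  "crit_witness n E r A a1 a2 b2 b3 b4 \<longleftrightarrow>
     distinct [a1, a2, b2, b3, b4] \<and>
     int (mult a1 A) \<ge> ell_sum n E r 2 1 \<and>
     int (mult a2 A) \<ge> ell_sum n E r 2 2 \<and>
     int (mult b2 A) \<ge> ell_sum n E r 3 2 \<and>
     int (mult b3 A) \<ge> ell_sum n E r 3 3 \<and>
     int (mult b4 A) \<ge> ell_sum n E r 3 4 \<and>
     int (mult b4 A) < ell n E r 3"

definition rig_prop :: "nat \<Rightarrow> (nat \<Rightarrow> nat \<Rightarrow> bool) \<Rightarrow> nat \<Rightarrow> real mat \<Rightarrow> bool" where
  "rig_prop n E r A \<longleftrightarrow> (\<exists>a1 a2 b2 b3 b4 l37 l48 l49.
     distinct [a1, a2, b2, b3, b4, l37, l48, l49] \<and>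
     crit_witness n E r A a1 a2 b2 b3 b4 \<and>
     int (mult l37 A) \<ge> ell n E r 3 + ell n E r 7 \<and>
     int (mult l48 A) \<ge> ell n E r 4 + ell n E r 8 \<and>
     int (mult l49 A) \<ge> ell n E r 4 + ell n E r 9)"

end

(*
Eliminate x - A on the rooted tree from the leaves upwards. The pivots are increasing rational functions of x
whose product is the characteristic polynomial, so the multiplicity of an eigenvalue is the number of vertices
where the pivot vanishes there minus the number of vertices where it has a pole. On a lush hedge the
witnesses of a critical multiplicity list attain the largest possible surplus of zeros, one after the
other, and the only zero patterns doing so are periodic in the level. Solving for the matrix data, level by
level, shows that diagonal entries and sums of squared edge weights depend on the level only and are explicit
functions of the five witnesses. After an affine normalisation three parameters remain, and the three further
eigenvalues give three polynomial equations. Eliminating one parameter and parametrising a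
hyperboloid by its rulings turns these into two plane curves, which meet in exactly one point of the
admissible region. Hence the spectrum is unique up to an affine map.
*)

theory Submission
  imports Defs
begin

text \<open>Count levels from the leaves. If the pivots of a whole level k vanish, level k + 1
  consists of poles, so this level contributes |V_k| - |V_{k+1}| = ell_{k+1}. A witness alpha_j or
  beta_j thus asks for zeros on every second or third level from level j - 1 on, and lambda_{i,j}
  for zeros on levels i - 1 and j - 1. Where a pivot vanishes above poles only, the eigenvalue is
  the diagonal entry; so the alphas give the diagonal outside level 1, and the betas then give the
  weights. The obstacle is that the level 2 pivot has a further zero besides alpha_1 and beta_3,
  which beta_4 might occupy; mult(beta_4) < ell_3 excludes this, and lambda_{3,7} has to lie there.
  The map that normalises alpha_1, alpha_2 to 0, 1 may reverse the order, hence the alternative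
  between B and -B in (2). In (3) equal ordered lists carry the witnesses of A to witnesses of B in
  increasing order, so that the affine factor is positive.\<close>

section \<open>Inequalities for the two plane curves\<close>

lemma frac_leI: "\<lbrakk>(b::real) > 0; d > 0; a * d \<le> c * b\<rbrakk> \<Longrightarrow> a / b \<le> c / d"
  by (simp add: pos_divide_le_eq pos_le_divide_eq mult.commute)

definition pqdom :: "real \<Rightarrow> real \<Rightarrow> bool" where
  "pqdom p q \<longleftrightarrow> 0 < q \<and> q < p \<and> p < 1"

text \<open>The extra condition makes p + q + p q - 1 positive, the common denominator of the
  parametrisation by rulings.\<close>

definition pqdom' :: "real \<Rightarrow> real \<Rightarrow> bool" where
  "pqdom' p q \<longleftrightarrow> pqdom p q \<and> p + q + p * q > 1"

text \<open>Among these expressions are factors of the two curve equations, which occur as arguments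
  of logarithms below.\<close>

lemma pqdom_pos:
  assumes "pqdom p q"
  shows "0 < q" "q < p" "p < 1" "q < 1" "0 < p" "0 < p + q" "0 < 1 - p * q" "0 < 1 - q" "0 < 1 - p"
    "0 < p - q" "0 < 2 - p - q" "0 < p + q - 2 * p * q" "0 < 1 + 2 * p * q - q"
proof -
  show *: "0 < q" "q < p" "p < 1" "q < 1" "0 < p" "0 < p + q" "0 < 1 - q" "0 < 1 - p" "0 < p - q" "0 < 2 - p - q"
    using assms by (auto simp: pqdom_def)
  have "p * q < 1 * 1" by (rule mult_strict_mono) (use * in auto)
  then show "0 < 1 - p * q" by simp
  have "0 < p * (1 - q) + q * (1 - p)" using * by (intro add_pos_pos mult_pos_pos) auto
  then show "0 < p + q - 2 * p * q" by (simp add: algebra_simps)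
  have "0 < 2 * p * q + (1 - q)" using * by (intro add_pos_pos mult_pos_pos) auto
  then show "0 < 1 + 2 * p * q - q" by simp
qed

lemma pqdom'_pos:
  assumes "pqdom' p q"
  shows "0 < 2 * p + p * q - 1" "p + q > 4/5" "2 * p + p * q - 1 = p * (p + q) - (1 - p)^2"
proof -
  have d: "pqdom p q" and D: "p + q + p * q > 1" using assms by (auto simp: pqdom'_def)
  note pos = pqdom_pos[OF d]
  show "0 < 2 * p + p * q - 1" using D pos by simp
  show "2 * p + p * q - 1 = p * (p + q) - (1 - p)^2" by (simp add: power2_eq_square algebra_simps)
  \<comment> \<open>Since p q is at most (p + q)^2 / 4, a sum p + q of at most 4/5 would give p + q
    + p q <= 24/25. The exact threshold is 2 sqrt 2 - 2, about 0.828.\<close>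
  show "p + q > 4/5"
  proof (rule ccontr)
    assume c: "\<not> p + q > 4/5"
    have "0 \<le> (p - q)^2" by simp
    then have "4 * (p * q) \<le> (p + q)^2" by (simp add: power2_eq_square algebra_simps)
    also have "(p + q)^2 \<le> 4/5 * (p + q)"
      unfolding power2_eq_square using c pos by (intro mult_right_mono) auto
    finally show False using D c by simp
  qed
qed

text \<open>The expression is the partial derivative of \<open>h1\<close> in p. Each negative term
  is dominated by a positive one: 1/p by 1/(p - q), and q/(1 - p q) by 2/(1 - p).\<close>

lemma h1_p_pos:
  assumes "pqdom p q"
  shows "1 / (p - q) + 1 / (p + q) - q / (1 - p * q) - 1 / p + 2 / (1 - p) > 0"
proof -
  note pos = pqdom_pos[OF assms]
  have "1 / p \<le> 1 / (p - q)" using pos by (intro frac_leI) auto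
  moreover have "q / (1 - p * q) \<le> 2 / (1 - p)"
  proof (rule frac_leI)
    have "q * (1 - p) \<le> 1 * (1 - p)" using pos by (intro mult_right_mono) auto
    moreover have "p * q \<le> p * 1" using pos by (intro mult_left_mono) auto
    ultimately show "q * (1 - p) \<le> 2 * (1 - p * q)"
      using pos unfolding right_diff_distrib by linarith
  qed (use pos in auto)
  moreover have "1 / (p + q) > 0" using pos by simp
  ultimately show ?thesis by linarith
qed

text \<open>The partial derivative of \<open>h1\<close> in q. The pair 1/(1 - q) - p/(1 - p q) stays
  below 1/(1 - p q), which the other three terms outweigh.\<close>

lemma h1_q_neg:
  assumes "pqdom p q"
  shows "- 1 / (p - q) + 1 / (p + q) - p / (1 - p * q) - 1 / q + 1 / (1 - q) < 0"
proof -
  note pos = pqdom_pos[OF assms]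
  have e1: "- 1 / (p - q) + 1 / (p + q) - 1 / q = - ((p^2 + q^2) / (q * (p^2 - q^2)))"
  proof -
    have "p^2 - q^2 = (p - q) * (p + q)" by (simp add: power2_eq_square algebra_simps)
    then show ?thesis using pos by (simp add: divide_simps power2_eq_square)
  qed
  have e2: "1 / (1 - q) - p / (1 - p * q) = (1 - p) / ((1 - q) * (1 - p * q))"
    using pos by (simp add: divide_simps) (simp add: algebra_simps)
  have "(1 - p) / ((1 - q) * (1 - p * q)) < 1 / (1 - p * q)"
    using pos by (simp add: divide_simps)
  also have "\<dots> \<le> (p^2 + q^2) / (q * (p^2 - q^2))"
  proof (rule frac_leI)
    have "q^2 < p^2" using pos by (intro power_strict_mono) auto
    then show "0 < q * (p^2 - q^2)" using pos by simp
    have "0 \<le> (p - q)^2" by simp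
    then have a: "2 * (p * q) \<le> p^2 + q^2" by (simp add: power2_eq_square algebra_simps)
    have b: "p * (p * q) \<le> 1 * (p * q)" using pos by (intro mult_right_mono) auto
    have "p * (p * (p * q)) \<le> 1 * (p * (p * q))" using pos by (intro mult_right_mono) auto
    then have b2: "p * (p * (p * q)) \<le> p * q" using b by simp
    have b3: "p * q ^ 3 \<le> 1 * q ^ 3" using pos by (intro mult_right_mono) auto
    show "1 * (q * (p^2 - q^2)) \<le> (p^2 + q^2) * (1 - p * q)"
      using a b b2 b3 by (simp add: power2_eq_square power3_eq_cube algebra_simps)
  qed (use pos in auto)
  finally show ?thesis using e1 e2 by linarith
qed

text \<open>The derivative of \<open>h1\<close> in direction (1,1), along which ln (p - q) is
  constant. The condition p + q + p q > 1 enters through the bound on 1/q.\<close>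

lemma h1_diag_pos:
  assumes "pqdom' p q"
  shows "2 / (p + q) - (p + q) / (1 - p * q) - 1 / p - 1 / q + 2 / (1 - p) + 1 / (1 - q) > 0"
proof -
  have d: "pqdom p q" and D: "p + q + p * q > 1" using assms by (auto simp: pqdom'_def)
  note pos = pqdom_pos[OF d]
  have e1: "1 / p < 2 / (p + q)" using pos by (simp add: divide_simps)
  have e2: "1 / q \<le> 2 / (1 - p) - 1"
  proof -
    have "1 / q \<le> (1 + p) / (1 - p)" using pos D by (intro frac_leI) (auto simp: algebra_simps)
    also have "\<dots> = 2 / (1 - p) - 1" using pos by (simp add: divide_simps)
    finally show ?thesis .
  qed
  show ?thesis
  proof (cases "q \<ge> 1/2")
    case True
    have "(p + q) / (1 - p * q) \<le> 2 / ((1 - p) + (1 - q))"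
    proof (rule frac_leI)
      have "2 * (1 - p * q) - (p + q) * ((1 - p) + (1 - q)) = (1 - p)^2 + (1 - q)^2"
        by (simp add: power2_eq_square algebra_simps)
      moreover have "(1 - p)^2 + (1 - q)^2 \<ge> 0" by simp
      ultimately show "(p + q) * ((1 - p) + (1 - q)) \<le> 2 * (1 - p * q)" by linarith
    qed (use pos in auto)
    also have "\<dots> \<le> 2 / ((1 - p) + (1 - p))" using pos by (intro frac_leI) auto
    also have "\<dots> = 1 / (1 - p)" using pos by (simp add: field_simps)
    finally have a: "(p + q) / (1 - p * q) \<le> 1 / (1 - p)" .
    have b: "1 / q \<le> 2" using True by (simp add: divide_simps)
    have c: "1 / (1 - q) > 1" "1 / (1 - p) > 1/(1-q)" using pos by (simp_all add: divide_simps)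
    have "1 / (1 - q) \<ge> 2" using True pos by (simp add: divide_simps)
    moreover have "2 / (1 - p) = 1 / (1 - p) + 1 / (1 - p)" by simp
    ultimately show ?thesis using a b c e1 by linarith
  next
    case False
    have "(p + q) / (1 - p * q) \<le> (2 - q) / (1 - q)"
    proof (rule frac_leI)
      have "0 \<le> (1 - q) * (1 - 2 * q)" using False pos by (intro mult_nonneg_nonneg) auto
      moreover have "0 \<le> (1 - p) * (1 + q - q^2)"
      proof -
        have "q * q \<le> 1 * 1" using pos by (intro mult_mono) auto
        then show ?thesis using pos by (intro mult_nonneg_nonneg) (auto simp: power2_eq_square)
      qed
      ultimately show "(p + q) * (1 - q) \<le> (2 - q) * (1 - p * q)"
        by (simp add: power2_eq_square algebra_simps)
    qed (use pos in auto)
    also have "\<dots> = 1 + 1 / (1 - q)" using pos by (simp add: divide_simps)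
    finally show ?thesis using e1 e2 by linarith
  qed
qed

text \<open>The derivative of \<open>hG\<close> in direction (1,1). Four groups of terms have the
  lower bounds -3, -4/p, 4/5 and 11/5 + 4/p, which add up to 0; the last bound is strict.\<close>

lemma hG_diag_pos:
  assumes "pqdom' p q"
  shows "3 / p + 1 / q - 3 / (1 - q) + 2 * (2 * p + 2 * q - 1) / (1 + 2 * p * q - q) - 4 / (2 - p - q)
     + 2 * (2 + p + q) / (2 * p + p * q - 1) - 6 / (p + q) + 3 * (p + q) / (1 - p * q)
     - 4 * (1 - p - q) / (p + q - 2 * p * q) > 0"
proof -
  have d: "pqdom p q" using assms by (auto simp: pqdom'_def)
  note pos = pqdom_pos[OF d] pqdom'_pos[OF assms]
  have i: "3 * (p + q) / (1 - p * q) - 3 / (1 - q) \<ge> - 3"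
  proof -
    have "q / (1 - q) \<le> (p + q) / (1 - p * q)"
    proof (rule frac_leI)
      have "q * (q * (1 - p)) \<le> 1 * (q * (1 - p))" using pos by (intro mult_right_mono) auto
      moreover have "q * (1 - p) \<le> p * (1 - q)" using pos by (simp add: algebra_simps)
      ultimately show "q * (1 - p * q) \<le> (p + q) * (1 - q)" by (simp add: algebra_simps)
    qed (use pos in auto)
    moreover have "q / (1 - q) = 1 / (1 - q) - 1" using pos by (simp add: divide_simps)
    moreover have "3 * (p + q) / (1 - p * q) = 3 * ((p + q) / (1 - p * q))" "3 / (1 - q) = 3 * (1 / (1 - q))"
      by simp_all
    ultimately show ?thesis by linarith
  qed
  have ii: "- 4 * (1 - p - q) / (p + q - 2 * p * q) - 4 / (2 - p - q) \<ge> - 4 / p"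
  proof -
    have "1 / (2 - p - q) \<le> (p^2 - p * q + q) / (p * (p + q - 2 * p * q))"
    proof (rule frac_leI)
      have "(p^2 - p * q + q) * (2 - p - q) - 1 * (p * (p + q - 2 * p * q))
          = (1 - p) * ((p - q) * q + 2 * (1 - p) * q + p * (p - q))"
        by (simp add: power2_eq_square algebra_simps)
      moreover have "0 \<le> (1 - p) * ((p - q) * q + 2 * (1 - p) * q + p * (p - q))"
        using pos by (intro mult_nonneg_nonneg add_nonneg_nonneg) auto
      ultimately show "1 * (p * (p + q - 2 * p * q)) \<le> (p^2 - p * q + q) * (2 - p - q)" by simp
    qed (use pos in auto)
    also have "\<dots> = 1 / p - (1 - p - q) / (p + q - 2 * p * q)"
      using pos by (simp add: divide_simps) (simp add: power2_eq_square algebra_simps)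
    finally have "1 / (2 - p - q) \<le> 1 / p - (1 - p - q) / (p + q - 2 * p * q)" .
    moreover have g: "- 4 * u / w = - (4 * (u / w))" "4 / w = 4 * (1 / w)" "- 4 / w = - (4 * (1 / w))" for u w :: real
      by simp_all
    ultimately show ?thesis unfolding g by linarith
  qed
  have iii: "3 / p + 1 / q - 6 / (p + q) \<ge> 4/5"
  proof -
    have "3 / p + 1 / q - 6 / (p + q) = (p^2 - 2 * p * q + 3 * q^2) / (p * q * (p + q))"
      using pos by (simp add: divide_simps) (simp add: power2_eq_square algebra_simps)
    also have "\<dots> \<ge> 4 / 5"
    proof (rule frac_leI)
      have "p * (q * (p + q)) \<le> 1 * (q * (p + q))" using pos by (intro mult_right_mono) auto
      \<comment> \<open>This completes the square in 5 (5 p^2 - 14 p q + 11 q^2), where 5 p^2 - 14 p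
        q + 11 q^2 is the difference of the two sides once p (q (p + q)) is replaced by q (p +
        q).\<close>
      moreover have "0 \<le> (5 * p - 7 * q)^2 + 6 * q^2" by simp
      then have "0 \<le> 25 * p^2 - 70 * (p * q) + 55 * q^2" by (simp add: power2_eq_square algebra_simps)
      ultimately show "4 * (p * q * (p + q)) \<le> (p^2 - 2 * p * q + 3 * q^2) * 5"
        by (simp add: power2_eq_square algebra_simps)
    qed (use pos in auto)
    finally show ?thesis .
  qed
  have X2: "2 * (2 + p + q) / (2 * p + p * q - 1) \<ge> 2 / p + 4 / (p * (p + q))"
  proof -
    have "2 / p + 4 / (p * (p + q)) = 2 * (2 + p + q) / (p * (p + q))"
      using pos by (simp add: divide_simps)
    also have "\<dots> \<le> 2 * (2 + p + q) / (2 * p + p * q - 1)"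
      using pos by (intro divide_left_mono mult_pos_pos) (auto intro: mult_nonneg_nonneg)
    finally show ?thesis .
  qed
  have iv: "2 * (2 * p + 2 * q - 1) / (1 + 2 * p * q - q) + 2 * (2 + p + q) / (2 * p + p * q - 1) > 11/5 + 4 / p"
  proof (cases "p \<ge> 1/2")
    case True
    have "q * (2 * p - 1) \<le> 1 * (2 * p - 1)" using pos True by (intro mult_right_mono) auto
    then have "2 * (2 * p + 2 * q - 1) / (2 * p) \<le> 2 * (2 * p + 2 * q - 1) / (1 + 2 * p * q - q)"
      using pos by (intro divide_left_mono mult_pos_pos) (auto simp: algebra_simps)
    moreover have "2 * (2 * p + 2 * q - 1) / (2 * p) = (2 * (p + q) - 1) / p" using pos by (simp add: divide_simps)
    moreover have "11/5 + 4 / p < 2 / p + 4 / (p * (p + q)) + (2 * (p + q) - 1) / p"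
    proof -
      define s where "s = p + q"
      have s: "s > 0" using pos by (simp add: s_def)
      \<comment> \<open>The minimum of 4/s + 2 s is 4 sqrt 2, attained at s = sqrt 2. The rationals
        7/5 and 28/5 stand in for sqrt 2 and 4 sqrt 2.\<close>
      have "0 \<le> (s - 7/5)^2" by simp
      then have "14/5 * s \<le> s^2 + 49/25" by (simp add: power2_eq_square algebra_simps)
      then have "(28/5) * s < 4 + 2 * s^2" by simp
      then have "28/5 < 4 / s + 2 * s" using s by (simp add: divide_simps power2_eq_square)
      then have "11/5 * p + 4 < 2 + 4 / s + (2 * s - 1)" using pos by simp
      then have "(11/5 * p + 4) / p < (2 + 4 / s + (2 * s - 1)) / p" using pos by (intro divide_strict_right_mono)
      moreover have "(11/5 * p + 4) / p = 11/5 + 4 / p" using pos by (simp add: add_divide_distrib)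
      moreover have "(2 + 4 / s + (2 * s - 1)) / p = 2 / p + 4 / (p * s) + (2 * s - 1) / p"
        by (simp only: add_divide_distrib divide_divide_eq_left mult.commute)
      ultimately show ?thesis by (simp add: s_def)
    qed
    ultimately show ?thesis using X2 by linarith
  next
    case False
    have "4 / p \<le> 4 / (p * (p + q))" using pos False by (intro divide_left_mono mult_pos_pos) auto
    moreover have "4 < 2 / p" using False pos by (simp add: divide_simps)
    moreover have "2 * (2 * p + 2 * q - 1) / (1 + 2 * p * q - q) > 0"
      using pos by (intro divide_pos_pos) auto
    ultimately show ?thesis using X2 by linarith
  qed
  show ?thesis using i ii iii iv by linarith
qed


lemma sum_ab_bound:
  assumes "pqdom' p q"
  shows "2 * ((1 - p) + (1 - q)) < 2 + (1 - p) * (1 - q)"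
  using assms by (simp add: pqdom'_def algebra_simps)

text \<open>The partial derivative of \<open>hG\<close> in q. Besides 1/q >= 1/p, three groups of
  terms have the lower bounds 1/2, -1/p and -1/2, the last one strict.\<close>

lemma hG_q_pos:
  assumes "pqdom' p q"
  shows "1 / q - 3 / (1 - q) + 2 * (2 * p - 1) / (1 + 2 * p * q - q) - 2 / (2 - p - q)
     + 2 * p / (2 * p + p * q - 1) + 1 / (p - q) - 3 / (p + q) + 3 * p / (1 - p * q)
     - 2 * (1 - 2 * p) / (p + q - 2 * p * q) > 0"
proof -
  have d: "pqdom p q" using assms by (auto simp: pqdom'_def)
  note pos = pqdom_pos[OF d] pqdom'_pos[OF assms]
  define a b where "a = 1 - p" and "b = 1 - q"
  have p: "p = 1 - a" and q: "q = 1 - b" by (auto simp: a_def b_def)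
  have ab: "0 < a" "a < b" "b < 1" using pos by (auto simp: a_def b_def)
  have Dab: "2 * (a + b) < 2 + a * b" using sum_ab_bound[OF assms] by (simp add: a_def b_def)
  have s: "a + b < 6/5" using pos by (simp add: a_def b_def)
  have den: "0 < a + b - a * b" using pos by (simp add: p q algebra_simps)
  have v: "1 / (p - q) - 3 / (1 - q) + 3 * p / (1 - p * q) \<ge> 1/2"
  proof -
    have "1 / (p - q) - 3 / (1 - q) + 3 * p / (1 - p * q)
        = (3 * a^2 - 2 * a * b + b^2 - a * b^2) / (b * (b - a) * (a + b - a * b))"
    proof -
      have eqs: "p - q = b - a" "1 - q = b" "1 - p * q = a + b - a * b" by (auto simp: p q algebra_simps)
      show ?thesis unfolding eqs unfolding p
        using ab den by (simp add: divide_simps) (simp add: power2_eq_square algebra_simps)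
    qed
    also have "\<dots> \<ge> 1/2"
    proof (rule frac_leI)
      have b1: "b \<le> 1 - a / 2" using Dab ab
      proof -
        have "a * b \<le> a * 1" using ab by (intro mult_left_mono) auto
        then show ?thesis using Dab by simp
      qed
      have "b^2 * b \<le> b^2 * (1 - a / 2)" by (rule mult_left_mono[OF b1]) simp
      then have "b^2 * b * (1 - a) \<le> b^2 * (1 - a / 2) * (1 - a)"
        using ab by (intro mult_right_mono) auto
      then have k1: "b * b * b \<le> b * b + a * b * b * b - 3/2 * (a * b * b) + 1/2 * (a * a * b * b)"
        by (simp add: power2_eq_square field_simps)
      have "a * b * (a + b) \<le> a * b * (6/5)" using s ab by (intro mult_left_mono) auto
      then have k2: "a * a * b + a * b * b \<le> 6/5 * (a * b)" by (simp add: algebra_simps)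
      have k3: "a * a * b * b \<le> a * a * b * 1" using ab by (intro mult_left_mono) auto
      have "0 \<le> (23 * a - 10 * b)^2 + 71 * a^2" by simp
      then have k4: "46 * (a * b) \<le> 10 * (b * b) + 60 * (a * a)" by (simp add: power2_eq_square algebra_simps)
      have "(3 * a^2 - 2 * a * b + b^2 - a * b^2) * 2 - 1 * (b * (b - a) * (a + b - a * b))
          = 6 * (a * a) - 4 * (a * b) + 2 * (b * b) - b * b * b - 2 * (a * b * b) + a * a * b - a * a * b * b + a * b * b * b"
        by (simp add: power2_eq_square algebra_simps)
      then show "1 * (b * (b - a) * (a + b - a * b)) \<le> (3 * a^2 - 2 * a * b + b^2 - a * b^2) * 2"
        using k1 k2 k3 k4 by linarith
    qed (use ab den in auto)
    finally show ?thesis .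
  qed
  have vi: "- 2 * (1 - 2 * p) / (p + q - 2 * p * q) - 2 / (2 - p - q) \<ge> - 1 / p"
  proof -
    have "1 / (2 - p - q) \<le> (4 * p^2 - p + q - 2 * p * q) / (2 * p * (p + q - 2 * p * q))"
    proof (rule frac_leI)
      have "2 + a * b \<le> 2 + a" using ab by simp
      with Dab have "2 * (a + b) < 2 + a" by (rule less_le_trans)
      then have l1: "a + 2 * b < 2" by (simp add: algebra_simps)
      then have "3 * a < 2" using ab by simp
      then have "0 \<le> 4 - 6 * a - 2 * (b - a)" using l1 by simp
      moreover have "0 \<le> (b - a) / a" using ab by simp
      ultimately have "0 \<le> 4 - 6 * a - 2 * (b - a) + (b - a) / a" by linarith
      then have "0 \<le> (b - a) * a * (4 - 6 * a - 2 * (b - a) + (b - a) / a)"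
        using ab by (intro mult_nonneg_nonneg) auto
      also have "\<dots> = (b - a) * (4 * a - 6 * a^2 - 2 * a * (b - a) + (b - a))"
        using ab by (simp add: field_simps power2_eq_square)
      also have "\<dots> = (4 * p^2 - p + q - 2 * p * q) * (2 - p - q) - 1 * (2 * p * (p + q - 2 * p * q))"
        by (simp add: p q power2_eq_square algebra_simps)
      finally show "1 * (2 * p * (p + q - 2 * p * q)) \<le> (4 * p^2 - p + q - 2 * p * q) * (2 - p - q)" by simp
    qed (use pos in auto)
    also have "\<dots> = 1 / (2 * p) - (1 - 2 * p) / (p + q - 2 * p * q)"
      using pos by (simp add: divide_simps) (simp add: power2_eq_square algebra_simps)
    finally have "1 / (2 - p - q) \<le> 1 / (2 * p) - (1 - 2 * p) / (p + q - 2 * p * q)" .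
    moreover have g: "- 2 * u / w = - (2 * (u / w))" "2 / w = 2 * (1 / w)" "- 1 / w = - (2 * (1 / (2 * w)))" for u w :: real
      by simp_all
    ultimately show ?thesis unfolding g by linarith
  qed
  define s e c where "s = p + q" and "e = 1 + 2 * p * q - q" and "c = 2 * p + p * q - 1"
  have pse: "0 < s" "0 < e" "0 < c" "4/5 < s" "s < 2 * p" "c = p * s - (1 - p)^2"
    using pos by (simp_all add: s_def e_def c_def)
  have vii: "2 * (2 * p - 1) / e + 2 * p / c - 3 / s > - 1/2"
  proof -
    \<comment> \<open>The numerator of the claim \<open>vii\<close> over the common denominator e c
      s, after replacing p s by c + (1 - p)^2.\<close>
    have N: "c * (2 * (2 * p - 1) * s - e * (1 - s / 2)) + 2 * e * (1 - p)^2 > 0"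
    proof (cases "p \<ge> 1/2")
      case True
      have e2: "e \<le> 2 * p"
      proof -
        have "q * (2 * p - 1) \<le> 1 * (2 * p - 1)" using pos True by (intro mult_right_mono) auto
        then show ?thesis by (simp add: e_def algebra_simps)
      qed
      have key: "p * s - 5/2 * p * s^2 + s^2 < 2 * (1 - p)^2"
      proof -
        \<comment> \<open>As a function of s the left side of \<open>key\<close> is concave; it lies
          below its tangent at s = 4/5, the lower bound for s.\<close>
        have "0 \<le> (5/2 * p - 1) * (s - 4/5)^2" using True by (intro mult_nonneg_nonneg) auto
        moreover have "(5/2 * p - 1) * (s - 4/5)^2
            = s * (8/5 - 3 * p) + 8/5 * p - 16/25 - (p * s - 5/2 * p * s^2 + s^2)"
          by (simp add: power2_eq_square field_simps)
        ultimately have l: "p * s - 5/2 * p * s^2 + s^2 \<le> s * (8/5 - 3 * p) + 8/5 * p - 16/25"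
          by linarith
        show ?thesis
        proof (cases "8/5 - 3 * p \<le> 0")
          case True
          then have "s * (8/5 - 3 * p) \<le> 4/5 * (8/5 - 3 * p)" using pse by (intro mult_right_mono_neg) auto
          moreover have "0 \<le> (p - 4/5)^2" by simp
          then have "0 \<le> p^2 - 8/5 * p + 16/25" by (simp add: power2_eq_square algebra_simps)
          ultimately show ?thesis using l by (simp add: power2_eq_square algebra_simps)
        next
          case False
          \<comment> \<open>Here p < 8/15, so s < 2 p < 11/10.\<close>
          then have "s * (8/5 - 3 * p) \<le> 11/10 * (8/5 - 3 * p)" using pse by (intro mult_right_mono) auto
          moreover have "0 \<le> (p - 1/2)^2" by simp
          then have "0 \<le> p^2 - p + 1/4" by (simp add: power2_eq_square algebra_simps)
          ultimately show ?thesis using l False \<open>p \<ge> 1/2\<close> by (simp add: power2_eq_square algebra_simps)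
        qed
      qed
      show ?thesis
      proof (cases "p - 5/2 * p * s + s \<ge> 0")
        case nn: True
        have "c * (p - 5/2 * p * s + s) \<le> p * s * (p - 5/2 * p * s + s)"
          using nn pse by (intro mult_right_mono) auto
        also have "\<dots> = p * (p * s - 5/2 * p * s^2 + s^2)" by (simp add: power2_eq_square algebra_simps)
        also have "\<dots> < p * (2 * (1 - p)^2)" using key pos by (intro mult_strict_left_mono) auto
        finally have k: "0 < 2 * p * (1 - p)^2 - c * (p - 5/2 * p * s + s)" by simp
        have "0 < e * (2 * p * (1 - p)^2 - c * (p - 5/2 * p * s + s))" using k pse by simp
        moreover have "c * ((2 * p - 1) * s) * e \<le> c * ((2 * p - 1) * s) * (2 * p)"
          using e2 True pse by (intro mult_left_mono) auto
        ultimately have "0 < p * (c * (2 * (2 * p - 1) * s - e * (1 - s / 2)) + 2 * e * (1 - p)^2)"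
          by (simp add: algebra_simps)
        then show ?thesis using pos by (simp add: zero_less_mult_iff)
      next
        case neg: False
        have "c * ((2 * p - 1) * s) * e \<le> c * ((2 * p - 1) * s) * (2 * p)"
          using e2 True pse by (intro mult_left_mono) auto
        moreover have "0 < e * c * - (p - 5/2 * p * s + s)" using neg pse by (intro mult_pos_pos) auto
        moreover have "0 \<le> p * e * (1 - p)^2" using pos pse by simp
        ultimately have "0 < p * (c * (2 * (2 * p - 1) * s - e * (1 - s / 2)) + 2 * e * (1 - p)^2)"
          by (simp add: algebra_simps)
        then show ?thesis using pos by (simp add: zero_less_mult_iff)
      qed
    next
      case False
      have p25: "2/5 < p" using pse by simp
      have s1: "s < 1" using pse False by simp
      have "q * (1 - 2 * p) \<le> 1/2 * (1/5)" using False p25 pos by (intro mult_mono) auto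
      then have e9: "9/10 \<le> e" by (simp add: e_def algebra_simps)
      have a2: "1/4 \<le> (1 - p)^2"
        using power_mono[of "1/2" "1 - p" 2] False by (simp add: power2_eq_square)
      have "p * s \<le> 1/2 * 1" using False s1 pos pse by (intro mult_mono) auto
      then have c4: "c \<le> 1/4" using pse a2 by simp
      have "2 * (1 - 2 * p) * s \<le> 2 * (1/5) * 1" using p25 s1 pse False by (intro mult_mono) auto
      then have f1: "c * (2 * (1 - 2 * p) * s) \<le> 1/4 * (2/5)" using c4 pse False by (intro mult_mono) auto
      have f2: "c * (e * (1 - s / 2)) \<le> 1/4 * (e * 1)" using c4 pse s1 by (intro mult_mono) auto
      have f3: "2 * e * (1/4) \<le> 2 * e * (1 - p)^2" using a2 pse by (intro mult_left_mono) auto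
      have "c * (2 * (2 * p - 1) * s - e * (1 - s / 2))
          = - (c * (2 * (1 - 2 * p) * s)) - c * (e * (1 - s / 2))" by (simp add: algebra_simps)
      then show ?thesis using e9 f1 f2 f3 by linarith
    qed
    have "2 * (2 * p - 1) / e + 2 * p / c - 3 / s + 1/2
        = (2 * (2 * p - 1) * c * s + 2 * p * e * s - 3 * e * c + e * c * s / 2) / (e * c * s)"
      using pse(1-3) by (simp add: divide_simps) (simp add: algebra_simps)
    also have "2 * (2 * p - 1) * c * s + 2 * p * e * s - 3 * e * c + e * c * s / 2
        = c * (2 * (2 * p - 1) * s - e * (1 - s / 2)) + 2 * e * (1 - p)^2 + 2 * e * (p * s - (1 - p)^2 - c)"
      by (simp add: power2_eq_square algebra_simps)
    also have "\<dots> = c * (2 * (2 * p - 1) * s - e * (1 - s / 2)) + 2 * e * (1 - p)^2"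
      using pse(6) by simp
    also have "\<dots> / (e * c * s) > 0" using N pse by (intro divide_pos_pos mult_pos_pos) auto
    finally show ?thesis by simp
  qed
  have "1 / p \<le> 1 / q" using pos by (intro frac_leI) auto
  then show ?thesis using v vi vii unfolding s_def e_def c_def by linarith
qed

section \<open>The intersection point of the two plane curves\<close>

text \<open>Dividing the two sides of the equation in curve (of curve') gives a quotient R1 (R2) that is 1 at a
  solution; h1 is ln (4 R1) and hG is ln (R2^2 / R1^3). The exponents are chosen such that hG
  increases both along the diagonal and with q, while the level line h1 = ln 4 rises with slope less than 1,
  so that hG is strictly monotone on that line.\<close>
definition h1 :: "real \<Rightarrow> real \<Rightarrow> real" where
  "h1 p q = ln (p - q) + ln (p + q) + ln (1 - p * q) - ln p - ln q - 2 * ln (1 - p) - ln (1 - q)"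

definition hG :: "real \<Rightarrow> real \<Rightarrow> real" where
  "hG p q = 3 * ln p + ln q + 3 * ln (1 - q) + 2 * ln (1 + 2 * p * q - q) + 2 * ln (2 - p - q)
     + 2 * ln (2 * p + p * q - 1) - ln (p - q) - 3 * ln (p + q) - 3 * ln (1 - p * q)
     - 2 * ln (p + q - 2 * p * q)"

text \<open>In ruling parameters and with t eliminated, this is the condition that u, v, w are the
  roots of the level 3 cubic; \<open>curve'\<close> is the condition that the level 8 pivot vanishes
  at w.\<close>

definition curve :: "real \<Rightarrow> real \<Rightarrow> bool" where
  "curve p q \<longleftrightarrow> 4 * p * q * ((1 - p) * (1 - p)) * (1 - q) = (p - q) * (p + q) * (1 - p * q)"

definition curve' :: "real \<Rightarrow> real \<Rightarrow> bool" where
  "curve' p q \<longleftrightarrow> 8 * q * ((1 - p) * (1 - p) * (1 - p)) * (p + q - 2 * p * q)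
     = (p - q) * (1 + 2 * p * q - q) * (2 - p - q) * (2 * p + p * q - 1)"

lemma DERIV_ln_comp:
  fixes g :: "real \<Rightarrow> real"
  assumes "(g has_real_derivative g') (at x)" "g x > 0"
  shows "((\<lambda>x. ln (g x)) has_real_derivative g' / g x) (at x)"
  using assms by (auto intro!: derivative_eq_intros simp: divide_inverse)

lemmas DERIV_ln_sums = DERIV_add DERIV_diff DERIV_cmult DERIV_ln_comp

lemma h1_less_p:
  assumes "pqdom p q" "p < p'" "p' < 1"
  shows "h1 p q < h1 p' q"
proof (rule DERIV_pos_imp_increasing[OF assms(2)])
  fix x assume "p \<le> x" "x \<le> p'"
  then have d: "pqdom x q" using assms by (auto simp: pqdom_def)
  note pos = pqdom_pos[OF d]
  have "((\<lambda>p. h1 p q) has_real_derivative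
      1 / (x - q) + 1 / (x + q) + (- q) / (1 - x * q) - 1 / x - 0 / q - 2 * ((- 1) / (1 - x)) - 0 / (1 - q)) (at x)"
    unfolding h1_def
    by (intro DERIV_ln_sums; (fact pos | auto intro!: derivative_eq_intros))
  moreover have "1 / (x - q) + 1 / (x + q) + (- q) / (1 - x * q) - 1 / x - 0 / q - 2 * ((- 1) / (1 - x)) - 0 / (1 - q) > 0"
    using h1_p_pos[OF d] by simp
  ultimately show "\<exists>y. ((\<lambda>p. h1 p q) has_real_derivative y) (at x) \<and> y > 0" by blast
qed

lemma h1_less_q:
  assumes "pqdom p q" "q < q'" "q' < p"
  shows "h1 p q' < h1 p q"
proof (rule DERIV_neg_imp_decreasing[OF assms(2)])
  fix x assume "q \<le> x" "x \<le> q'"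
  then have d: "pqdom p x" using assms by (auto simp: pqdom_def)
  note pos = pqdom_pos[OF d]
  have "((\<lambda>q. h1 p q) has_real_derivative
      (- 1) / (p - x) + 1 / (p + x) + (- p) / (1 - p * x) - 0 / p - 1 / x - 2 * (0 / (1 - p)) - (- 1) / (1 - x)) (at x)"
    unfolding h1_def
    by (intro DERIV_ln_sums; (fact pos | auto intro!: derivative_eq_intros))
  moreover have "(- 1) / (p - x) + 1 / (p + x) + (- p) / (1 - p * x) - 0 / p - 1 / x - 2 * (0 / (1 - p)) - (- 1) / (1 - x) < 0"
    using h1_q_neg[OF d] by simp
  ultimately show "\<exists>y. ((\<lambda>q. h1 p q) has_real_derivative y) (at x) \<and> y < 0" by blast
qed

lemma pqdom'_diag:
  assumes "pqdom' p q" "0 \<le> t" "p + t < 1"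
  shows "pqdom' (p + t) (q + t)"
proof -
  have "p * q \<le> (p + t) * (q + t)" using assms by (intro mult_mono) (auto simp: pqdom'_def pqdom_def)
  then show ?thesis using assms by (auto simp: pqdom'_def pqdom_def)
qed

lemma h1_less_diag:
  assumes "pqdom' p q" "0 < t" "p + t < 1"
  shows "h1 p q < h1 (p + t) (q + t)"
proof -
  have "(\<lambda>t. h1 (p + t) (q + t)) 0 < (\<lambda>t. h1 (p + t) (q + t)) t"
  proof (rule DERIV_pos_imp_increasing[OF assms(2)])
    fix x assume "0 \<le> x" "x \<le> t"
    then have d': "pqdom' (p + x) (q + x)" using pqdom'_diag assms by auto
    then have d: "pqdom (p + x) (q + x)" by (simp add: pqdom'_def)
    note pos = pqdom_pos[OF d]
    define P Q where "P = p + x" and "Q = q + x"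
    have "((\<lambda>t. h1 (p + t) (q + t)) has_real_derivative
        0 / (p + x - (q + x)) + 2 / (p + x + (q + x)) + (- ((p + x) + (q + x))) / (1 - (p + x) * (q + x)) - 1 / (p + x)
        - 1 / (q + x) - 2 * ((- 1) / (1 - (p + x))) - (- 1) / (1 - (q + x))) (at x)"
      unfolding h1_def
      by (intro DERIV_ln_sums; (fact pos | auto intro!: derivative_eq_intros))
    moreover have "0 / (P - Q) + 2 / (P + Q) + (- (P + Q)) / (1 - P * Q) - 1 / P
        - 1 / Q - 2 * ((- 1) / (1 - P)) - (- 1) / (1 - Q) > 0"
    proof -
      have "(- (P + Q)) / (1 - P * Q) = - ((P + Q) / (1 - P * Q))" by (simp add: minus_divide_left)
      then show ?thesis using h1_diag_pos[OF d', folded P_def Q_def] by simp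
    qed
    ultimately show "\<exists>y. ((\<lambda>t. h1 (p + t) (q + t)) has_real_derivative y) (at x) \<and> y > 0"
      unfolding P_def Q_def by blast
  qed
  then show ?thesis by simp
qed

lemma hG_less_diag:
  assumes "pqdom' p q" "0 < t" "p + t < 1"
  shows "hG p q < hG (p + t) (q + t)"
proof -
  have "(\<lambda>t. hG (p + t) (q + t)) 0 < (\<lambda>t. hG (p + t) (q + t)) t"
  proof (rule DERIV_pos_imp_increasing[OF assms(2)])
    fix x assume "0 \<le> x" "x \<le> t"
    then have d': "pqdom' (p + x) (q + x)" using pqdom'_diag assms by auto
    then have d: "pqdom (p + x) (q + x)" by (simp add: pqdom'_def)
    define P Q where "P = p + x" and "Q = q + x"
    note pos = pqdom_pos[OF d] pqdom'_pos(1)[OF d']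
    have "((\<lambda>t. hG (p + t) (q + t)) has_real_derivative
        3 * (1 / (p + x)) + 1 / (q + x) + 3 * ((- 1) / (1 - (q + x))) + 2 * ((2 * ((p + x) + (q + x)) - 1) / (1 + 2 * (p + x) * (q + x) - (q + x)))
        + 2 * ((- 2) / (2 - (p + x) - (q + x))) + 2 * ((2 + (p + x) + (q + x)) / (2 * (p + x) + (p + x) * (q + x) - 1)) - 0 / ((p + x) - (q + x)) - 3 * (2 / ((p + x) + (q + x)))
        - 3 * ((- ((p + x) + (q + x))) / (1 - (p + x) * (q + x))) - 2 * ((2 - 2 * ((p + x) + (q + x))) / ((p + x) + (q + x) - 2 * (p + x) * (q + x)))) (at x)"
      unfolding hG_def
      by (intro DERIV_ln_sums; (fact pos | auto intro!: derivative_eq_intros simp: algebra_simps))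
    moreover have "3 * (1 / P) + 1 / Q + 3 * ((- 1) / (1 - Q)) + 2 * ((2 * (P + Q) - 1) / (1 + 2 * P * Q - Q))
        + 2 * ((- 2) / (2 - P - Q)) + 2 * ((2 + P + Q) / (2 * P + P * Q - 1)) - 0 / (P - Q) - 3 * (2 / (P + Q))
        - 3 * ((- (P + Q)) / (1 - P * Q)) - 2 * ((2 - 2 * (P + Q)) / (P + Q - 2 * P * Q)) > 0"
    proof -
      have "2 * (2 - 2 * (P + Q)) = 4 * (1 - P - Q)" by simp
      then have "2 * ((2 - 2 * (P + Q)) / (P + Q - 2 * P * Q)) = 4 * (1 - P - Q) / (P + Q - 2 * P * Q)"
        by (metis times_divide_eq_right)
      moreover have "3 * ((- (P + Q)) / (1 - P * Q)) = - (3 * (P + Q) / (1 - P * Q))"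
        by (simp add: minus_divide_left)
      moreover have "2 * (2 * (P + Q) - 1) = 2 * (2 * P + 2 * Q - 1)" by simp
      then have "2 * ((2 * (P + Q) - 1) / (1 + 2 * P * Q - Q)) = 2 * (2 * P + 2 * Q - 1) / (1 + 2 * P * Q - Q)"
        by (metis times_divide_eq_right)
      moreover have "2 * ((2 + P + Q) / (2 * P + P * Q - 1)) = 2 * (2 + P + Q) / (2 * P + P * Q - 1)"
        by (metis times_divide_eq_right)
      moreover have "2 * ((- 2) / (2 - P - Q)) = - (4 / (2 - P - Q))" "3 * (2 / (P + Q)) = 6 / (P + Q)"
        "3 * (1 / P) = 3 / P" "3 * ((- 1) / (1 - Q)) = - (3 / (1 - Q))" "0 / (P - Q) = 0" by simp_all
      ultimately show ?thesis using hG_diag_pos[OF d', folded P_def Q_def] by linarith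
    qed
    ultimately show "\<exists>y. ((\<lambda>t. hG (p + t) (q + t)) has_real_derivative y) (at x) \<and> y > 0"
      unfolding P_def Q_def by blast
  qed
  then show ?thesis by simp
qed

lemma hG_less_q:
  assumes "pqdom' p q" "q < q'" "q' < p"
  shows "hG p q < hG p q'"
proof (rule DERIV_pos_imp_increasing[OF assms(2)])
  fix Q assume Q: "q \<le> Q" "Q \<le> q'"
  have "p * q \<le> p * Q" using Q assms by (intro mult_left_mono) (auto simp: pqdom'_def pqdom_def)
  then have "p + q + p * q \<le> p + Q + p * Q" using Q by (intro add_mono) auto
  then have d': "pqdom' p Q" using assms Q by (auto simp: pqdom'_def pqdom_def)
  then have d: "pqdom p Q" by (simp add: pqdom'_def)
  note pos = pqdom_pos[OF d] pqdom'_pos(1)[OF d']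
  have "((\<lambda>q. hG p q) has_real_derivative
      3 * (0 / p) + 1 / Q + 3 * ((- 1) / (1 - Q)) + 2 * ((2 * p - 1) / (1 + 2 * p * Q - Q))
      + 2 * ((- 1) / (2 - p - Q)) + 2 * (p / (2 * p + p * Q - 1)) - (- 1) / (p - Q) - 3 * (1 / (p + Q))
      - 3 * ((- p) / (1 - p * Q)) - 2 * ((1 - 2 * p) / (p + Q - 2 * p * Q))) (at Q)"
    unfolding hG_def
    by (intro DERIV_ln_sums; (fact pos | auto intro!: derivative_eq_intros simp: algebra_simps))
  moreover have "3 * (0 / p) + 1 / Q + 3 * ((- 1) / (1 - Q)) + 2 * ((2 * p - 1) / (1 + 2 * p * Q - Q))
      + 2 * ((- 1) / (2 - p - Q)) + 2 * (p / (2 * p + p * Q - 1)) - (- 1) / (p - Q) - 3 * (1 / (p + Q))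
      - 3 * ((- p) / (1 - p * Q)) - 2 * ((1 - 2 * p) / (p + Q - 2 * p * Q)) > 0"
  proof -
    have "2 * ((1 - 2 * p) / (p + Q - 2 * p * Q)) = 2 * (1 - 2 * p) / (p + Q - 2 * p * Q)"
      "2 * ((2 * p - 1) / (1 + 2 * p * Q - Q)) = 2 * (2 * p - 1) / (1 + 2 * p * Q - Q)"
      "2 * (p / (2 * p + p * Q - 1)) = 2 * p / (2 * p + p * Q - 1)"
      "3 * ((- p) / (1 - p * Q)) = - (3 * p / (1 - p * Q))"
      by (simp_all only: times_divide_eq_right minus_divide_left mult_minus_right)
    moreover have "2 * ((- 1) / (2 - p - Q)) = - (2 / (2 - p - Q))" "(- 1) / (p - Q) = - (1 / (p - Q))"
      "3 * ((- 1) / (1 - Q)) = - (3 / (1 - Q))" "3 * (1 / (p + Q)) = 3 / (p + Q)" "3 * (0 / p) = 0" by simp_all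
    ultimately show ?thesis using hG_q_pos[OF d'] by linarith
  qed
  ultimately show "\<exists>y. ((\<lambda>q. hG p q) has_real_derivative y) (at Q) \<and> y > 0" by blast
qed

lemma h1_curve:
  assumes "pqdom p q"
  shows "h1 p q = ln ((p - q) * (p + q) * (1 - p * q) / (p * q * ((1 - p) * (1 - p)) * (1 - q)))"
    and "curve p q \<longleftrightarrow> h1 p q = ln 4"
    and "4 * p * q * ((1 - p) * (1 - p)) * (1 - q) < (p - q) * (p + q) * (1 - p * q) \<longleftrightarrow> ln 4 < h1 p q"
proof -
  note pos = pqdom_pos[OF assms]
  show eq: "h1 p q = ln ((p - q) * (p + q) * (1 - p * q) / (p * q * ((1 - p) * (1 - p)) * (1 - q)))"
    using pos by (simp add: h1_def ln_mult ln_div)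
  define N X where "N = (p - q) * (p + q) * (1 - p * q)" and "X = p * q * ((1 - p) * (1 - p)) * (1 - q)"
  have X: "X > 0" "4 * p * q * ((1 - p) * (1 - p)) * (1 - q) = 4 * X"
    using pos by (simp add: X_def) (simp only: X_def mult.assoc)
  have NX: "N / X > 0" unfolding N_def using X pos by (intro divide_pos_pos mult_pos_pos) auto
  show "curve p q \<longleftrightarrow> h1 p q = ln 4"
    unfolding eq curve_def X N_def[symmetric] X_def[symmetric]
    using X ln_inj_iff[OF NX, of 4] by (auto simp: field_simps)
  show "4 * p * q * ((1 - p) * (1 - p)) * (1 - q) < (p - q) * (p + q) * (1 - p * q) \<longleftrightarrow> ln 4 < h1 p q"
    unfolding eq X N_def[symmetric] X_def[symmetric]
    using X ln_less_cancel_iff[OF _ NX, of 4] by (simp add: pos_less_divide_eq)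
qed

text \<open>Both quotients are 1 at a solution. The exponents 2 and -3 also cancel the constants, as
  8^2 = 4^3, and the powers of 1 - p.\<close>

lemma hG_solution:
  assumes "pqdom' p q" "curve p q" "curve' p q"
  shows "hG p q = 0"
proof -
  have d: "pqdom p q" using assms by (simp add: pqdom'_def)
  note pos = pqdom_pos[OF d] pqdom'_pos(1)[OF assms(1)]
  have "ln (8 * q * ((1 - p) * (1 - p) * (1 - p)) * (p + q - 2 * p * q))
     = ln ((p - q) * (1 + 2 * p * q - q) * (2 - p - q) * (2 * p + p * q - 1))"
    using assms(3) by (simp add: curve'_def)
  then have e3: "ln 8 + ln q + 3 * ln (1 - p) + ln (p + q - 2 * p * q)
      = ln (p - q) + ln (1 + 2 * p * q - q) + ln (2 - p - q) + ln (2 * p + p * q - 1)"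
    using pos by (simp add: ln_mult)
  have e1: "ln (p - q) + ln (p + q) + ln (1 - p * q) - ln p - ln q - 2 * ln (1 - p) - ln (1 - q) = ln 4"
    using h1_curve(2)[OF d] assms(2) by (simp add: h1_def)
  have "ln (8::real) = 3 * ln 2" "ln (4::real) = 2 * ln 2"
    using ln_realpow[of 2 3] ln_realpow[of 2 2] by simp_all
  then show ?thesis using e3 e1 unfolding hG_def by linarith
qed

text \<open>If q < q', go from (p, q) along the diagonal to (p', q + p' - p) and from there upwards
  in q to (p', q'). On both legs \<open>hG\<close> increases strictly, although it is 0 at both
  ends. The second leg does go upwards because p' - p < q' - q on the level line of
  \<open>h1\<close>.\<close>

lemma curve_unique_aux:
  assumes a: "pqdom' p q" "curve p q" "curve' p q" and b: "pqdom' p' q'" "curve p' q'" "curve' p' q'"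
  shows "\<not> q < q'"
proof
  assume q: "q < q'"
  have da: "pqdom p q" and db: "pqdom p' q'" using a b by (auto simp: pqdom'_def)
  note posa = pqdom_pos[OF da] and posb = pqdom_pos[OF db]
  have eq: "h1 p q = ln 4" "h1 p' q' = ln 4" using h1_curve(2) da db a b by auto
  have p: "p < p'"
  proof (rule ccontr)
    assume c: "\<not> p < p'"
    have d: "pqdom p' q" using q c posa posb by (auto simp: pqdom_def)
    have "h1 p' q' < h1 p' q" by (rule h1_less_q[OF d q]) (use posb in auto)
    also have "\<dots> \<le> h1 p q" using h1_less_p[OF d, of p] c posa by (cases "p = p'") auto
    finally show False using eq by simp
  qed
  \<comment> \<open>Otherwise a diagonal step up to q' followed by a step in p would reach (p', q'),
    and \<open>h1\<close> would have increased strictly.\<close>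
  have dd: "p' - q' < p - q"
  proof (rule ccontr)
    assume c: "\<not> p' - q' < p - q"
    define t where "t = q' - q"
    have t: "t > 0" "p + t \<le> p'" "q + t = q'" using q c by (auto simp: t_def)
    have "h1 p q < h1 (p + t) (q + t)" by (rule h1_less_diag[OF a(1) t(1)]) (use t posb in auto)
    also have "\<dots> \<le> h1 p' (q + t)"
    proof (cases "p + t = p'")
      case False
      have "pqdom (p + t) (q + t)" using pqdom'_diag[OF a(1), of t] t posb by (auto simp: pqdom'_def)
      then show ?thesis using h1_less_p[of "p + t" "q + t" p'] False t posb by auto
    qed simp
    finally show False using eq t by simp
  qed
  define t where "t = p' - p"
  have t: "t > 0" "p + t = p'" "q + t < q'" using p dd by (auto simp: t_def)
  have "hG p q < hG (p + t) (q + t)" by (rule hG_less_diag[OF a(1) t(1)]) (use t posb in auto)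
  also have "\<dots> < hG (p + t) q'"
    by (rule hG_less_q) (use t posb pqdom'_diag[OF a(1), of t] in auto)
  finally show False using hG_solution[OF a] hG_solution[OF b] t by simp
qed

lemma curve_unique:
  assumes a: "pqdom' p q" "curve p q" "curve' p q" and b: "pqdom' p' q'" "curve p' q'" "curve' p' q'"
  shows "p = p' \<and> q = q'"
proof -
  have q: "q = q'" using curve_unique_aux[OF a b] curve_unique_aux[OF b a] by simp
  have da: "pqdom p q" and db: "pqdom p' q'" using a b by (auto simp: pqdom'_def)
  have "h1 p q = ln 4" "h1 p' q = ln 4" using h1_curve(2) da db a b q by auto
  then have "p = p'"
    using h1_less_p[of p q p'] h1_less_p[of p' q p] da db q pqdom_pos(3)[OF da] pqdom_pos(3)[OF db]
    by (cases p p' rule: linorder_cases) auto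
  with q show ?thesis by simp
qed


section \<open>Existence of the intersection point\<close>

definition cpoly :: "real \<Rightarrow> real \<Rightarrow> real" where
  "cpoly p q = (p - q) * (p + q) * (1 - p * q) - 4 * p * q * ((1 - p) * (1 - p)) * (1 - q)"

lemma curve_cpoly: "curve p q \<longleftrightarrow> cpoly p q = 0"
  by (auto simp: curve_def cpoly_def)

text \<open>The polynomial form also makes sense at p = q and p = 1, where it is negative and
  positive; uniqueness is the monotonicity of \<open>h1\<close> in p.\<close>

lemma curve_ex1:
  assumes "0 < q" "q < 1"
  shows "\<exists>!p. pqdom p q \<and> curve p q"
proof -
  have "\<exists>x\<ge>q. x \<le> 1 \<and> cpoly x q = 0"
  proof (rule IVT)
    show "cpoly q q \<le> 0" using assms by (simp add: cpoly_def)
    show "0 \<le> cpoly 1 q" using assms by (simp add: cpoly_def)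
    show "\<forall>x. q \<le> x \<and> x \<le> 1 \<longrightarrow> isCont (\<lambda>x. cpoly x q) x"
      unfolding cpoly_def by (intro allI impI continuous_intros)
  qed (use assms in simp)
  then obtain x where x: "q \<le> x" "x \<le> 1" "cpoly x q = 0" by auto
  have "cpoly q q \<noteq> 0" "cpoly 1 q \<noteq> 0"
    using assms by (auto simp: cpoly_def)
  with x have x': "pqdom x q" "curve x q" using assms by (auto simp: pqdom_def curve_cpoly less_le)
  show ?thesis
  proof (rule ex1I[of _ x])
    fix y assume y: "pqdom y q \<and> curve y q"
    then have "h1 x q = h1 y q" using h1_curve(2) x' by auto
    then show "y = x"
      using h1_less_p[of x q y] h1_less_p[of y q x] x' y
      by (cases x y rule: linorder_cases) (auto simp: pqdom_def)
  qed (use x' in simp)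
qed

definition cp :: "real \<Rightarrow> real" where
  "cp q = (THE p. pqdom p q \<and> curve p q)"

lemma cp: "\<lbrakk>0 < q; q < 1\<rbrakk> \<Longrightarrow> pqdom (cp q) q \<and> curve (cp q) q"
  unfolding cp_def by (rule theI') (rule curve_ex1)

text \<open>The sign of \<open>cpoly\<close> tells on which side of the curve a point lies. This
  yields both the continuity of \<open>cp\<close> and rational brackets for its values.\<close>

lemma cpoly_pos_iff:
  assumes "pqdom p q"
  shows "cpoly p q > 0 \<longleftrightarrow> cp q < p" and "cpoly p q < 0 \<longleftrightarrow> p < cp q"
proof -
  have q: "0 < q" "q < 1" using assms by (auto simp: pqdom_def)
  note c = cp[OF q]
  have e: "h1 (cp q) q = ln 4" using h1_curve(2) c by auto
  have pos: "cpoly p q > 0 \<longleftrightarrow> ln 4 < h1 p q" using h1_curve(3)[OF assms] by (simp add: cpoly_def)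
  have zero: "cpoly p q = 0 \<longleftrightarrow> h1 p q = ln 4" using h1_curve(2)[OF assms] by (simp add: curve_cpoly)
  show "cpoly p q > 0 \<longleftrightarrow> cp q < p" "cpoly p q < 0 \<longleftrightarrow> p < cp q"
    using h1_less_p[of p q "cp q"] h1_less_p[of "cp q" q p] assms c e pos zero
    by (cases p "cp q" rule: linorder_cases; auto simp: pqdom_def)+
qed

lemma isCont_cp:
  assumes "0 < q" "q < 1"
  shows "isCont cp q"
  unfolding isCont_def
proof (rule order_tendstoI)
  have dom: "pqdom (cp q) q" using cp[OF assms] by simp
  have c: "isCont (\<lambda>y. cpoly a y) q" for a unfolding cpoly_def by (intro continuous_intros)
  have evq: "\<forall>\<^sub>F y in at q. y < a" if "q < a" for a
    using order_tendstoD(2)[OF tendsto_ident_at that] by simp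
  have ev0: "\<forall>\<^sub>F y in at q. 0 < y" using order_tendstoD(1)[OF tendsto_ident_at assms(1)] by simp
  {
    fix a assume "a < cp q"
    \<comment> \<open>The bound is raised above q so that \<open>pqdom a' y\<close> holds for y near
      q.\<close>
    define a' where "a' = max a ((q + cp q) / 2)"
    have a': "q < a'" "a \<le> a'" "a' < cp q" "a' < 1"
      using dom \<open>a < cp q\<close> by (auto simp: a'_def pqdom_def less_max_iff_disj min_less_iff_disj)
    then have "cpoly a' q < 0" using cpoly_pos_iff(2)[of a' q] assms by (simp add: pqdom_def)
    then have "\<forall>\<^sub>F y in at q. cpoly a' y < 0" using order_tendstoD(2)[OF isContD[OF c]] by simp
    then show "\<forall>\<^sub>F y in at q. a < cp y"
      using evq[OF a'(1)] ev0
    proof eventually_elim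
      case (elim y)
      then have "pqdom a' y" using a' by (simp add: pqdom_def)
      then show ?case using cpoly_pos_iff(2)[of a' y] elim a' by simp
    qed
  next
    fix a assume "cp q < a"
    define a' where "a' = min a ((1 + cp q) / 2)"
    have a': "q < a'" "a' \<le> a" "cp q < a'" "a' < 1"
      using dom \<open>cp q < a\<close> by (auto simp: a'_def pqdom_def less_max_iff_disj min_less_iff_disj)
    then have "cpoly a' q > 0" using cpoly_pos_iff(1)[of a' q] assms by (simp add: pqdom_def)
    then have "\<forall>\<^sub>F y in at q. cpoly a' y > 0" using order_tendstoD(1)[OF isContD[OF c]] by simp
    then show "\<forall>\<^sub>F y in at q. cp y < a"
      using evq[OF a'(1)] ev0
    proof eventually_elim
      case (elim y)
      then have "pqdom a' y" using a' by (simp add: pqdom_def)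
      then show ?case using cpoly_pos_iff(1)[of a' y] elim a' by simp
    qed
  }
qed

text \<open>Along p = \<open>cp q\<close> the remaining equation changes sign between q = 3/5 and q
  = 7/10. The decimals bracket \<open>cp\<close> at these two points by signs of
  \<open>cpoly\<close>, and bound each factor of the equation over the bracket.\<close>

lemma curve_exists: "\<exists>p q. pqdom' p q \<and> curve p q \<and> curve' p q"
proof -
  define g where "g p q = (p - q) * (1 + 2 * p * q - q) * (2 - p - q) * (2 * p + p * q - 1)
     - 8 * q * ((1 - p) * (1 - p) * (1 - p)) * (p + q - 2 * p * q)" for p q :: real
  have "\<exists>q\<ge>3/5. q \<le> 7/10 \<and> (\<lambda>q. g (cp q) q) q = 0"
  proof (rule IVT)
    show "\<forall>q. 3/5 \<le> q \<and> q \<le> 7/10 \<longrightarrow> isCont (\<lambda>q. g (cp q) q) q"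
      unfolding g_def by (intro allI impI continuous_intros isCont_cp) auto
    define p where "p = cp (3/5)"
    have p: "684/1000 < p" "p < 688/1000"
      using cpoly_pos_iff(2)[of "684/1000" "3/5"] cpoly_pos_iff(1)[of "688/1000" "3/5"]
      by (simp_all add: p_def pqdom_def cpoly_def)
    have "(p - 3/5) * (1 + 2 * p * (3/5) - 3/5) * (2 - p - 3/5) * (2 * p + p * (3/5) - 1)
        \<le> (88/1000) * (1226/1000) * (716/1000) * (789/1000)"
      using p by (intro mult_mono mult_nonneg_nonneg) auto
    moreover have "8 * (3/5) * ((312/1000) * (312/1000) * (312/1000)) * (462/1000)
        \<le> 8 * (3/5) * ((1 - p) * (1 - p) * (1 - p)) * (p + 3/5 - 2 * p * (3/5))"
      using p by (intro mult_mono mult_nonneg_nonneg) auto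
    ultimately show "g (cp (3/5)) (3/5) \<le> 0" unfolding g_def p_def[symmetric] by linarith
    define p' where "p' = cp (7/10)"
    have p: "753/1000 < p'" "p' < 758/1000"
      using cpoly_pos_iff(2)[of "753/1000" "7/10"] cpoly_pos_iff(1)[of "758/1000" "7/10"]
      by (simp_all add: p'_def pqdom_def cpoly_def)
    have "(53/1000) * (1354/1000) * (542/1000) * (1033/1000)
        \<le> (p' - 7/10) * (1 + 2 * p' * (7/10) - 7/10) * (2 - p' - 7/10) * (2 * p' + p' * (7/10) - 1)"
      using p by (intro mult_mono mult_nonneg_nonneg) auto
    moreover have "8 * (7/10) * ((1 - p') * (1 - p') * (1 - p')) * (p' + 7/10 - 2 * p' * (7/10))
        \<le> 8 * (7/10) * ((247/1000) * (247/1000) * (247/1000)) * (399/1000)"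
      using p by (intro mult_mono mult_nonneg_nonneg) auto
    ultimately show "0 \<le> g (cp (7/10)) (7/10)" unfolding g_def p'_def[symmetric] by linarith
  qed simp
  then obtain q where q: "3/5 \<le> q" "q \<le> 7/10" "g (cp q) q = 0" by auto
  then have c: "pqdom (cp q) q" "curve (cp q) q" using cp[of q] by auto
  have "1 < cp q + q" "0 < cp q * q" using c q by (auto simp: pqdom_def)
  then have "1 < cp q + q + cp q * q" by linarith
  then have "pqdom' (cp q) q" using c by (simp add: pqdom'_def)
  moreover have "curve' (cp q) q" using q(3) by (simp add: curve'_def g_def)
  ultimately show ?thesis using c by blast
qed

section \<open>The rigid parameters\<close>

text \<open>The hyperboloid n^2 = x^2 + y^2 - 1 is parametrised by its two rulings
  n - y = q (x - 1) and n - x = p (y - 1); below, D = p + q + p q - 1.\<close>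

locale ruling =
  fixes p q D x y n :: real
  assumes D: "D = p + q + p * q - 1" and D0: "D > 0"
    and x: "x * D = q - p + p * q + 1" and y: "y * D = p - q + p * q + 1" and n: "n * D = 1 + p + q - p * q"
begin

lemma factors:
  "(x - 1) * D = 2 * (1 - p)" "(y - 1) * D = 2 * (1 - q)" "(n - 1) * D = 2 - 2 * (p * q)" "(n + 1) * D = 2 * (p + q)"
  "(y - x) * D = 2 * (p - q)" "(n - x) * D = 2 * p * (1 - q)" "(n - y) * D = 2 * q * (1 - p)"
  "(n - x - y + 1) * D = - 2 * (1 - p) * (1 - q)" "(n - x - y - 1) * D = - 4 * p * q"
  "(2 * n - x - y) * D = 2 * (p + q - 2 * p * q)" "(2 * y + x - n) * D = 2 * (1 + 2 * p * q - q)"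
  "(y + x) * D = 2 * (p * q + 1)"
  using x y n unfolding D by (simp_all add: algebra_simps)

lemma hyperboloid: "n^2 = x^2 + y^2 - 1"
proof -
  have "((n - y) * D) * ((n + y) * D) = ((x - 1) * D) * ((x + 1) * D)"
  proof -
    have s: "(n + y) * D = 2 + 2 * p" "(x + 1) * D = 2 * q + 2 * (p * q)"
      using x y n unfolding D by (simp_all add: algebra_simps)
    show ?thesis unfolding factors s by (simp add: algebra_simps)
  qed
  then have "D * D * (n^2 - (x^2 + y^2 - 1)) = 0"
    by (simp add: power2_eq_square algebra_simps)
  then show ?thesis using D0 by simp
qed

lemma curve_iff: "curve p q \<longleftrightarrow> 4 * (x - 1) * (n - x) * (n - y) = (y - x) * (n^2 - 1)"
proof -
  have "(4 * (x - 1) * (n - x) * (n - y) - (y - x) * (n^2 - 1)) * (D * D * D)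
      = 4 * ((x - 1) * D) * ((n - x) * D) * ((n - y) * D) - ((y - x) * D) * ((n - 1) * D) * ((n + 1) * D)"
    by (simp add: power2_eq_square algebra_simps)
  also have "\<dots> = 8 * (4 * p * q * ((1 - p) * (1 - p)) * (1 - q) - (p - q) * (p + q) * (1 - p * q))"
    unfolding factors by (simp add: algebra_simps)
  finally have *: "(4 * (x - 1) * (n - x) * (n - y) - (y - x) * (n^2 - 1)) * (D * D * D)
      = 8 * (4 * p * q * ((1 - p) * (1 - p)) * (1 - q) - (p - q) * (p + q) * (1 - p * q))" .
  have "D * D * D \<noteq> 0" using D0 by simp
  with * show ?thesis unfolding curve_def by (metis (no_types, lifting) mult_eq_0_iff right_minus_eq zero_neq_numeral)
qed

text \<open>Both sides have degree 5, so multiplication by D^5 clears the denominators; the factor p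
  (1 - q) that then splits off is nonzero by the assumptions.\<close>

lemma curve'_iff:
  assumes "p > 0" "q < 1"
  shows "curve' p q \<longleftrightarrow> 4 * (x - 1)^2 * ((n - x - y - 1) * (n - x - y + 1)) * (2 * n - x - y)
     = (y - x) * (y^2 - x^2 + 4 * (x - 1)) * (2 * y + x - n) * (n - x)" (is "_ \<longleftrightarrow> ?L = ?R")
proof -
  have K: "(y^2 - x^2 + 4 * (x - 1)) * (D * D) = 4 * ((2 - p - q) * (2 * p + p * q - 1))"
  proof -
    have "(y^2 - x^2 + 4 * (x - 1)) * (D * D) = ((y - x) * D) * ((y + x) * D) + 4 * ((x - 1) * D) * D"
      by (simp add: power2_eq_square algebra_simps)
    then show ?thesis unfolding factors unfolding D by (simp add: algebra_simps)
  qed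
  have "(?L - ?R) * (D * D * D * D * D)
      = 4 * (((x - 1) * D) * ((x - 1) * D)) * (((n - x - y - 1) * D) * ((n - x - y + 1) * D)) * ((2 * n - x - y) * D)
        - ((y - x) * D) * ((y^2 - x^2 + 4 * (x - 1)) * (D * D)) * ((2 * y + x - n) * D) * ((n - x) * D)"
    unfolding left_diff_distrib[of ?L] by (rule arg_cong2[of _ _ _ _ "(-)"]) (simp_all add: power2_eq_square mult_ac)
  also have "\<dots> = 32 * p * (1 - q) * (8 * q * ((1 - p) * (1 - p) * (1 - p)) * (p + q - 2 * p * q)
        - (p - q) * (1 + 2 * p * q - q) * (2 - p - q) * (2 * p + p * q - 1))"
  proof -
    have "4 * (2 * a * (2 * a)) * (- 4 * p * q * (- 2 * a * b)) * (2 * s) - 2 * c * (4 * (k * k')) * (2 * e) * (2 * p * b)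
        = 32 * p * b * (8 * q * (a * a * a) * s - c * e * k * k')" for a b c e s k k' :: real
      by (simp add: algebra_simps)
    then show ?thesis unfolding factors K .
  qed
  finally have *: "(?L - ?R) * (D * D * D * D * D)
      = 32 * p * (1 - q) * (8 * q * ((1 - p) * (1 - p) * (1 - p)) * (p + q - 2 * p * q)
        - (p - q) * (1 + 2 * p * q - q) * (2 - p - q) * (2 * p + p * q - 1))" .
  have "D * D * D * D * D \<noteq> 0" "32 * p * (1 - q) \<noteq> 0" using D0 assms by simp_all
  with * show ?thesis unfolding curve'_def by (metis (no_types, lifting) mult_eq_0_iff right_minus_eq)
qed

end

text \<open>With witnesses 0, 1, b, t, u, 1 + b - t, v, w in the order of the statement, the four equations
  express that the level 6, 7 and 8 pivots vanish at the last three, and that u, v, w are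
  the zeros of the level 3 pivot other than 1.\<close>
definition rigid :: "real \<Rightarrow> real \<Rightarrow> real \<Rightarrow> real \<Rightarrow> real \<Rightarrow> bool" where
  "rigid b t u v w \<longleftrightarrow> b < 0 \<and> t > 1 \<and> u > 1 \<and> v < b \<and> b < w \<and> w < 0 \<and> u + v + w = 1 + b
     \<and> u * (u - 1) = b * (1 + b - 2 * t)
     \<and> v * (v - 1) = u * (u - 1) + b * (b - 1)
     \<and> w * (w - 1) * (w * (w - 1) - v * (v - 1)) = t * (t - 1) * (w * (w - 1) - u * (u - 1))
     \<and> (b - u) * (b - v) * (b - w) = b * (b - t) * (t - 1)"

text \<open>The equation \<open>e1\<close> is linear in t. With U = u (u - 1) and B = b (b - 1) it
  gives 2 b t - 2 b = B - U = (b - u) (b + u - 1), and \<open>e2\<close> says B + U = v (v - 1).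
  Multiplied by 4 b or 4 b^2, both remaining equations become free of t and share the factor b - u,
  which cancels.\<close>

lemma eliminate_t:
  fixes b t u v w :: real
  assumes b: "b \<noteq> 0" "b \<noteq> u" and sum: "w = 1 + b - u - v"
    and e1: "u * (u - 1) = b * (1 + b - 2 * t)" and e2: "v * (v - 1) = u * (u - 1) + b * (b - 1)"
  shows "(b - u) * (b - v) * (b - w) = b * (b - t) * (t - 1)
       \<longleftrightarrow> 4 * b * (b - v) * (b - w) = (b + u - 1) * (v * (v - 1))" (is ?th1)
    and "w * (w - 1) * (w * (w - 1) - v * (v - 1)) = t * (t - 1) * (w * (w - 1) - u * (u - 1))
       \<longleftrightarrow> 4 * b^2 * (w * (w - 1)) * (w - v)
         = (b + u - 1) * (b * (b - 1) - u * (u - 1) + 2 * b) * (w - u) * (b - v)" (is ?th2)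
proof -
  define U B where "U = u * (u - 1)" and "B = b * (b - 1)"
  have t: "2 * b * t = b + b * b - U" using e1 by (simp add: U_def algebra_simps)
  have BU: "B - U = (b - u) * (b + u - 1)" by (simp add: U_def B_def algebra_simps)
  have "4 * b * (b * (b - t) * (t - 1)) = (2 * b * b - 2 * b * t) * (2 * b * t - 2 * b)"
    by (simp add: algebra_simps)
  also have "\<dots> = (B + U) * (B - U)" unfolding t by (simp add: B_def algebra_simps)
  finally have a: "4 * b * (b * (b - t) * (t - 1)) = (b - u) * ((b + u - 1) * (v * (v - 1)))"
    using e2 by (simp add: BU U_def[symmetric] B_def[symmetric] mult_ac add_ac)
  have "(b - u) * (b - v) * (b - w) = b * (b - t) * (t - 1)
      \<longleftrightarrow> 4 * b * ((b - u) * (b - v) * (b - w)) = 4 * b * (b * (b - t) * (t - 1))" using b by simp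
  also have "\<dots> \<longleftrightarrow> (b - u) * (4 * b * (b - v) * (b - w)) = (b - u) * ((b + u - 1) * (v * (v - 1)))"
    unfolding a by (simp only: mult_ac)
  also have "\<dots> \<longleftrightarrow> 4 * b * (b - v) * (b - w) = (b + u - 1) * (v * (v - 1))"
    by (rule mult_left_cancel) (use b in simp)
  finally show ?th1 .
  have "4 * b^2 * (t * (t - 1)) = (2 * b * t) * (2 * b * t - 2 * b)"
    by (simp add: power2_eq_square algebra_simps)
  also have "\<dots> = (B - U) * (B - U + 2 * b)" unfolding t by (simp add: B_def algebra_simps)
  finally have T: "4 * b^2 * (t * (t - 1)) = (b - u) * (b + u - 1) * (B - U + 2 * b)" using BU by simp
  have wv: "w * (w - 1) - v * (v - 1) = (b - u) * (w - v)" and wu: "w * (w - 1) - u * (u - 1) = (b - v) * (w - u)"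
    unfolding sum by (simp_all add: algebra_simps)
  have "w * (w - 1) * (w * (w - 1) - v * (v - 1)) = t * (t - 1) * (w * (w - 1) - u * (u - 1))
      \<longleftrightarrow> 4 * b^2 * (w * (w - 1) * ((b - u) * (w - v))) = 4 * b^2 * (t * (t - 1) * ((b - v) * (w - u)))"
  proof -
    have nz: "4 * b^2 \<noteq> 0" using b by simp
    show ?thesis unfolding wv wu mult.assoc[of "4 * b^2"] by (rule mult_left_cancel[OF nz, symmetric])
  qed
  also have "\<dots> \<longleftrightarrow> (b - u) * (4 * b^2 * (w * (w - 1)) * (w - v))
      = (b - u) * ((b + u - 1) * (B - U + 2 * b) * (w - u) * (b - v))"
  proof -
    have "4 * b^2 * (t * (t - 1) * ((b - v) * (w - u)))
        = (b - u) * (b + u - 1) * (B - U + 2 * b) * ((b - v) * (w - u))"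
      unfolding T[symmetric] by (simp only: mult.assoc)
    moreover have "4 * b^2 * (w * (w - 1) * ((b - u) * (w - v)))
        = (b - u) * (4 * b^2 * (w * (w - 1)) * (w - v))"
    proof -
      have "z * (W * (c * d)) = c * (z * W * d)" for z W c d :: real by simp
      then show ?thesis .
    qed
    moreover have "(b - u) * (b + u - 1) * (B - U + 2 * b) * ((b - v) * (w - u))
        = (b - u) * ((b + u - 1) * (B - U + 2 * b) * (w - u) * (b - v))"
    proof -
      have "c * f * g * (e * d) = c * (f * g * d * e)" for c d e f g :: real by simp
      then show ?thesis .
    qed
    ultimately show ?thesis by (simp only:)
  qed
  also have "\<dots> \<longleftrightarrow> 4 * b^2 * (w * (w - 1)) * (w - v) = (b + u - 1) * (B - U + 2 * b) * (w - u) * (b - v)"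
    by (rule mult_left_cancel) (use b in simp)
  finally show ?th2 unfolding U_def B_def .
qed

text \<open>Because 4 z (z - 1) = (2 z - 1)^2 - 1, the coordinates x = 1 - 2 b, y = 2 u - 1, n = 1 -
  2 v turn the equation for v (v - 1) into a hyperboloid.\<close>

lemma ruling_coordinates:
  fixes x y n b u v w :: real
  assumes "b = (1 - x) / 2" "u = (1 + y) / 2" "v = (1 - n) / 2" "w = (1 + n - x - y) / 2"
  shows "v * (v - 1) = u * (u - 1) + b * (b - 1) \<longleftrightarrow> n^2 = x^2 + y^2 - 1"
    and "4 * b * (b - v) * (b - w) = (b + u - 1) * (v * (v - 1))
      \<longleftrightarrow> 4 * (x - 1) * (n - x) * (n - y) = (y - x) * (n^2 - 1)"
    and "4 * b^2 * (w * (w - 1)) * (w - v) = (b + u - 1) * (b * (b - 1) - u * (u - 1) + 2 * b) * (w - u) * (b - v)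
      \<longleftrightarrow> 4 * (x - 1)^2 * ((n - x - y - 1) * (n - x - y + 1)) * (2 * n - x - y)
        = (y - x) * (y^2 - x^2 + 4 * (x - 1)) * (2 * y + x - n) * (n - x)"
proof -
  have f: "b = - ((x - 1) / 2)" "b - v = (n - x) / 2" "b - w = - ((n - y) / 2)" "b + u - 1 = (y - x) / 2"
    "v * (v - 1) = (n^2 - 1) / 4" "w * (w - 1) = ((n - x - y - 1) * (n - x - y + 1)) / 4"
    "w - v = (2 * n - x - y) / 2" "w - u = - ((2 * y + x - n) / 2)"
    "b * (b - 1) - u * (u - 1) + 2 * b = - ((y^2 - x^2 + 4 * (x - 1)) / 4)"
    unfolding assms by (simp_all add: field_simps power2_eq_square)
  show "v * (v - 1) = u * (u - 1) + b * (b - 1) \<longleftrightarrow> n^2 = x^2 + y^2 - 1"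
  proof -
    have "v * (v - 1) - (u * (u - 1) + b * (b - 1)) = (n^2 - (x^2 + y^2 - 1)) / 4"
      unfolding assms by (simp add: field_simps power2_eq_square)
    then show ?thesis by auto
  qed
  have scale: "X / 2 = Y / 8 \<longleftrightarrow> 4 * X = Y" "X / 8 = Y / 32 \<longleftrightarrow> 4 * X = Y" for X Y :: real by auto
  have P1: "4 * b * (b - v) * (b - w) = ((x - 1) * (n - x) * (n - y)) / 2"
  proof -
    have "4 * - (X / 2) * (Y / 2) * - (Z / 2) = (X * Y * Z) / 2" for X Y Z :: real by simp
    then show ?thesis unfolding f(2,3) unfolding f(1) .
  qed
  have Q1: "(b + u - 1) * (v * (v - 1)) = ((y - x) * (n^2 - 1)) / 8"
    unfolding f(4,5) by (simp only: times_divide_times_eq)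
  show "4 * b * (b - v) * (b - w) = (b + u - 1) * (v * (v - 1))
      \<longleftrightarrow> 4 * (x - 1) * (n - x) * (n - y) = (y - x) * (n^2 - 1)"
    unfolding P1 Q1 scale by (simp only: mult.assoc)
  have P2: "4 * b^2 * (w * (w - 1)) * (w - v)
      = ((x - 1)^2 * ((n - x - y - 1) * (n - x - y + 1)) * (2 * n - x - y)) / 8"
  proof -
    have "4 * (- (X / 2))^2 * (Y / 4) * (Z / 2) = (X^2 * Y * Z) / 8" for X Y Z :: real
      by (simp add: power2_eq_square)
    then show ?thesis unfolding f(6,7) unfolding f(1) .
  qed
  have Q2: "(b + u - 1) * (b * (b - 1) - u * (u - 1) + 2 * b) * (w - u) * (b - v)
      = ((y - x) * (y^2 - x^2 + 4 * (x - 1)) * (2 * y + x - n) * (n - x)) / 32"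
  proof -
    have "(X / 2) * - (Y / 4) * - (Z / 2) * (W / 2) = (X * Y * Z * W) / 32" for X Y Z W :: real by simp
    then show ?thesis unfolding f(2,4,8,9) .
  qed
  show "4 * b^2 * (w * (w - 1)) * (w - v)
      = (b + u - 1) * (b * (b - 1) - u * (u - 1) + 2 * b) * (w - u) * (b - v)
      \<longleftrightarrow> 4 * (x - 1)^2 * ((n - x - y - 1) * (n - x - y + 1)) * (2 * n - x - y)
        = (y - x) * (y^2 - x^2 + 4 * (x - 1)) * (2 * y + x - n) * (n - x)"
    unfolding P2 Q2 scale by (simp only: mult.assoc)
qed

lemma rigid_ruling:
  assumes "rigid b t u v w"
  shows "\<exists>p q. pqdom' p q \<and> curve p q \<and> curve' p q
     \<and> b = (1 - (q - p + p * q + 1) / (p + q + p * q - 1)) / 2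
     \<and> u = (1 + (p - q + p * q + 1) / (p + q + p * q - 1)) / 2"
proof -
  have R: "b < 0" "t > 1" "u > 1" "v < b" "b < w" "w < 0" "u + v + w = 1 + b"
    and e: "u * (u - 1) = b * (1 + b - 2 * t)" "v * (v - 1) = u * (u - 1) + b * (b - 1)"
      "w * (w - 1) * (w * (w - 1) - v * (v - 1)) = t * (t - 1) * (w * (w - 1) - u * (u - 1))"
      "(b - u) * (b - v) * (b - w) = b * (b - t) * (t - 1)"
    using assms by (auto simp: rigid_def)
  define x y n where "x = 1 - 2 * b" and "y = 2 * u - 1" and "n = 1 - 2 * v"
  have c: "b = (1 - x) / 2" "u = (1 + y) / 2" "v = (1 - n) / 2" "w = (1 + n - x - y) / 2"
    using R(7) by (simp_all add: x_def y_def n_def)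
  note rc = ruling_coordinates[OF c]
  have w: "w = 1 + b - u - v" and b: "b \<noteq> 0" "b \<noteq> u" using R by auto
  have h: "n^2 = x^2 + y^2 - 1" using rc(1) e(2) by blast
  have h4: "4 * (x - 1) * (n - x) * (n - y) = (y - x) * (n^2 - 1)"
    using rc(2) eliminate_t(1)[OF b w e(1,2)] e(4) by blast
  have h3: "4 * (x - 1)^2 * ((n - x - y - 1) * (n - x - y + 1)) * (2 * n - x - y)
        = (y - x) * (y^2 - x^2 + 4 * (x - 1)) * (2 * y + x - n) * (n - x)"
    using rc(3) eliminate_t(2)[OF b w e(1,2)] e(3) by blast
  have o: "x > 1" "y > 1" "n > x" "n > y" "n < x + y - 1" using R by (simp_all add: x_def y_def n_def)
  have "n * n > 1 * 1" using o by (intro mult_strict_mono) auto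
  then have n1: "n^2 - 1 > 0" by (simp add: power2_eq_square)
  \<comment> \<open>The sign conditions make the left side of \<open>h4\<close> positive; this gives
    x < y and later q < p.\<close>
  have "(y - x) * (n^2 - 1) > 0" unfolding h4[symmetric] using o by (intro mult_pos_pos) auto
  then have yx: "y > x" using n1 by (simp add: zero_less_mult_iff)
  define p q D where "p = (n - x) / (y - 1)" and "q = (n - y) / (x - 1)" and "D = p + q + p * q - 1"
  have py: "p * (y - 1) = n - x" and qx: "q * (x - 1) = n - y" using o by (auto simp: p_def q_def)
  have p1: "p < 1" and q0: "q > 0" using o by (simp_all add: p_def q_def)
  have qp: "q < p"
  proof -
    have "(n - x) * (x - 1) - (n - y) * (y - 1) = (y - x) * (x + y - 1 - n)" by (simp add: algebra_simps)
    moreover have "(y - x) * (x + y - 1 - n) > 0" using yx o by (intro mult_pos_pos) auto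
    ultimately have "(n - y) * (y - 1) < (n - x) * (x - 1)" by linarith
    then show ?thesis using o by (simp add: p_def q_def divide_simps)
  qed
  have "q * (n + y) * (x - 1) = (x + 1) * (x - 1)"
  proof -
    have "q * (n + y) * (x - 1) = (q * (x - 1)) * (n + y)" by simp
    also have "\<dots> = n^2 - y^2" unfolding qx by (simp add: power2_eq_square algebra_simps)
    also have "\<dots> = (x + 1) * (x - 1)" unfolding h by (simp add: power2_eq_square algebra_simps)
    finally show ?thesis .
  qed
  then have qn: "q * (n + y) = x + 1" using o by simp
  have XY: "(y - 1) * (1 - p) = (x - 1) * (1 - q)" using py qx by (simp add: algebra_simps)
  \<comment> \<open>This intersects the two rulings: \<open>qn\<close> expresses x + 1, n is
    eliminated by \<open>qx\<close>, and \<open>XY\<close> trades (y - 1) (1 - p) for (x - 1) (1 -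
    q). A common factor 1 - q then cancels.\<close>
  have XD: "(x - 1) * D = 2 * (1 - p)"
  proof -
    have s: "2 + 2 * (y - 1) + q * (x - 1) = n + y" using qx by simp
    have "q * (2 + 2 * (y - 1) + q * (x - 1)) = (x - 1) + 2" unfolding s using qn by simp
    then have "(1 - p) * (q * (2 + 2 * (y - 1) + q * (x - 1))) = (1 - p) * ((x - 1) + 2)" by simp
    then have "2 * q * (1 - p) + 2 * q * ((y - 1) * (1 - p)) + q * q * (x - 1) * (1 - p) = (1 - p) * (x - 1) + 2 * (1 - p)"
      by (simp add: algebra_simps)
    then have "(1 - q) * ((x - 1) * D - 2 * (1 - p)) = 0" unfolding XY D_def by (simp add: algebra_simps)
    moreover have "1 - q \<noteq> 0" using qp p1 by simp
    ultimately show ?thesis by simp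
  qed
  have YD: "(y - 1) * D = 2 * (1 - q)"
  proof -
    have "(1 - p) * ((y - 1) * D) = ((y - 1) * (1 - p)) * D" by (simp only: mult_ac)
    also have "\<dots> = (1 - q) * ((x - 1) * D)" unfolding XY by (simp only: mult_ac)
    also have "\<dots> = (1 - p) * (2 * (1 - q))" unfolding XD by (simp only: mult_ac)
    finally show ?thesis using p1 by simp
  qed
  have D0: "D > 0"
  proof -
    have "(x - 1) * D > 0" using XD p1 by simp
    then show ?thesis using o by (simp add: zero_less_mult_iff)
  qed
  interpret ruling p q D x y n
  proof
    show "x * D = q - p + p * q + 1" "y * D = p - q + p * q + 1"
      using XD YD by (simp_all add: D_def algebra_simps)
    have "n = y + q * (x - 1)" using qx by simp
    then have "n * D = (y + q * (x - 1)) * D" by simp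
    then have "n * D = y * D + q * ((x - 1) * D)" by (simp only: distrib_right mult.assoc)
    then show "n * D = 1 + p + q - p * q" unfolding XD \<open>y * D = p - q + p * q + 1\<close> by (simp add: algebra_simps)
  qed (use D0 in \<open>auto simp: D_def\<close>)
  have "pqdom' p q" using q0 qp p1 D0 by (simp add: pqdom'_def pqdom_def D_def)
  moreover have "curve p q" using curve_iff h4 by blast
  moreover have "curve' p q" using curve'_iff h3 q0 qp p1 by simp
  moreover have "x = (q - p + p * q + 1) / D" "y = (p - q + p * q + 1) / D"
    using ruling.x ruling.y x y D0 by (simp_all add: divide_simps)
  ultimately show ?thesis using c D_def by blast
qed

text \<open>Only b, t and u are compared because the level data \<open>aseq\<close> and
  \<open>Cseq\<close> depend on nothing else. The curves fix b and u, and the first equation is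
  linear in t.\<close>

theorem rigid_unique:
  assumes "rigid b t u v w" "rigid b' t' u' v' w'"
  shows "b = b' \<and> t = t' \<and> u = u'"
proof -
  have bu: "b = b' \<and> u = u'"
    using rigid_ruling[OF assms(1)] rigid_ruling[OF assms(2)] curve_unique by metis
  have "b * (1 + b - 2 * t) = b * (1 + b - 2 * t')" "b \<noteq> 0"
    using assms bu by (auto simp: rigid_def)
  then show ?thesis using bu by simp
qed

theorem rigid_exists: "\<exists>b t u v w. rigid b t u v w"
proof -
  obtain p q where pq: "pqdom' p q" "curve p q" "curve' p q" using curve_exists by blast
  then have d: "pqdom p q" by (simp add: pqdom'_def)
  note pos = pqdom_pos[OF d]
  define D where "D = p + q + p * q - 1"
  have D0: "D > 0" using pq by (simp add: D_def pqdom'_def)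
  define x y n where "x = (q - p + p * q + 1) / D" and "y = (p - q + p * q + 1) / D" and "n = (1 + p + q - p * q) / D"
  interpret ruling p q D x y n
  proof
    show "x * D = q - p + p * q + 1" "y * D = p - q + p * q + 1" "n * D = 1 + p + q - p * q"
      using D0 by (simp_all add: x_def y_def n_def)
  qed (use D0 in \<open>simp_all add: D_def\<close>)
  have sgn: "z > 0" if "z * D > 0" for z using that D0 by (simp add: zero_less_mult_iff)
  have "(x - 1) * D > 0" "(y - 1) * D > 0" "(y - x) * D > 0" "(n - x) * D > 0" "(n - y) * D > 0"
    unfolding factors using pos by simp_all
  moreover have "- (n - x - y + 1) * D = 2 * ((1 - p) * (1 - q))"
    using factors(8) by (simp only: mult_minus_left minus_mult_minus mult.assoc minus_minus)
  then have "- (n - x - y + 1) * D > 0" using pos by simp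
  ultimately have o: "x - 1 > 0" "y - 1 > 0" "y - x > 0" "n - x > 0" "n - y > 0" "- (n - x - y + 1) > 0"
    using sgn by blast+
  define b u v w where "b = (1 - x) / 2" and "u = (1 + y) / 2" and "v = (1 - n) / 2" and "w = (1 + n - x - y) / 2"
  define k where "k = u * (u - 1) / b"
  \<comment> \<open>Solved from u (u - 1) = b (1 + b - 2 t).\<close>
  define t where "t = (1 + b - k) / 2"
  note rc = ruling_coordinates[OF b_def u_def v_def w_def]
  have R: "b < 0" "u > 1" "v < b" "b < w" "w < 0" "u + v + w = 1 + b"
    using o by (simp_all add: b_def u_def v_def w_def field_simps)
  have b: "b \<noteq> 0" "b \<noteq> u" and w: "w = 1 + b - u - v" using R by auto
  have "1 + b - 2 * t = k" by (simp add: t_def field_simps)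
  then have e1: "u * (u - 1) = b * (1 + b - 2 * t)" using b by (simp add: k_def)
  have e2: "v * (v - 1) = u * (u - 1) + b * (b - 1)" using rc(1) hyperboloid by blast
  have e4: "(b - u) * (b - v) * (b - w) = b * (b - t) * (t - 1)"
    using rc(2) eliminate_t(1)[OF b w e1 e2] curve_iff pq by blast
  have e3: "w * (w - 1) * (w * (w - 1) - v * (v - 1)) = t * (t - 1) * (w * (w - 1) - u * (u - 1))"
    using rc(3) eliminate_t(2)[OF b w e1 e2] curve'_iff pq pos by blast
  have "t > 1"
  proof -
    have "u * (u - 1) - b * (b - 1) = (u - b) * (u + b - 1)" by (simp add: algebra_simps)
    moreover have "(u - b) * (u + b - 1) > 0" using R o by (intro mult_pos_pos) (auto simp: u_def b_def field_simps)
    ultimately have "b * (1 + b - 2 * t) > b * (b - 1)" using e1 by linarith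
    then have "1 + b - 2 * t < b - 1" using R by (simp add: mult_less_cancel_left)
    then show ?thesis by simp
  qed
  then show ?thesis using R e1 e2 e3 e4 unfolding rigid_def by blast
qed

section \<open>Hedges as levelled trees\<close>

text \<open>The spectral arguments use only parents and levels, that is, heights above the leaves.
  Graph distances occur only where this structure is derived, in
  \<open>lush_hedge_lush_tree\<close>.\<close>

locale lush_tree =
  fixes n :: nat and r :: nat and H :: nat and E :: "nat \<Rightarrow> nat \<Rightarrow> bool"
    and par lev :: "nat \<Rightarrow> nat"
  assumes root_less: "r < n" and lev_root: "lev r = H"
    and par_less: "\<lbrakk>v < n; v \<noteq> r\<rbrakk> \<Longrightarrow> par v < n"
    and lev_par: "\<lbrakk>v < n; v \<noteq> r\<rbrakk> \<Longrightarrow> lev (par v) = Suc (lev v)"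
    and lev_le: "v < n \<Longrightarrow> lev v \<le> H"
    and E_iff: "\<lbrakk>u < n; v < n\<rbrakk> \<Longrightarrow> E u v \<longleftrightarrow> (u \<noteq> r \<and> v = par u) \<or> (v \<noteq> r \<and> u = par v)"
    and three_children: "\<lbrakk>v < n; lev v \<ge> 2\<rbrakk> \<Longrightarrow> card {c. c < n \<and> c \<noteq> r \<and> par c = v} \<ge> 3"
    and two_children: "\<lbrakk>v < n; lev v = 1\<rbrakk> \<Longrightarrow> card {c. c < n \<and> c \<noteq> r \<and> par c = v} \<ge> 2"
    and H_ge: "H \<ge> 8"

lemma gdist_le: "(u, v) \<in> adj_rel n E ^^ k \<Longrightarrow> gdist n E u v \<le> k"
  unfolding gdist_def by (rule Least_le)

locale rooted =
  fixes n :: nat and E :: "nat \<Rightarrow> nat \<Rightarrow> bool" and r :: nat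
  assumes rooted: "is_rooted_tree n E r"
begin

abbreviation "d v \<equiv> gdist n E r v"

lemma root_less: "r < n"
  and card_edges: "card (edges n E) = n - 1"
  using rooted unfolding is_rooted_tree_def is_tree_def by simp_all

lemma edge:
  assumes "E u v"
  shows "u < n \<and> v < n \<and> u \<noteq> v \<and> E v u"
proof -
  have "\<forall>u v. E u v \<longrightarrow> u < n \<and> v < n \<and> u \<noteq> v \<and> E v u"
    using rooted unfolding is_rooted_tree_def is_tree_def by blast
  with assms show ?thesis by blast
qed

lemma conn: "\<lbrakk>u < n; v < n\<rbrakk> \<Longrightarrow> \<exists>k. (u, v) \<in> adj_rel n E ^^ k"
  using rooted unfolding is_rooted_tree_def is_tree_def by meson

lemma relpow_gdist: "\<lbrakk>u < n; v < n\<rbrakk> \<Longrightarrow> (u, v) \<in> adj_rel n E ^^ gdist n E u v"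
  unfolding gdist_def by (rule LeastI_ex) (rule conn)

lemma d_root: "d r = 0"
  using gdist_le[of r r 0] by simp

lemma d_trans: "\<lbrakk>u < n; v < n\<rbrakk> \<Longrightarrow> d v \<le> d u + gdist n E u v"
  by (rule gdist_le) (auto simp: relpow_add intro: relpow_gdist root_less)

lemma d_edge: "E u v \<Longrightarrow> d v \<le> Suc (d u)"
proof -
  assume e: "E u v"
  then have "(u, v) \<in> adj_rel n E ^^ 1" using edge[OF e] by (auto simp: adj_rel_def)
  then have "gdist n E u v \<le> 1" by (rule gdist_le)
  then show ?thesis using d_trans[of u v] edge[OF e] by auto
qed

lemma ex_par:
  assumes "v < n" "v \<noteq> r"
  shows "\<exists>u. E u v \<and> d v = Suc (d u)"
proof -
  have p: "(r, v) \<in> adj_rel n E ^^ d v" by (rule relpow_gdist[OF root_less assms(1)])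
  with assms(2) obtain k where k: "d v = Suc k" by (cases "d v") auto
  from p[unfolded k] obtain u where u: "(r, u) \<in> adj_rel n E ^^ k" "(u, v) \<in> adj_rel n E"
    by (auto elim: relpow_Suc_E)
  from u(2) have e: "E u v" by (simp add: adj_rel_def)
  have "d u \<le> k" by (rule gdist_le[OF u(1)])
  moreover have "Suc k \<le> Suc (d u)" using d_edge[OF e] k by simp
  ultimately show ?thesis using e k by auto
qed

definition "par v = (SOME u. E u v \<and> d v = Suc (d u))"

lemma par: "\<lbrakk>v < n; v \<noteq> r\<rbrakk> \<Longrightarrow> E (par v) v \<and> d v = Suc (d (par v))"
  unfolding par_def by (rule someI_ex) (rule ex_par)

text \<open>The n - 1 parent edges are pairwise distinct, hence they are all of the n - 1 edges. In
  this way the edge count replaces acyclicity.\<close>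

lemma edges_par:
  "edges n E = (\<lambda>v. (min v (par v), max v (par v))) ` ({..<n} - {r})" (is "_ = ?f ` ?V")
proof -
  have inj: "inj_on ?f ?V"
  proof (rule inj_onI)
    fix v w assume v: "v \<in> ?V" and w: "w \<in> ?V" and eq: "?f v = ?f w"
    show "v = w"
    proof (rule ccontr)
      assume "v \<noteq> w"
      with eq have "v = par w" "w = par v"
        by (auto simp only: min_def max_def prod.inject split: if_splits)
      moreover have "d v = Suc (d (par v))" "d w = Suc (d (par w))"
        using par[of v] par[of w] v w by blast+
      ultimately show False by (metis n_not_Suc_n not_less_eq lessI less_SucI)
    qed
  qed
  have sub: "?f ` ?V \<subseteq> edges n E"
  proof
    fix x assume "x \<in> ?f ` ?V"
    then obtain v where v: "v < n" "v \<noteq> r" and x: "x = ?f v" by blast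
    have e: "E (par v) v" using par[OF v] by simp
    then show "x \<in> edges n E" using edge[OF e] x v
      by (auto simp: edges_def min_def max_def)
  qed
  have "finite (edges n E)"
    by (rule finite_subset[of _ "{..<n} \<times> {..<n}"]) (auto simp: edges_def)
  moreover have "card (?f ` ?V) = card (edges n E)"
    using card_image[OF inj] root_less card_edges by simp
  ultimately show ?thesis using card_subset_eq[OF _ sub] by simp
qed

lemma E_iff:
  assumes "u < n" "v < n"
  shows "E u v \<longleftrightarrow> (u \<noteq> r \<and> v = par u) \<or> (v \<noteq> r \<and> u = par v)"
proof
  assume e: "E u v"
  then have "(min u v, max u v) \<in> edges n E"
    using edge[OF e] edge[of v u] by (auto simp: edges_def min_def max_def)
  then obtain w where "w < n" "w \<noteq> r" "min u v = min w (par w)" "max u v = max w (par w)"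
    unfolding edges_par by auto
  then show "(u \<noteq> r \<and> v = par u) \<or> (v \<noteq> r \<and> u = par v)"
    by (auto simp: min_def max_def split: if_splits)
next
  assume "(u \<noteq> r \<and> v = par u) \<or> (v \<noteq> r \<and> u = par v)"
  then show "E u v" using par[of u] par[of v] edge assms by blast
qed

lemma par_less: "\<lbrakk>v < n; v \<noteq> r\<rbrakk> \<Longrightarrow> par v < n"
  using par edge by blast

lemma children_eq: "v < n \<Longrightarrow> children n E r v = {c. c < n \<and> c \<noteq> r \<and> par c = v}"
proof -
  assume v: "v < n"
  have "is_child n E r c v \<longleftrightarrow> c < n \<and> c \<noteq> r \<and> par c = v" for c
  proof
    assume "is_child n E r c v"
    then have c: "c < n" "E v c" "d v < d c" by (auto simp: is_child_def)
    then have "c \<noteq> r" using d_root by auto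
    moreover have "\<not> (v \<noteq> r \<and> c = par v)" using par[OF v] c(3) by auto
    ultimately show "c < n \<and> c \<noteq> r \<and> par c = v" using E_iff[OF v c(1)] c by auto
  next
    assume "c < n \<and> c \<noteq> r \<and> par c = v"
    then show "is_child n E r c v" using par[of c] v by (auto simp: is_child_def)
  qed
  then show ?thesis by (simp add: children_def)
qed

lemma leaf_iff:
  assumes "v < n" "v \<noteq> r"
  shows "is_leaf n E r v \<longleftrightarrow> children n E r v = {}"
proof -
  have fin: "finite (children n E r v)" by (simp add: children_eq[OF assms(1)])
  have "{u. u < n \<and> E v u} = insert (par v) (children n E r v)"
    using par_less[OF assms] assms by (auto simp: children_eq E_iff)
  moreover have "par v \<notin> children n E r v"
    using par[OF assms] by (auto simp: children_def is_child_def)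
  ultimately have "degree n E v = Suc (card (children n E r v))"
    using fin by (simp add: degree_def)
  then show ?thesis using assms fin by (auto simp: is_leaf_def)
qed

text \<open>A descent through children terminates because distances from the root are bounded. For n
  different from 1 it does not stop at the root, which never counts as a leaf.\<close>

lemma ex_leaf_below:
  assumes "n \<noteq> 1" "v < n"
  shows "\<exists>l k. is_leaf n E r l \<and> d l = d v + k \<and> (v, l) \<in> adj_rel n E ^^ k"
  using assms(2)
proof (induction "Max (d ` {..<n}) - d v" arbitrary: v rule: less_induct)
  case less
  show ?case
  proof (cases "children n E r v = {}")
    case True
    have "v \<noteq> r"
    proof
      assume vr: "v = r"
      define w where "w = (if r = 0 then 1 else 0 :: nat)"
      have w: "w < n" "w \<noteq> r" using assms(1) root_less by (auto simp: w_def)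
      from conn[OF root_less w(1)] obtain k where k: "(r, w) \<in> adj_rel n E ^^ k" by auto
      with w(2) obtain k' where "k = Suc k'" by (cases k) auto
      with k obtain u where "(r, u) \<in> adj_rel n E" by (metis relpow_Suc_D2)
      then have e: "E r u" by (simp add: adj_rel_def)
      then have "u < n" "u \<noteq> r" using edge[OF e] by auto
      moreover have "d r < d u" using par[of u] \<open>u < n\<close> \<open>u \<noteq> r\<close> d_root by simp
      ultimately have "u \<in> children n E r v" using e vr root_less
        by (simp add: children_def is_child_def)
      with True show False by simp
    qed
    then have "is_leaf n E r v" using leaf_iff[OF less.prems] True by simp
    then show ?thesis by (intro exI[of _ v] exI[of _ 0]) auto
  next
    case False
    then obtain c where c: "c < n" "c \<noteq> r" "par c = v" using children_eq[OF less.prems] by auto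
    have dc: "d c = Suc (d v)" "E v c" using par[OF c(1,2)] c by auto
    have "d c \<le> Max (d ` {..<n})" using c by (intro Max_ge) auto
    then obtain l k where lk: "is_leaf n E r l" "d l = d c + k" "(c, l) \<in> adj_rel n E ^^ k"
      using less.hyps[of c] dc c by (metis Suc_le_lessD diff_less_mono2 lessI)
    have "(v, c) \<in> adj_rel n E" using dc(2) c less.prems by (simp add: adj_rel_def)
    then have "(v, l) \<in> adj_rel n E ^^ Suc k" using lk(3) by (rule relpow_Suc_I2)
    then show ?thesis using lk dc by (intro exI[of _ l] exI[of _ "Suc k"]) auto
  qed
qed

end

text \<open>If all leaves have distance D from the root, the height of v is D - \<open>d v\<close>:
  the triangle inequality gives one bound, a leaf below v the other. So heights grow by one from
  child to parent.\<close>

lemma lush_hedge_lush_tree: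
  assumes lush: "is_lush n E r" and H: "hedge_height n E r \<ge> 8"
  shows "\<exists>par. lush_tree n r (hedge_height n E r) E par (hgt n E r)"
proof -
  have hedge: "is_hedge n E r" using lush by (simp add: is_lush_def)
  then interpret rooted n E r by unfold_locales (simp add: is_hedge_def)
  \<comment> \<open>For n = 1 there are no leaves, and \<open>hgt\<close> is \<open>Min\<close> of
    the empty set, an unspecified number. The three children demanded at height at least 2 exclude
    this case.\<close>
  have n1: "n \<noteq> 1"
  proof
    assume "n = 1"
    then have "children n E r r \<subseteq> {0}" by (auto simp: children_def is_child_def)
    then have "card (children n E r r) \<le> 1" using card_mono[of "{0::nat}"] by fastforce
    moreover have "card (children n E r r) \<ge> 3"
      using lush H root_less by (simp add: is_lush_def hedge_height_def)
    ultimately show False by simp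
  qed
  obtain l0 where l0: "is_leaf n E r l0" using ex_leaf_below[OF n1 root_less] by auto
  define D where "D = d l0"
  have leaf_D: "is_leaf n E r l \<Longrightarrow> d l = D" for l
    using hedge n1 l0 unfolding is_hedge_def D_def by blast
  have leaf_less: "is_leaf n E r l \<Longrightarrow> l < n" for l by (simp add: is_leaf_def)
  have hgt: "hgt n E r v = D - d v \<and> d v \<le> D" if v: "v < n" for v
  proof -
    obtain l k where lk: "is_leaf n E r l" "d l = d v + k" "(v, l) \<in> adj_rel n E ^^ k"
      using ex_leaf_below[OF n1 v] by auto
    have k: "k = D - d v" "d v \<le> D" using leaf_D[OF lk(1)] lk(2) by auto
    have lower: "D - d v \<le> gdist n E v l'" if "is_leaf n E r l'" for l'
      using d_trans[OF v leaf_less[OF that]] leaf_D[OF that] by simp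
    have "gdist n E v l = D - d v" using lower[OF lk(1)] gdist_le[OF lk(3)] k by simp
    then have "Min {gdist n E v w |w. is_leaf n E r w} = D - d v"
    proof (intro Min_eqI)
      show "finite {gdist n E v w |w. is_leaf n E r w}"
        by (rule finite_subset[of _ "gdist n E v ` {..<n}"]) (auto dest: leaf_less)
    qed (use lower lk(1) in \<open>auto intro: exI[of _ l]\<close>)
    then show ?thesis using k by (simp add: hgt_def)
  qed
  have HD: "hedge_height n E r = D" using hgt[OF root_less] d_root by (simp add: hedge_height_def)
  show ?thesis
  proof (intro exI[of _ par] lush_tree.intro)
    show "hgt n E r (par v) = Suc (hgt n E r v)" if "v < n" "v \<noteq> r" for v
      using par[OF that] hgt[OF that(1)] hgt[OF par_less[OF that]] by auto
    show "hgt n E r v \<le> hedge_height n E r" if "v < n" for v using hgt[OF that] HD by simp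
    show "3 \<le> card {c. c < n \<and> c \<noteq> r \<and> par c = v}" if "v < n" "2 \<le> hgt n E r v" for v
      using lush that unfolding is_lush_def children_eq[OF that(1), symmetric] by blast
    show "2 \<le> card {c. c < n \<and> c \<noteq> r \<and> par c = v}" if "v < n" "hgt n E r v = 1" for v
      using lush that unfolding is_lush_def children_eq[OF that(1), symmetric] by blast
  qed (use root_less par_less E_iff H in \<open>auto simp: hedge_height_def\<close>)
qed

section \<open>Elimination from the leaves\<close>

text \<open>A permutation with nonzero product never raises h, and it preserves the sum of h; so it
  cannot lower h anywhere either, and only the identity is left.\<close>

lemma det_height_triangular:
  fixes L :: "real mat" and h :: "nat \<Rightarrow> nat"
  assumes L: "L \<in> carrier_mat n n"
    and tri: "\<And>i j. \<lbrakk>i < n; j < n; L $$ (i, j) \<noteq> 0\<rbrakk> \<Longrightarrow> i = j \<or> h j < h i"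
  shows "det L = (\<Prod>i<n. L $$ (i, i))"
proof -
  have zero: "(\<Prod>i = 0..<n. L $$ (i, p i)) = 0" if p: "p permutes {0..<n}" and "p \<noteq> id" for p
  proof (rule ccontr)
    assume "(\<Prod>i = 0..<n. L $$ (i, p i)) \<noteq> 0"
    then have nz: "L $$ (i, p i) \<noteq> 0" if "i < n" for i using that by auto
    have pi: "p i < n" if "i < n" for i using permutes_in_image[OF p, of i] that by simp
    have alt: "p i = i \<or> h (p i) < h i" if "i < n" for i
      using tri[OF that pi[OF that] nz[OF that]] by metis
    have "(\<Sum>i\<in>{0..<n}. h (p i)) = (\<Sum>i\<in>{0..<n}. h i)"
      using sum.permute[OF p, of h] by (simp add: o_def)
    then have "p i = i" if "i < n" for i
    proof -
      assume eq: "(\<Sum>i\<in>{0..<n}. h (p i)) = (\<Sum>i\<in>{0..<n}. h i)"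
      show ?thesis
      proof (rule ccontr)
        assume "p i \<noteq> i"
        with alt[OF that] have "h (p i) < h i" by simp
        moreover have "h (p j) \<le> h j" if "j < n" for j using alt[OF that] by (auto simp: less_imp_le)
        ultimately have "(\<Sum>i\<in>{0..<n}. h (p i)) < (\<Sum>i\<in>{0..<n}. h i)"
          using that by (intro sum_strict_mono_ex1) auto
        with eq show False by simp
      qed
    qed
    then have "p = id" using permutes_not_in[OF p] by (fastforce simp: fun_eq_iff)
    with \<open>p \<noteq> id\<close> show False by simp
  qed
  have "det L = (\<Sum>p\<in>{p. p permutes {0..<n}}. signof p * (\<Prod>i = 0..<n. L $$ (i, p i)))"
    by (rule det_def'[OF L])
  also have "\<dots> = (\<Sum>p\<in>{id}. signof p * (\<Prod>i = 0..<n. L $$ (i, p i)))"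
    by (rule sum.mono_neutral_right) (use zero in \<open>auto simp: finite_permutations permutes_id\<close>)
  also have "\<dots> = (\<Prod>i<n. L $$ (i, i))" by (simp add: atLeast0LessThan)
  finally show ?thesis .
qed

text \<open>The reciprocal with 1/infinity = 0. At \<open>Some 0\<close> it takes the value 1/0 = 0,
  so \<open>Fl\<close> has to treat vanishing children separately.\<close>

fun oinv :: "real option \<Rightarrow> real" where
  "oinv None = 0"
| "oinv (Some y) = 1 / y"

context lush_tree
begin

definition ch :: "nat \<Rightarrow> nat set" where
  "ch v = {c. c < n \<and> c \<noteq> r \<and> par c = v}"

definition V :: "nat \<Rightarrow> nat set" where
  "V k = {v. v < n \<and> lev v = k}"

lemma finite_ch [simp]: "finite (ch v)" by (simp add: ch_def)
lemma finite_V [simp]: "finite (V k)" by (simp add: V_def)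

lemma chD: "c \<in> ch v \<Longrightarrow> c < n \<and> c \<noteq> r \<and> par c = v \<and> v < n \<and> lev v = Suc (lev c)"
  using par_less lev_par by (auto simp: ch_def)

lemma card_ch_ge: "\<lbrakk>v < n; lev v \<noteq> 0\<rbrakk> \<Longrightarrow> card (ch v) \<ge> 2"
  using two_children[of v] three_children[of v] by (cases "lev v = 1") (auto simp: ch_def)

lemma card_ch_ge3: "\<lbrakk>v < n; lev v \<ge> 2\<rbrakk> \<Longrightarrow> card (ch v) \<ge> 3"
  using three_children[of v] by (auto simp: ch_def)

lemma ch_leaf: "lev v = 0 \<Longrightarrow> ch v = {}"
  using chD by fastforce

lemma E_iff_ch: "\<lbrakk>u < n; v < n\<rbrakk> \<Longrightarrow> E u v \<longleftrightarrow> u \<in> ch v \<or> v \<in> ch u"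
  by (auto simp: E_iff ch_def)

lemma ch_asym: "c \<in> ch v \<Longrightarrow> v \<notin> ch c"
  using chD[of c v] chD[of v c] by auto

lemma ch_neq: "c \<in> ch v \<Longrightarrow> c \<noteq> v"
  using chD by fastforce

text \<open>F A x v is the pivot of x - A at v when the tree is eliminated from the leaves upwards;
  None stands for infinity.\<close>
primrec Fl :: "real mat \<Rightarrow> real \<Rightarrow> nat \<Rightarrow> nat \<Rightarrow> real option" where
  "Fl A x 0 v = Some (x - A $$ (v, v))"
| "Fl A x (Suc k) v = (if \<exists>c\<in>ch v. Fl A x k c = Some 0 then None
     else Some (x - A $$ (v, v) - (\<Sum>c\<in>ch v. (A $$ (v, c))^2 * oinv (Fl A x k c))))"

definition F :: "real mat \<Rightarrow> real \<Rightarrow> nat \<Rightarrow> real option" where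
  "F A x v = Fl A x (lev v) v"

lemma F_eq: "F A x v = (if \<exists>c\<in>ch v. F A x c = Some 0 then None
     else Some (x - A $$ (v, v) - (\<Sum>c\<in>ch v. (A $$ (v, c))^2 * oinv (F A x c))))"
proof (cases "lev v")
  case 0
  then show ?thesis by (simp add: F_def ch_leaf)
next
  case (Suc k)
  have "F A x c = Fl A x k c" if "c \<in> ch v" for c using chD[OF that] Suc by (simp add: F_def)
  then show ?thesis using Suc by (simp add: F_def)
qed

text \<open>The same pivots as real functions, for generic x; at the poles 1/0 = 0 makes them meaningless.\<close>
primrec fl :: "real mat \<Rightarrow> nat \<Rightarrow> nat \<Rightarrow> real \<Rightarrow> real" where
  "fl A 0 v x = x - A $$ (v, v)"
| "fl A (Suc k) v x = x - A $$ (v, v) - (\<Sum>c\<in>ch v. (A $$ (v, c))^2 / fl A k c x)"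

definition fr :: "real mat \<Rightarrow> nat \<Rightarrow> real \<Rightarrow> real" where
  "fr A v x = fl A (lev v) v x"

lemma fr_eq: "fr A v x = x - A $$ (v, v) - (\<Sum>c\<in>ch v. (A $$ (v, c))^2 / fr A c x)"
proof (cases "lev v")
  case 0
  then show ?thesis by (simp add: fr_def ch_leaf)
next
  case (Suc k)
  have "fr A c x = fl A k c x" if "c \<in> ch v" for c using chD[OF that] Suc by (simp add: fr_def)
  then show ?thesis using Suc by (simp add: fr_def)
qed

lemma S_T_D:
  assumes "A \<in> S_T n E"
  shows "A \<in> carrier_mat n n"
    and "\<lbrakk>i < n; j < n\<rbrakk> \<Longrightarrow> A $$ (i, j) = A $$ (j, i)"
    and "\<lbrakk>i < n; j < n; i \<noteq> j\<rbrakk> \<Longrightarrow> A $$ (i, j) \<noteq> 0 \<longleftrightarrow> i \<in> ch j \<or> j \<in> ch i"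
proof -
  have A: "A \<in> carrier_mat n n" "A\<^sup>T = A" using assms by (auto simp: S_T_def)
  show "A \<in> carrier_mat n n" by fact
  show "A $$ (i, j) = A $$ (j, i)" if "i < n" "j < n"
    using A that by (metis carrier_matD index_transpose_mat(1))
  show "A $$ (i, j) \<noteq> 0 \<longleftrightarrow> i \<in> ch j \<or> j \<in> ch i" if "i < n" "j < n" "i \<noteq> j"
    using assms that by (simp add: S_T_def E_iff_ch)
qed

text \<open>This is the factorisation x - A = L D L^T with the pivots on the diagonal D;
  \<open>LD\<close> is the product L D. There is no fill-in because two different vertices never
  share a child.\<close>

lemma poly_char_poly_eq_prod:
  assumes A: "A \<in> S_T n E" and nz: "\<And>v. v < n \<Longrightarrow> fr A v x \<noteq> 0"
  shows "poly (char_poly A) x = (\<Prod>v<n. fr A v x)"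
proof -
  note AD = S_T_D[OF A]
  define LD where "LD = mat n n (\<lambda>(i, j). if i = j then fr A j x else if j \<in> ch i then - A $$ (i, j) else 0)"
  define L where "L = mat n n (\<lambda>(i, j). if i = j then 1 else if j \<in> ch i then - A $$ (i, j) / fr A j x else 0)"
  have LDc: "LD \<in> carrier_mat n n" and Lc: "L \<in> carrier_mat n n" by (auto simp: LD_def L_def)
  have "- (char_matrix A x) = LD * L\<^sup>T"
  proof (rule eq_matI)
    fix i j assume "i < dim_row (LD * L\<^sup>T)" "j < dim_col (LD * L\<^sup>T)"
    then have ij: "i < n" "j < n" using LDc Lc by auto
    have lhs: "(- (char_matrix A x)) $$ (i, j) = (if i = j then x else 0) - A $$ (i, j)"
      using ij AD(1) by (auto simp: char_matrix_def)
    have rhs: "(LD * L\<^sup>T) $$ (i, j) = (\<Sum>k<n. LD $$ (i, k) * L $$ (j, k))"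
      using ij LDc Lc by (simp add: scalar_prod_def atLeast0LessThan)
    have "(\<Sum>k<n. LD $$ (i, k) * L $$ (j, k)) = (if i = j then x else 0) - A $$ (i, j)"
    proof (cases "i = j")
      case True
      have "(\<Sum>k<n. LD $$ (i, k) * L $$ (j, k)) = (\<Sum>k\<in>insert i (ch i). LD $$ (i, k) * L $$ (j, k))"
        by (rule sum.mono_neutral_right) (use True ij in \<open>auto simp: LD_def dest: chD\<close>)
      also have "\<dots> = fr A i x + (\<Sum>k\<in>ch i. LD $$ (i, k) * L $$ (j, k))"
        using ch_neq[of i i] True ij by (subst sum.insert) (auto simp: LD_def L_def)
      also have "(\<Sum>k\<in>ch i. LD $$ (i, k) * L $$ (j, k)) = (\<Sum>k\<in>ch i. (A $$ (i, k))^2 / fr A k x)"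
      proof (rule sum.cong)
          fix k assume k: "k \<in> ch i"
          then show "LD $$ (i, k) * L $$ (j, k) = (A $$ (i, k))^2 / fr A k x"
            using True ij chD[OF k] ch_neq[OF k] by (simp add: LD_def L_def power2_eq_square)
        qed simp
      finally show ?thesis using True fr_eq[of A i x] by simp
    next
      case False
      have single: "(\<Sum>k<n. LD $$ (i, k) * L $$ (j, k)) = (\<Sum>k\<in>{m}. LD $$ (i, k) * L $$ (j, k))"
        if "m < n" "\<And>k. \<lbrakk>k < n; k \<noteq> m\<rbrakk> \<Longrightarrow> LD $$ (i, k) * L $$ (j, k) = 0" for m
        by (rule sum.mono_neutral_right) (use that in auto)
      consider "i \<in> ch j" | "j \<in> ch i" | "i \<notin> ch j" "j \<notin> ch i" by blast
      then show ?thesis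
      proof cases
        case 1
        have "(\<Sum>k<n. LD $$ (i, k) * L $$ (j, k)) = (\<Sum>k\<in>{i}. LD $$ (i, k) * L $$ (j, k))"
          by (rule single) (use ij False 1 ch_asym[OF 1] in \<open>auto simp: LD_def L_def dest: chD\<close>)
        then show ?thesis using ij False 1 nz[of i] AD(2)[of i j] by (simp add: LD_def L_def)
      next
        case 2
        have "(\<Sum>k<n. LD $$ (i, k) * L $$ (j, k)) = (\<Sum>k\<in>{j}. LD $$ (i, k) * L $$ (j, k))"
          by (rule single) (use ij False 2 ch_asym[OF 2] in \<open>auto simp: LD_def L_def dest: chD\<close>)
        then show ?thesis using ij False 2 by (simp add: LD_def L_def)
      next
        case 3
        have "LD $$ (i, k) * L $$ (j, k) = 0" if "k < n" for k
          using ij False 3 that by (auto simp: LD_def L_def dest: chD)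
        then have "(\<Sum>k<n. LD $$ (i, k) * L $$ (j, k)) = 0" by (intro sum.neutral) auto
        moreover have "A $$ (i, j) = 0" using AD(3)[of i j] ij False 3 by auto
        ultimately show ?thesis using False by simp
      qed
    qed
    then show "(- (char_matrix A x)) $$ (i, j) = (LD * L\<^sup>T) $$ (i, j)" using lhs rhs by simp
  qed (use AD(1) LDc Lc in \<open>auto simp: char_matrix_def\<close>)
  then have "poly (char_poly A) x = det LD * det (L\<^sup>T)"
    unfolding char_poly_matrix[OF AD(1)] using det_mult[OF LDc, of "L\<^sup>T"] Lc by simp
  also have "det (L\<^sup>T) = det L" by (rule det_transpose[OF Lc])
  also have "det L = (\<Prod>i<n. L $$ (i, i))"
    by (rule det_height_triangular[OF Lc, of lev]) (auto simp: L_def split: if_splits dest: chD)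
  also have "\<dots> = 1" by (simp add: L_def)
  also have "det LD = (\<Prod>i<n. LD $$ (i, i))"
    by (rule det_height_triangular[OF LDc, of lev]) (auto simp: LD_def split: if_splits dest: chD)
  also have "\<dots> = (\<Prod>v<n. fr A v x)" by (simp add: LD_def)
  finally show ?thesis by simp
qed

end

section \<open>Multiplicities count zeros minus poles\<close>

lemma tendsto_of_quotient:
  fixes f :: "real \<Rightarrow> real"
  assumes "((\<lambda>x. (f x - y) / (x - l)) \<longlongrightarrow> D) (at l)"
  shows "(f \<longlongrightarrow> y) (at l)"
proof -
  have "((\<lambda>x. y + (x - l) * ((f x - y) / (x - l))) \<longlongrightarrow> y + (l - l) * D) (at l)"
    by (intro tendsto_intros assms)
  moreover have "\<forall>\<^sub>F x in at l. y + (x - l) * ((f x - y) / (x - l)) = f x"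
    by (auto simp: eventually_at_filter)
  ultimately show ?thesis using tendsto_cong by fastforce
qed

lemma tendsto_powi_at_imp_zero:
  fixes l c :: real
  assumes lim: "((\<lambda>x. (x - l) powi k) \<longlongrightarrow> c) (at l)" and c: "c \<noteq> 0"
  shows "k = 0"
proof (rule ccontr)
  have pos: "((\<lambda>x. (x - l) powi j) \<longlongrightarrow> 0) (at l)" if "j > 0" for j
  proof -
    have "((\<lambda>x. (x - l) ^ nat j) \<longlongrightarrow> (l - l) ^ nat j) (at l)" by (intro tendsto_intros)
    moreover have "((\<lambda>x. x - l) \<longlongrightarrow> l - l) (at l)" by (intro tendsto_intros)
    ultimately show ?thesis using that by (simp add: power_int_def)
  qed
  assume "k \<noteq> 0"
  then consider "k > 0" | "k < 0" by linarith
  then show False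
  proof cases
    case 1
    then show False using tendsto_unique[OF _ lim pos] c by simp
  next
    case 2
    have "((\<lambda>x. inverse ((x - l) powi k)) \<longlongrightarrow> inverse c) (at l)" by (intro tendsto_inverse lim c)
    then have "((\<lambda>x. (x - l) powi (- k)) \<longlongrightarrow> inverse c) (at l)" by (simp add: power_int_minus)
    then show False using tendsto_unique[OF _ _ pos] 2 c by fastforce
  qed
qed

lemma prod_powi: "(a :: real) \<noteq> 0 \<Longrightarrow> (\<Prod>v\<in>S. a powi e v) = a powi (\<Sum>v\<in>S. e v)"
  by (induction S rule: infinite_finite_induct) (auto simp: power_int_add)

fun wt :: "real option \<Rightarrow> int" where
  "wt None = -1"
| "wt (Some y) = (if y = 0 then 1 else 0)"

text \<open>The local behaviour at l of the pivots, which are increasing rational functions: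
  D is the derivative at a finite value, and -c the residue at a pole.\<close>
fun behaves :: "(real \<Rightarrow> real) \<Rightarrow> real \<Rightarrow> real option \<Rightarrow> bool" where
  "behaves f l None \<longleftrightarrow> (\<exists>c>0. ((\<lambda>x. (x - l) * f x) \<longlongrightarrow> - c) (at l))"
| "behaves f l (Some y) \<longleftrightarrow> (\<exists>D\<ge>1. ((\<lambda>x. (f x - y) / (x - l)) \<longlongrightarrow> D) (at l))"

lemma behaves_inverse_pole:
  assumes "behaves f l (Some 0)"
  shows "\<exists>L>0. ((\<lambda>x. (x - l) * (1 / f x)) \<longlongrightarrow> L) (at l)"
proof -
  from assms obtain D where D: "D \<ge> 1" "((\<lambda>x. (f x - 0) / (x - l)) \<longlongrightarrow> D) (at l)" by auto
  have "((\<lambda>x. 1 / ((f x - 0) / (x - l))) \<longlongrightarrow> 1 / D) (at l)"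
    using D by (intro tendsto_intros) auto
  then show ?thesis using D(1) by (intro exI[of _ "1 / D"]) auto
qed

lemma behaves_inverse_finite:
  assumes b: "behaves f l z" and z: "z \<noteq> Some 0"
  shows "\<exists>D\<ge>0. ((\<lambda>x. (1 / f x - oinv z) / (x - l)) \<longlongrightarrow> - D) (at l)"
proof (cases z)
  case None
  with b obtain c where c: "c > 0" "((\<lambda>x. (x - l) * f x) \<longlongrightarrow> - c) (at l)" by auto
  have "((\<lambda>x. 1 / ((x - l) * f x)) \<longlongrightarrow> 1 / (- c)) (at l)"
    using c by (intro tendsto_intros) auto
  moreover have "1 / ((x - l) * f x) = (1 / f x - 0) / (x - l)" for x by (simp add: mult.commute)
  ultimately show ?thesis using c None by (intro exI[of _ "1 / c"]) simp
next
  case (Some y)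
  then have y: "y \<noteq> 0" using z by auto
  from b Some obtain D where D: "D \<ge> 1" "((\<lambda>x. (f x - y) / (x - l)) \<longlongrightarrow> D) (at l)" by auto
  have fy: "(f \<longlongrightarrow> y) (at l)" by (rule tendsto_of_quotient[OF D(2)])
  have "((\<lambda>x. - ((f x - y) / (x - l)) / (f x * y)) \<longlongrightarrow> - D / (y * y)) (at l)"
    by (intro tendsto_intros D fy) (use y in auto)
  moreover have "\<forall>\<^sub>F x in at l. - ((f x - y) / (x - l)) / (f x * y) = (1 / f x - 1 / y) / (x - l)"
    using tendsto_imp_eventually_ne[OF fy y]
  proof eventually_elim
    case (elim x)
    have "1 / f x - 1 / y = (y - f x) / (f x * y)" using elim y by (simp add: diff_frac_eq)
    then show ?case by (simp add: minus_divide_left mult.commute)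
  qed
  ultimately have "((\<lambda>x. (1 / f x - 1 / y) / (x - l)) \<longlongrightarrow> - D / (y * y)) (at l)"
    using tendsto_cong by fastforce
  moreover have "D / (y * y) \<ge> 0" using D(1) by auto
  ultimately show ?thesis using Some by (intro exI[of _ "D / (y * y)"]) auto
qed

lemma behaves_scaled:
  assumes "behaves f l z"
  shows "\<exists>c. c \<noteq> 0 \<and> ((\<lambda>x. f x * (x - l) powi (- wt z)) \<longlongrightarrow> c) (at l)"
proof (cases z)
  case None
  with assms obtain c where "c > 0" "((\<lambda>x. (x - l) * f x) \<longlongrightarrow> - c) (at l)" by auto
  then show ?thesis using None by (intro exI[of _ "- c"]) (simp add: mult.commute)
next
  case (Some y)
  then obtain D where D: "D \<ge> 1" "((\<lambda>x. (f x - y) / (x - l)) \<longlongrightarrow> D) (at l)" using assms by auto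
  show ?thesis
  proof (cases "y = 0")
    case True
    then show ?thesis using D Some
      by (intro exI[of _ D]) (simp add: power_int_minus divide_inverse)
  next
    case False
    then show ?thesis using tendsto_of_quotient[OF D(2)] Some by (intro exI[of _ y]) simp
  qed
qed

context lush_tree
begin

text \<open>A child c contributes -(A_vc)^2 / f_c, and all these terms are increasing with residues
  of one sign. Hence poles of different children cannot cancel, and at finite values the derivative
  stays at least 1, the share of x itself.\<close>

lemma behaves_fr:
  assumes A: "A \<in> S_T n E"
  shows "v < n \<Longrightarrow> behaves (fr A v) l (F A l v)"
proof (induction "lev v" arbitrary: v rule: less_induct)
  case less
  have IH: "behaves (fr A c) l (F A l c)" if "c \<in> ch v" for c
    using less.hyps[of c] chD[OF that] by auto
  have b: "(A $$ (v, c))^2 > 0" if "c \<in> ch v" for c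
    using S_T_D(3)[OF A, of v c] chD[OF that] ch_neq[OF that] that by auto
  have lim1: "\<exists>L\<ge>0. ((\<lambda>x. (x - l) * (1 / fr A c x)) \<longlongrightarrow> L) (at l) \<and> (F A l c = Some 0 \<longrightarrow> L > 0)"
    if c: "c \<in> ch v" for c
  proof (cases "F A l c = Some 0")
    case True
    then show ?thesis using behaves_inverse_pole[of "fr A c" l] IH[OF c] by (metis less_imp_le)
  next
    case False
    obtain D where "((\<lambda>x. (1 / fr A c x - oinv (F A l c)) / (x - l)) \<longlongrightarrow> - D) (at l)"
      using behaves_inverse_finite[OF IH[OF c] False] by auto
    then have "((\<lambda>x. 1 / fr A c x) \<longlongrightarrow> oinv (F A l c)) (at l)" by (rule tendsto_of_quotient)
    then have "((\<lambda>x. (x - l) * (1 / fr A c x)) \<longlongrightarrow> (l - l) * oinv (F A l c)) (at l)"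
      by (intro tendsto_intros)
    then show ?thesis using False by (intro exI[of _ 0]) simp
  qed
  show ?case
  proof (cases "\<exists>c\<in>ch v. F A l c = Some 0")
    case True
    then obtain c0 where c0: "c0 \<in> ch v" "F A l c0 = Some 0" by auto
    obtain L where L: "\<And>c. c \<in> ch v \<Longrightarrow> L c \<ge> 0 \<and>
        ((\<lambda>x. (x - l) * (1 / fr A c x)) \<longlongrightarrow> L c) (at l) \<and> (F A l c = Some 0 \<longrightarrow> L c > 0)"
      using lim1 by metis
    have "((\<lambda>x. (x - l) * (x - A $$ (v, v)) - (\<Sum>c\<in>ch v. (A $$ (v, c))^2 * ((x - l) * (1 / fr A c x))))
       \<longlongrightarrow> (l - l) * (l - A $$ (v, v)) - (\<Sum>c\<in>ch v. (A $$ (v, c))^2 * L c)) (at l)"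
      using L by (intro tendsto_intros) auto
    moreover have "(x - l) * (x - A $$ (v, v)) - (\<Sum>c\<in>ch v. (A $$ (v, c))^2 * ((x - l) * (1 / fr A c x)))
        = (x - l) * fr A v x" for x
    proof -
      have "(\<Sum>c\<in>ch v. (A $$ (v, c))^2 * ((x - l) * (1 / fr A c x)))
        = (x - l) * (\<Sum>c\<in>ch v. (A $$ (v, c))^2 / fr A c x)"
        by (simp add: sum_distrib_left mult_ac)
      then show ?thesis by (simp only: fr_eq[of A v x] right_diff_distrib)
    qed
    moreover have "(\<Sum>c\<in>ch v. (A $$ (v, c))^2 * L c) > 0"
      using L b c0 by (intro sum_pos2[of _ c0]) auto
    ultimately show ?thesis using True F_eq[of A l v] by auto
  next
    case False
    define y where "y = l - A $$ (v, v) - (\<Sum>c\<in>ch v. (A $$ (v, c))^2 * oinv (F A l c))"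
    have Fv: "F A l v = Some y" using False F_eq[of A l v] by (simp add: y_def)
    have "\<forall>c\<in>ch v. \<exists>D\<ge>0. ((\<lambda>x. (1 / fr A c x - oinv (F A l c)) / (x - l)) \<longlongrightarrow> - D) (at l)"
      using behaves_inverse_finite IH False by blast
    then obtain D where D: "\<And>c. c \<in> ch v \<Longrightarrow> D c \<ge> 0 \<and>
        ((\<lambda>x. (1 / fr A c x - oinv (F A l c)) / (x - l)) \<longlongrightarrow> - D c) (at l)"
      by metis
    have "((\<lambda>x. 1 - (\<Sum>c\<in>ch v. (A $$ (v, c))^2 * ((1 / fr A c x - oinv (F A l c)) / (x - l))))
       \<longlongrightarrow> 1 - (\<Sum>c\<in>ch v. (A $$ (v, c))^2 * - D c)) (at l)"
      using D by (intro tendsto_intros) auto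
    moreover have "\<forall>\<^sub>F x in at l. 1 - (\<Sum>c\<in>ch v. (A $$ (v, c))^2 * ((1 / fr A c x - oinv (F A l c)) / (x - l)))
        = (fr A v x - y) / (x - l)"
    proof -
      have "1 - (\<Sum>c\<in>ch v. (A $$ (v, c))^2 * ((1 / fr A c x - oinv (F A l c)) / (x - l)))
        = (fr A v x - y) / (x - l)" if "x \<noteq> l" for x
      proof -
        have "(\<Sum>c\<in>ch v. (A $$ (v, c))^2 * ((1 / fr A c x - oinv (F A l c)) / (x - l)))
          = ((\<Sum>c\<in>ch v. (A $$ (v, c))^2 / fr A c x) - (\<Sum>c\<in>ch v. (A $$ (v, c))^2 * oinv (F A l c))) / (x - l)"
          by (simp add: sum_divide_distrib sum_subtractf[symmetric] right_diff_distrib)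
        moreover have "1 - z / (x - l) = (x - l - z) / (x - l)" for z
          using that by (simp add: diff_divide_distrib)
        moreover have "x - l - ((\<Sum>c\<in>ch v. (A $$ (v, c))^2 / fr A c x) - (\<Sum>c\<in>ch v. (A $$ (v, c))^2 * oinv (F A l c)))
          = fr A v x - y" by (simp add: fr_eq[of A v x] y_def)
        ultimately show ?thesis by presburger
      qed
      then show ?thesis by (auto simp: eventually_at_filter)
    qed
    ultimately have "((\<lambda>x. (fr A v x - y) / (x - l)) \<longlongrightarrow> 1 - (\<Sum>c\<in>ch v. (A $$ (v, c))^2 * - D c)) (at l)"
      using tendsto_cong by fastforce
    moreover have "(\<Sum>c\<in>ch v. (A $$ (v, c))^2 * - D c) \<le> 0"
      using D by (intro sum_nonpos) (auto simp: mult_nonneg_nonneg)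
    ultimately show ?thesis
      unfolding Fv by (auto intro!: exI[of _ "1 - (\<Sum>c\<in>ch v. (A $$ (v, c))^2 * - D c)"])
  qed
qed

text \<open>The orders at l on both sides of the product formula are compared by a limit: their
  difference k makes (x - l) \<open>powi\<close> k converge to a nonzero number, so k = 0.\<close>

theorem mult_eq_sum_wt:
  assumes A: "A \<in> S_T n E"
  shows "int (mult l A) = (\<Sum>v<n. wt (F A l v))"
proof -
  define p where "p = char_poly A"
  define m where "m = order l p"
  define e where "e = (\<Sum>v<n. wt (F A l v))"
  have p0: "p \<noteq> 0" using degree_monic_char_poly[OF S_T_D(1)[OF A]] by (auto simp: p_def)
  obtain q where pq: "p = [:- l, 1:] ^ m * q" and q: "\<not> [:- l, 1:] dvd q"
    using order_decomp[OF p0, of l] by (auto simp: m_def)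
  have ql: "poly q l \<noteq> 0" using q by (simp add: poly_eq_0_iff_dvd)
  have "\<forall>v. \<exists>c. v < n \<longrightarrow> c \<noteq> 0 \<and> ((\<lambda>x. fr A v x * (x - l) powi (- wt (F A l v))) \<longlongrightarrow> c) (at l)"
    using behaves_scaled[OF behaves_fr[OF A]] by blast
  then obtain c where c: "\<And>v. v < n \<Longrightarrow> c v \<noteq> 0 \<and>
      ((\<lambda>x. fr A v x * (x - l) powi (- wt (F A l v))) \<longlongrightarrow> c v) (at l)" by metis
  have lim: "((\<lambda>x. \<Prod>v<n. fr A v x * (x - l) powi (- wt (F A l v))) \<longlongrightarrow> (\<Prod>v<n. c v)) (at l)"
    using c by (intro tendsto_prod) auto
  have "\<forall>\<^sub>F x in at l. fr A v x \<noteq> 0" if "v < n" for v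
  proof -
    have "\<forall>\<^sub>F x in at l. fr A v x * (x - l) powi (- wt (F A l v)) \<noteq> 0"
      using c[OF that] by (intro tendsto_imp_eventually_ne[of _ "c v"]) auto
    then show ?thesis by eventually_elim auto
  qed
  then have "\<forall>\<^sub>F x in at l. \<forall>v\<in>{..<n}. fr A v x \<noteq> 0" by (intro eventually_ball_finite) auto
  moreover have "\<forall>\<^sub>F x in at l. x \<noteq> l" by (simp add: eventually_at_filter)
  moreover have "\<forall>\<^sub>F x in at l. poly q x \<noteq> 0"
    using ql by (intro tendsto_imp_eventually_ne[of _ "poly q l"]) (auto intro: isContD[OF poly_isCont])
  ultimately have ev: "\<forall>\<^sub>F x in at l. (\<Prod>v<n. fr A v x * (x - l) powi (- wt (F A l v))) / poly q x
      = (x - l) powi (int m - e)"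
  proof eventually_elim
    case (elim x)
    have "(\<Prod>v<n. fr A v x * (x - l) powi (- wt (F A l v))) = poly p x * (x - l) powi (- e)"
      using elim poly_char_poly_eq_prod[OF A, of x]
      by (simp add: prod.distrib prod_powi e_def sum_negf p_def)
    also have "poly p x = (x - l) powi int m * poly q x" by (simp add: pq)
    finally show ?case using elim by (simp add: power_int_add[symmetric] power_int_diff power_int_minus divide_inverse)
  qed
  have "((\<lambda>x. (\<Prod>v<n. fr A v x * (x - l) powi (- wt (F A l v))) / poly q x)
      \<longlongrightarrow> (\<Prod>v<n. c v) / poly q l) (at l)"
    using ql by (intro tendsto_divide lim) (auto intro: isContD[OF poly_isCont])
  then have "((\<lambda>x. (x - l) powi (int m - e)) \<longlongrightarrow> (\<Prod>v<n. c v) / poly q l) (at l)"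
    using tendsto_cong[OF ev] by simp
  moreover have "(\<Prod>v<n. c v) / poly q l \<noteq> 0" using c ql by auto
  ultimately have "int m - e = 0" by (rule tendsto_powi_at_imp_zero)
  moreover have "mult l A = m" using p0 by (simp add: mult_def spec_mset_def m_def p_def)
  ultimately show ?thesis by (simp add: e_def)
qed

end

section \<open>Forced zero patterns\<close>

text \<open>Zeros (1), poles (-1) and finite nonzero values (0) of the pivots at level k: the first zeros
  occur at level s and recur with period p.\<close>
definition tgt :: "nat \<Rightarrow> nat \<Rightarrow> nat \<Rightarrow> int" where
  "tgt s p k = (if k < s then 0 else if (k - s) mod p = 0 then 1 else if (k - s) mod p = 1 then -1 else 0)"

lemma tgt_less: "k < s \<Longrightarrow> tgt s p k = 0"
  by (simp add: tgt_def)

lemma tgt_start: "tgt s p s = 1"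
  by (simp add: tgt_def)

lemma tgt_Suc2: "j \<ge> s \<Longrightarrow> (tgt s 2 j = 1 \<and> tgt s 2 (Suc j) = -1) \<or> (tgt s 2 j = -1 \<and> tgt s 2 (Suc j) = 1)"
proof -
  assume "j \<ge> s"
  then obtain i where j: "j = s + i" using le_Suc_ex by blast
  have "i mod 2 = 0 \<or> i mod 2 = 1" by linarith
  then show ?thesis by (auto simp: tgt_def j Suc_diff_le mod_Suc)
qed

lemma tgt_Suc3: "j \<ge> s \<Longrightarrow> (tgt s 3 j = 1 \<and> tgt s 3 (Suc j) = -1) \<or> (j > s \<and> tgt s 3 j = -1 \<and> tgt s 3 (Suc j) = 0)
    \<or> (j > s \<and> tgt s 3 j = 0 \<and> tgt s 3 (Suc j) = 1)"
proof -
  assume "j \<ge> s"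
  then obtain i where j: "j = s + i" using le_Suc_ex by blast
  have "i mod 3 = 0 \<or> i mod 3 = 1 \<or> i mod 3 = 2" by linarith
  then show ?thesis by (cases "i = 0") (auto simp: tgt_def j Suc_diff_le mod_Suc)
qed

context lush_tree
begin

lemma V_eq_Union_ch: "k < H \<Longrightarrow> V k = (\<Union>v\<in>V (Suc k). ch v)"
proof
  assume "k < H"
  show "V k \<subseteq> (\<Union>v\<in>V (Suc k). ch v)"
  proof
    fix c assume "c \<in> V k"
    then have c: "c < n" "lev c = k" by (auto simp: V_def)
    with \<open>k < H\<close> have "c \<noteq> r" using lev_root by auto
    with c have "par c \<in> V (Suc k)" "c \<in> ch (par c)"
      using par_less lev_par by (auto simp: V_def ch_def)
    then show "c \<in> (\<Union>v\<in>V (Suc k). ch v)" by blast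
  qed
qed (auto simp: V_def dest: chD)

lemma sum_V_ch: "k < H \<Longrightarrow> (\<Sum>v\<in>V (Suc k). \<Sum>c\<in>ch v. f c) = (\<Sum>c\<in>V k. f c)"
proof -
  assume k: "k < H"
  have "(\<Sum>v\<in>V (Suc k). \<Sum>c\<in>ch v. f c) = (\<Sum>c\<in>(\<Union>v\<in>V (Suc k). ch v). f c)"
    by (rule sum.UNION_disjoint[symmetric]) (auto dest: chD)
  then show ?thesis using V_eq_Union_ch[OF k] by simp
qed

lemma V_top: "V H = {r}"
proof -
  have "v = r" if "v < n" "lev v = H" for v
    using lev_le[OF par_less[OF that(1)]] lev_par[OF that(1)] that by (cases "v = r") auto
  then have "V H \<subseteq> {r}" by (auto simp: V_def)
  moreover have "r \<in> V H" using root_less lev_root by (simp add: V_def)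
  ultimately show ?thesis by blast
qed

lemma root_induct [consumes 1, case_names root step]:
  assumes "v < n" "P r" "\<And>v c. \<lbrakk>v < n; c \<in> ch v; P v\<rbrakk> \<Longrightarrow> P c"
  shows "P v"
  using assms(1)
proof (induction "H - lev v" arbitrary: v rule: less_induct)
  case less
  show ?case
  proof (cases "v = r")
    case False
    then have v: "v \<in> ch (par v)" using less.prems by (simp add: ch_def)
    have "P (par v)"
      using less.hyps[of "par v"] chD[OF v] lev_le[of "par v"] by auto
    then show ?thesis using assms(3) v chD[OF v] by blast
  qed (use assms in simp)
qed

end

text \<open>An abstract form of the weights \<open>wt (F A l v)\<close> for fixed l, with
  \<open>total\<close> as the multiplicity bound. The source of \<open>st_zero\<close> is that a
  zero above poles only would make l a diagonal entry.\<close>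

locale pattern = lush_tree +
  fixes st :: "nat \<Rightarrow> int" and s p :: nat
  assumes st_range: "v < n \<Longrightarrow> st v \<in> {-1, 0, 1}"
    and st_pole: "v < n \<Longrightarrow> st v = -1 \<longleftrightarrow> (\<exists>c\<in>ch v. st c = 1)"
    and st_low: "\<lbrakk>v < n; lev v < s\<rbrakk> \<Longrightarrow> st v = 0"
    and period: "p = 2 \<or> p = 3 \<and> s \<ge> 1"
    and st_zero: "\<lbrakk>p = 3; v < n; lev v \<ge> 2; st v = 1\<rbrakk> \<Longrightarrow> \<exists>c\<in>ch v. st c = 0"
    and total: "(\<Sum>v<n. st v) \<ge> (\<Sum>v<n. tgt s p (lev v))"
begin

primrec gl :: "nat \<Rightarrow> nat \<Rightarrow> int" where
  "gl 0 v = tgt s p 0 - st v"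
| "gl (Suc k) v = tgt s p (Suc k) - st v + (\<Sum>c\<in>ch v. gl k c)"

text \<open>The number by which the zeros minus the poles below v fall short of the target.\<close>
definition gap :: "nat \<Rightarrow> int" where "gap v = gl (lev v) v"

lemma gap_eq: "gap v = tgt s p (lev v) - st v + (\<Sum>c\<in>ch v. gap c)"
proof (cases "lev v")
  case 0
  then show ?thesis by (simp add: gap_def ch_leaf)
next
  case (Suc k)
  have "gap c = gl k c" if "c \<in> ch v" for c using chD[OF that] Suc by (simp add: gap_def)
  then show ?thesis using Suc by (simp add: gap_def)
qed

lemma gap_root: "gap r = (\<Sum>v<n. tgt s p (lev v)) - (\<Sum>v<n. st v)"
proof -
  have "k \<le> H \<Longrightarrow> (\<Sum>v\<in>V k. gap v) = (\<Sum>v\<in>{v. v < n \<and> lev v \<le> k}. tgt s p (lev v) - st v)" for k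
  proof (induction k)
    case 0
    have "{v. v < n \<and> lev v \<le> 0} = V 0" by (auto simp: V_def)
    moreover have "gap v = tgt s p (lev v) - st v" if "v \<in> V 0" for v
      using that gap_eq[of v] by (simp add: ch_leaf V_def)
    ultimately show ?case by simp
  next
    case (Suc k)
    have "{v. v < n \<and> lev v \<le> Suc k} = V (Suc k) \<union> {v. v < n \<and> lev v \<le> k}" by (auto simp: V_def)
    moreover have "V (Suc k) \<inter> {v. v < n \<and> lev v \<le> k} = {}" by (auto simp: V_def)
    moreover have "(\<Sum>v\<in>V (Suc k). gap v) = (\<Sum>v\<in>V (Suc k). tgt s p (lev v) - st v) + (\<Sum>v\<in>V k. gap v)"
      using Suc.prems sum_V_ch[of k gap] by (subst gap_eq) (simp add: sum.distrib)
    ultimately show ?case using Suc by (simp add: sum.union_disjoint)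
  qed
  from this[of H] have "gap r = (\<Sum>v\<in>{v. v < n \<and> lev v \<le> H}. tgt s p (lev v) - st v)"
    by (simp add: V_top)
  moreover have "{v. v < n \<and> lev v \<le> H} = {..<n}" using lev_le by auto
  ultimately show ?thesis by (simp add: sum_subtractf)
qed

text \<open>The induction invariant: no gap is negative, and a deviation from the target costs at
  least 1. The one deviation that may be free is a zero at level 1 where a pole is due, as a vertex
  of level 1 may have only two children. The bound 2 for a missing pole on higher levels pays for an
  unwanted zero one level further up when the period is 3.\<close>

definition good :: "nat \<Rightarrow> bool" where
  "good v \<longleftrightarrow> gap v \<ge> 0 \<and> (tgt s p (lev v) \<noteq> -1 \<longrightarrow> st v \<noteq> tgt s p (lev v) \<longrightarrow> gap v \<ge> 1)
     \<and> (tgt s p (lev v) = -1 \<longrightarrow> st v = 0 \<longrightarrow> gap v \<ge> 1 \<and> (lev v \<ge> 2 \<longrightarrow> gap v \<ge> 2))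
     \<and> (tgt s p (lev v) = -1 \<longrightarrow> st v = 1 \<longrightarrow> lev v \<ge> 2 \<longrightarrow> gap v \<ge> 1)"

lemma good: "v < n \<Longrightarrow> good v"
proof (induction "lev v" arbitrary: v rule: less_induct)
  case less
  have IH: "good c" if "c \<in> ch v" for c using less.hyps[of c] chD[OF that] by auto
  have nn: "gap c \<ge> 0" if "c \<in> ch v" for c using IH[OF that] by (simp add: good_def)
  have S0: "(\<Sum>c\<in>ch v. gap c) \<ge> 0" using nn by (intro sum_nonneg) auto
  note range = st_range[OF less.prems] and pole = st_pole[OF less.prems] and ge = gap_eq[of v]
  consider (low) "lev v < s" | (start) "lev v = s" | (high) j where "lev v = Suc j" "j \<ge> s"
    by (metis less_imp_Suc_add linorder_cases le_add1)
  then show ?case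
  proof cases
    case low
    then show ?thesis using st_low[OF less.prems] S0 ge by (simp add: good_def tgt_less)
  next
    case start
    have "st v \<noteq> -1"
    proof
      assume "st v = -1"
      then obtain c where c: "c \<in> ch v" "st c = 1" using pole by auto
      then show False using st_low[of c] chD[OF c(1)] start by auto
    qed
    then show ?thesis using S0 ge range by (auto simp: good_def start tgt_start)
  next
    case high
    have cl: "lev c = j" if "c \<in> ch v" for c using chD[OF that] high by simp
    consider (P) "tgt s p j = 1" "tgt s p (lev v) = -1" | (Z) "tgt s p (lev v) = 1"
      | (N) "p = 3" "j \<ge> 2" "tgt s p j = -1" "tgt s p (lev v) = 0"
      using period tgt_Suc2[OF high(2)] tgt_Suc3[OF high(2)] high(1) by auto
    then show ?thesis
    proof cases
      \<comment> \<open>If v is no pole, then none of its children is a zero, so every child has gap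
        at least 1. This yields at least 2, or 3 from level 2 on, against a gain of at most 2 at
        v.\<close>
      case P
      have "(\<Sum>c\<in>ch v. gap c) \<ge> int (card (ch v))" if "st v \<noteq> -1"
      proof -
        have "gap c \<ge> 1" if "c \<in> ch v" for c
          using IH[OF that] cl[OF that] pole that \<open>st v \<noteq> -1\<close> P(1) by (auto simp: good_def)
        then have "(\<Sum>c\<in>ch v. gap c) \<ge> (\<Sum>c\<in>ch v. 1)" by (intro sum_mono) auto
        then show ?thesis by simp
      qed
      moreover have "card (ch v) \<ge> 2" "lev v \<ge> 2 \<longrightarrow> card (ch v) \<ge> 3"
        using card_ch_ge card_ch_ge3 less.prems high(1) by auto
      ultimately show ?thesis using P S0 ge range by (auto simp: good_def)
    next
      case Z
      then show ?thesis using S0 ge range by (auto simp: good_def)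
    next
      \<comment> \<open>Here j > s >= 1. A zero at v has a child that is neither zero nor pole
        although a pole is due there; its gap of at least 2 absorbs the gain at v.\<close>
      case N
      have two: "(\<Sum>c\<in>ch v. gap c) \<ge> 2" if one: "st v = 1"
      proof -
        obtain c where c: "c \<in> ch v" "st c = 0"
          using st_zero[OF N(1) less.prems] one high(1) N(2) by auto
        then have "gap c \<ge> 2" using IH[OF c(1)] cl[OF c(1)] N(2,3) by (simp add: good_def)
        moreover have "gap c \<le> (\<Sum>c\<in>ch v. gap c)" using nn c by (intro member_le_sum) auto
        ultimately show ?thesis by simp
      qed
      from range consider "st v = -1" | "st v = 0" | "st v = 1" by auto
      then show ?thesis by cases (use N(2-) S0 ge two in \<open>simp_all add: good_def\<close>)
    qed
  qed
qed

text \<open>By \<open>total\<close> the gap of the root is at most 0. Gaps are nonnegative and add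
  up over children, so all of them vanish, from the root downwards.\<close>

theorem pattern_forced:
  assumes "v < n"
  shows "st v = tgt s p (lev v)"
proof -
  have "gap v = 0 \<and> st v = tgt s p (lev v)" using assms
  proof (induction v rule: root_induct)
    case root
    have g: "good r" by (rule good[OF root_less])
    moreover have "gap r \<le> 0" using gap_root total by simp
    ultimately show ?case using st_range[OF root_less] lev_root H_ge by (auto simp: good_def)
  next
    case (step v c)
    have c: "c < n" "lev v = Suc (lev c)" using chD[OF step(2)] by auto
    have "(\<Sum>c\<in>ch v. gap c) = 0" using step(3) gap_eq[of v] by simp
    moreover have "gap c \<ge> 0" if "c \<in> ch v" for c using good[of c] chD[OF that] by (simp add: good_def)
    ultimately have g0: "gap c = 0" using sum_nonneg_eq_0_iff[of "ch v" gap] step(2) by auto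
    have "st c = tgt s p (lev c)"
    proof (rule ccontr)
      assume ne: "st c \<noteq> tgt s p (lev c)"
      then have t: "tgt s p (lev c) = -1" "st c = 1"
        using good[OF c(1)] g0 st_range[OF c(1)] by (auto simp: good_def)
      \<comment> \<open>The free deviation is excluded by the parent: it becomes a pole, but two
        consecutive levels never both have target -1.\<close>
      then have "st v = -1" using st_pole[OF step(1)] step(2) by auto
      then have "tgt s p (Suc (lev c)) = -1" using step(3) c by simp
      moreover have "lev c \<ge> s" using t(1) tgt_less[of "lev c" s p] by (cases "lev c < s") auto
      ultimately show False using t(1) period tgt_Suc2[of s "lev c"] tgt_Suc3[of s "lev c"] by auto
    qed
    then show ?case using g0 by simp
  qed
  then show ?thesis by simp
qed

end

section \<open>Matrices with data depending on the level only\<close>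

text \<open>The recursion of \<open>F\<close> when the vertices of a level share their data. All
  children of a vertex then have equal pivots, and only the sum \<open>C\<close> of the squared
  weights to them matters.\<close>

primrec Phi :: "(nat \<Rightarrow> real) \<Rightarrow> (nat \<Rightarrow> real) \<Rightarrow> real \<Rightarrow> nat \<Rightarrow> real option" where
  "Phi a C x 0 = Some (x - a 0)"
| "Phi a C x (Suc k) = (if Phi a C x k = Some 0 then None
     else Some (x - a (Suc k) - C (Suc k) * oinv (Phi a C x k)))"

lemma wt_eq_1: "wt z = 1 \<longleftrightarrow> z = Some 0"
  by (cases z) auto

lemma wt_eq_minus_1: "wt z = -1 \<longleftrightarrow> z = None"
  by (cases z) auto

lemma oinv_scale: "m \<noteq> 0 \<Longrightarrow> oinv (map_option ((*) m) z) = oinv z / m"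
  by (cases z) auto

lemma Phi_affine:
  assumes m: "m \<noteq> 0"
  shows "Phi (\<lambda>k. m * a k + d) (\<lambda>k. m^2 * C k) (m * x + d) k = map_option ((*) m) (Phi a C x k)"
proof (induction k)
  case 0
  show ?case by (simp add: algebra_simps)
next
  case (Suc k)
  have "(map_option ((*) m) z = Some 0) = (z = Some 0)" for z using m by (cases z) auto
  moreover have "m^2 * c * (z / m) = m * (c * z)" for c z using m by (simp add: power2_eq_square)
  ultimately show ?case using Suc m by (simp add: oinv_scale right_diff_distrib)
qed

lemma Phi_affine_zero:
  assumes "m \<noteq> 0"
  shows "Phi (\<lambda>k. m * a k + d) (\<lambda>k. m^2 * C k) (m * x + d) k = Some 0 \<longleftrightarrow> Phi a C x k = Some 0"
  unfolding Phi_affine[OF assms] using assms by (cases "Phi a C x k") auto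

context lush_tree
begin

section \<open>Level sizes and the numbers ell_i\<close>

definition el :: "nat \<Rightarrow> int" where
  "el k = int (card (V (k - 1))) - int (card (V k))"

lemma card_V_ge:
  assumes "k < H"
  shows "card (V k) \<ge> 2 * card (V (Suc k))" "k \<ge> 1 \<Longrightarrow> card (V k) \<ge> 3 * card (V (Suc k))"
proof -
  have eq: "card (V k) = (\<Sum>v\<in>V (Suc k). card (ch v))"
    using sum_V_ch[OF assms, of "\<lambda>_. 1::nat"] by simp
  have "(\<Sum>v\<in>V (Suc k). 2) \<le> (\<Sum>v\<in>V (Suc k). card (ch v))"
    by (rule sum_mono) (use card_ch_ge in \<open>auto simp: V_def\<close>)
  then show "card (V k) \<ge> 2 * card (V (Suc k))" using eq by simp
  assume "k \<ge> 1"
  then have "(\<Sum>v\<in>V (Suc k). 3) \<le> (\<Sum>v\<in>V (Suc k). card (ch v))"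
    by (intro sum_mono) (use card_ch_ge3 in \<open>auto simp: V_def\<close>)
  then show "card (V k) \<ge> 3 * card (V (Suc k))" using eq by simp
qed

lemma V_above: "k > H \<Longrightarrow> V k = {}"
  using lev_le by (fastforce simp: V_def)

lemma card_V_pos: "k \<le> H \<Longrightarrow> card (V k) > 0"
proof (induction "H - k" arbitrary: k)
  case 0
  then show ?case using V_top by (cases "k = H") auto
next
  case (Suc d)
  then have "card (V (Suc k)) > 0" "k < H" using Suc(1)[of "Suc k"] by auto
  then show ?case using card_V_ge(1)[of k] by simp
qed

lemma el_nonneg: "el (Suc k) \<ge> 0"
proof (cases "k < H")
  case True
  then show ?thesis using card_V_ge(1)[of k] by (simp add: el_def)
qed (use V_above[of "Suc k"] in \<open>simp add: el_def\<close>)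

text \<open>Three children per vertex give |V_k| >= 3 |V_{k+1}|. By \<open>sum_el_from\<close> the
  right side of this comparison dominates everything above: a zero level k is worth more than all
  higher levels together.\<close>

lemma card_V_less_el: "1 \<le> k \<Longrightarrow> k \<le> H \<Longrightarrow> int (card (V (Suc k))) < el (Suc k)"
  using card_V_ge(2)[of k] card_V_pos[of k] V_above[of "Suc k"]
  by (cases "k < H") (auto simp: el_def)

lemma sum_el_from:
  assumes "j \<le> Suc H"
  shows "(\<Sum>k\<in>{j..H}. el (Suc k)) = int (card (V j))"
  using assms
proof (induction "Suc H - j" arbitrary: j)
  case 0
  then have "j = Suc H" by simp
  then show ?case using V_above[of "Suc H"] by simp
next
  case (Suc d)
  then have "{j..H} = insert j {Suc j..H}" by auto
  moreover have "(\<Sum>k\<in>{Suc j..H}. el (Suc k)) = int (card (V (Suc j)))" using Suc by simp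
  ultimately show ?case by (simp add: el_def)
qed

lemma sum_lev:
  fixes f :: "nat \<Rightarrow> int"
  shows "(\<Sum>v<n. f (lev v)) = (\<Sum>k\<le>H. f k * int (card (V k)))"
proof -
  have "(\<Sum>v\<in>{..<n}. f (lev v)) = (\<Sum>k\<in>lev ` {..<n}. \<Sum>v | v \<in> {..<n} \<and> lev v = k. f (lev v))"
    by (rule sum.image_gen) simp
  also have "\<dots> = (\<Sum>k\<in>lev ` {..<n}. f k * int (card (V k)))"
    by (rule sum.cong) (auto simp: V_def)
  also have "\<dots> = (\<Sum>k\<le>H. f k * int (card (V k)))"
    by (rule sum.mono_neutral_left) (use lev_le in \<open>auto simp: V_def card_eq_0_iff\<close>)
  finally show ?thesis .
qed

text \<open>A level k of zeros has a level of poles directly above it, so the pair contributes |V_k|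
  - |V_{k+1}| = ell_{k+1}. The index shift arises because levels start at 0; above the root there is
  nothing to subtract.\<close>

lemma sum_poles:
  fixes z :: "nat \<Rightarrow> int"
  assumes "\<And>k. z k \<in> {-1, 0, 1}" "z 0 \<noteq> -1" "\<And>k. z (Suc k) = -1 \<longleftrightarrow> z k = 1"
  shows "(\<Sum>k\<le>H. z k * int (card (V k))) = (\<Sum>k\<le>H. if z k = 1 then el (Suc k) else 0)"
proof -
  have "(\<Sum>k\<le>m. z k * int (card (V k)))
      = (\<Sum>k\<le>m. if z k = 1 then el (Suc k) else 0) + (if z m = 1 then int (card (V (Suc m))) else 0)" for m
  proof (induction m)
    case 0
    have "z 0 \<in> {0, 1}" using assms(1)[of 0] assms(2) by auto
    then show ?case by (auto simp: el_def)
  next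
    case (Suc m)
    then show ?case using assms(1)[of "Suc m"] assms(3)[of m] by (auto simp: el_def)
  qed
  from this[of H] show ?thesis using V_above[of "Suc H"] by simp
qed

lemma sum_tgt:
  assumes "p = 2 \<or> p = 3"
  shows "(\<Sum>v<n. tgt s p (lev v)) = (\<Sum>k\<le>H. if tgt s p k = 1 then el (Suc k) else 0)"
  unfolding sum_lev[of "tgt s p"]
proof (rule sum_poles)
  show "tgt s p 0 \<noteq> -1" by (simp add: tgt_def)
  show "tgt s p (Suc k) = -1 \<longleftrightarrow> tgt s p k = 1" for k
  proof (cases "k \<ge> s")
    case True
    then show ?thesis using tgt_Suc2[OF True] tgt_Suc3[OF True] assms by auto
  next
    case False
    then show ?thesis by (simp add: tgt_def)
  qed
qed (simp add: tgt_def)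

definition uniform :: "real mat \<Rightarrow> (nat \<Rightarrow> real) \<Rightarrow> (nat \<Rightarrow> real) \<Rightarrow> nat \<Rightarrow> bool" where
  "uniform A a C m \<longleftrightarrow> (\<forall>v<n. lev v \<le> m \<longrightarrow> A $$ (v, v) = a (lev v)
     \<and> (lev v \<noteq> 0 \<longrightarrow> (\<Sum>c\<in>ch v. (A $$ (v, c))^2) = C (lev v)))"

lemma ch_nonempty: "v < n \<Longrightarrow> lev v \<noteq> 0 \<Longrightarrow> ch v \<noteq> {}"
  using card_ch_ge[of v] by auto

lemma F_uniform:
  assumes "uniform A a C m"
  shows "v < n \<Longrightarrow> lev v \<le> m \<Longrightarrow> F A x v = Phi a C x (lev v)"
proof (induction "lev v" arbitrary: v rule: less_induct)
  case less
  have u: "A $$ (v, v) = a (lev v)" "lev v \<noteq> 0 \<longrightarrow> (\<Sum>c\<in>ch v. (A $$ (v, c))^2) = C (lev v)"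
    using assms less.prems by (auto simp: uniform_def)
  show ?case
  proof (cases "lev v")
    case 0
    then show ?thesis using u F_eq[of A x v] ch_leaf[of v] by simp
  next
    case (Suc k)
    have "F A x c = Phi a C x k" if "c \<in> ch v" for c
      using less.hyps[of c] chD[OF that] less.prems Suc by auto
    then show ?thesis
      using F_eq[of A x v] u Suc ch_nonempty[OF less.prems(1)] by (auto simp: sum_distrib_right[symmetric])
  qed
qed

lemma mult_uniform:
  assumes A: "A \<in> S_T n E" and u: "uniform A a C H"
  shows "int (mult x A) = (\<Sum>k\<le>H. if Phi a C x k = Some 0 then el (Suc k) else 0)"
proof -
  have "int (mult x A) = (\<Sum>v<n. wt (Phi a C x (lev v)))"
    unfolding mult_eq_sum_wt[OF A] using F_uniform[OF u] lev_le by (intro sum.cong) auto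
  also have "\<dots> = (\<Sum>k\<le>H. if wt (Phi a C x k) = 1 then el (Suc k) else 0)"
    unfolding sum_lev[of "\<lambda>k. wt (Phi a C x k)"]
  proof (rule sum_poles)
    fix k
    show "wt (Phi a C x k) \<in> {-1, 0, 1}" by (cases "Phi a C x k") auto
    show "wt (Phi a C x (Suc k)) = -1 \<longleftrightarrow> wt (Phi a C x k) = 1"
      by (cases "Phi a C x k") auto
  qed simp
  finally show ?thesis by (simp add: wt_eq_1)
qed

lemma C_pos_uniform:
  assumes A: "A \<in> S_T n E" and u: "uniform A a C H" and k: "1 \<le> k" "k \<le> H"
  shows "C k > 0"
proof -
  obtain v where v: "v \<in> V k" using card_V_pos[OF k(2)] by (auto simp: card_gt_0_iff)
  then have v: "v < n" "lev v = k" by (auto simp: V_def)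
  have "(A $$ (v, c))^2 > 0" if "c \<in> ch v" for c
    using S_T_D(3)[OF A, of v c] chD[OF that] ch_neq[OF that] that by auto
  then have "(\<Sum>c\<in>ch v. (A $$ (v, c))^2) > 0"
    using ch_nonempty[OF v(1)] v k by (intro sum_pos) auto
  then show ?thesis using u v k by (auto simp: uniform_def)
qed

lemma ex_uniform:
  assumes C: "\<And>k. \<lbrakk>1 \<le> k; k \<le> H\<rbrakk> \<Longrightarrow> C k > 0"
  shows "\<exists>A\<in>S_T n E. uniform A a C H"
proof -
  define g where "g v = sqrt (C (lev v) / real (card (ch v)))" for v
  define A where "A = mat n n (\<lambda>(i, j). if i = j then a (lev i) else if j \<in> ch i then g i else if i \<in> ch j then g j else 0)"
  have g: "g v \<noteq> 0" "(g v)^2 * real (card (ch v)) = C (lev v)" if "v < n" "lev v \<noteq> 0" for v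
    using C[of "lev v"] card_ch_ge[OF that] lev_le[OF that(1)] that by (auto simp: g_def)
  have "A \<in> S_T n E"
    unfolding S_T_def
  proof (intro CollectI conjI allI impI)
    show "A \<in> carrier_mat n n" by (simp add: A_def)
    show "A\<^sup>T = A" by (rule eq_matI) (auto simp: A_def dest: ch_asym)
    fix i j assume ij: "i < n" "j < n" "i \<noteq> j"
    have "lev v \<noteq> 0" if "c \<in> ch v" for c v using chD[OF that] by simp
    then show "(A $$ (i, j) \<noteq> 0) = E i j"
      using ij g(1) by (auto simp: A_def E_iff_ch)
  qed
  moreover have "uniform A a C H"
    unfolding uniform_def
  proof (intro allI impI conjI)
    fix v assume v: "v < n"
    show "A $$ (v, v) = a (lev v)" using v by (simp add: A_def)
    assume "lev v \<noteq> 0"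
    have "(\<Sum>c\<in>ch v. (A $$ (v, c))^2) = (\<Sum>c\<in>ch v. (g v)^2)"
    proof (rule sum.cong)
      fix c assume c: "c \<in> ch v"
      show "(A $$ (v, c))^2 = (g v)^2" using chD[OF c] ch_neq[OF c] c by (simp add: A_def)
    qed simp
    then show "(\<Sum>c\<in>ch v. (A $$ (v, c))^2) = C (lev v)"
      using g(2)[OF v \<open>lev v \<noteq> 0\<close>] by (simp add: mult.commute)
  qed
  ultimately show ?thesis by blast
qed

text \<open>Nothing is assumed about higher levels. Every pole is charged to a zero among its
  children, except on level k + 1, where there are at most |V_{k+1}| poles; this leaves the zeros of
  level k unspent.\<close>

lemma mult_ge_level:
  assumes A: "A \<in> S_T n E" and Z: "\<And>v. v \<in> V k \<Longrightarrow> F A x v = Some 0"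
  shows "int (mult x A) \<ge> el (Suc k)"
proof -
  define z p where "z v = (if F A x v = Some 0 then 1 else 0 :: int)" and "p v = (if F A x v = None then 1 else 0 :: int)" for v
  have wt: "wt (F A x v) = z v - p v" for v by (cases "F A x v") (auto simp: z_def p_def)
  have z0: "z v \<ge> 0" and p1: "p v \<le> 1" for v by (auto simp: z_def p_def)
  have pz: "p v \<le> (\<Sum>c\<in>ch v. z c)" for v
  proof (cases "F A x v")
    case None
    then obtain c where c: "c \<in> ch v" "F A x c = Some 0" using F_eq[of A x v] by (auto split: if_splits)
    have "z c \<le> (\<Sum>c\<in>ch v. z c)" using c z0 by (intro member_le_sum) auto
    then show ?thesis using c p1[of v] by (simp add: z_def)
  qed (simp add: p_def sum_nonneg z0)
  define W where "W = V (Suc k)"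
  have Wn: "W \<subseteq> {..<n}" by (auto simp: W_def V_def)
  have "(\<Sum>v<n. p v) = (\<Sum>v\<in>{..<n} - W. p v) + (\<Sum>v\<in>W. p v)"
    by (rule sum.subset_diff[OF Wn]) simp
  also have "\<dots> \<le> (\<Sum>v\<in>{..<n} - W. \<Sum>c\<in>ch v. z c) + (\<Sum>v\<in>W. 1)"
    using pz p1 by (intro add_mono sum_mono) auto
  also have "(\<Sum>v\<in>{..<n} - W. \<Sum>c\<in>ch v. z c) = (\<Sum>c\<in>(\<Union>v\<in>{..<n} - W. ch v). z c)"
    by (rule sum.UNION_disjoint[symmetric]) (auto dest: chD)
  also have "\<dots> \<le> (\<Sum>c\<in>{..<n} - V k. z c)"
    using z0 by (intro sum_mono2) (auto simp: W_def V_def dest: chD)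
  also have "(\<Sum>c\<in>{..<n} - V k. z c) = (\<Sum>c<n. z c) - (\<Sum>c\<in>V k. z c)"
    by (subst sum.subset_diff[of "V k" "{..<n}"]) (auto simp: V_def)
  also have "(\<Sum>c\<in>V k. z c) = int (card (V k))" using Z by (simp add: z_def)
  finally have "(\<Sum>v<n. p v) \<le> (\<Sum>v<n. z v) - int (card (V k)) + int (card (V (Suc k)))"
    by (simp add: W_def)
  then show ?thesis unfolding mult_eq_sum_wt[OF A] wt sum_subtractf el_def by simp
qed

end

section \<open>Critical multiplicity lists\<close>

text \<open>The diagonal entries solved from the zero patterns of a1, a2 and b2. For k at least 1,
  \<open>bseq k\<close> below is the beta whose zero levels include k.\<close>

definition aseq :: "real \<Rightarrow> real \<Rightarrow> real \<Rightarrow> nat \<Rightarrow> real" where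
  "aseq a1 a2 b2 k = (if k = 1 then a2 + b2 - a1 else if even k then a1 else a2)"

definition bseq :: "real \<Rightarrow> real \<Rightarrow> real \<Rightarrow> nat \<Rightarrow> real" where
  "bseq b2 b3 b4 k = (if k mod 3 = 1 then b2 else if k mod 3 = 2 then b3 else b4)"

text \<open>The weight sums, each solved from a pivot vanishing on its level: at b2 on level 1, b3
  on level 2, b4 on level 3. From level 4 on the pivot two levels below is a pole at
  \<open>bseq k\<close>, so the pivot one level below is just \<open>bseq k\<close> minus its
  diagonal entry.\<close>

definition Cseq :: "real \<Rightarrow> real \<Rightarrow> real \<Rightarrow> real \<Rightarrow> real \<Rightarrow> nat \<Rightarrow> real" where
  "Cseq a1 a2 b2 b3 b4 k =
     (if k = 1 then - (a2 - a1) * (b2 - a1)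
      else if k = 2 then (b3 - a2) * (b3 - b2)
      else if k = 3 then (b4 - a1) * (b4 - b3) * (b4 - (a2 + b2 - b3)) / (b4 - b2)
      else (bseq b2 b3 b4 k - aseq a1 a2 b2 k) * (bseq b2 b3 b4 k - aseq a1 a2 b2 (k - 1)))"

lemma Phi_crit_1:
  assumes "l \<noteq> a1"
  shows "Phi (aseq a1 a2 b2) (Cseq a1 a2 b2 b3 b4) l 1 = Some ((l - a2) * (l - b2) / (l - a1))"
proof -
  have "l - (a2 + b2 - a1) - - (a2 - a1) * (b2 - a1) * (1 / (l - a1)) = (l - a2) * (l - b2) / (l - a1)"
    using assms by (simp add: divide_simps) (simp add: algebra_simps)
  then show ?thesis using assms by (simp add: aseq_def Cseq_def)
qed

text \<open>The factor l - (a2 + b2 - b3) is the important one: \<open>b4_ne\<close> keeps b4 away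
  from this zero, and lambda_{3,7} must lie there.\<close>

lemma Phi_crit_2:
  assumes "l \<noteq> a1" "l \<noteq> a2" "l \<noteq> b2"
  shows "Phi (aseq a1 a2 b2) (Cseq a1 a2 b2 b3 b4) l 2
    = Some ((l - a1) * ((l - b3) * (l - (a2 + b2 - b3))) / ((l - a2) * (l - b2)))"
proof -
  have "Phi (aseq a1 a2 b2) (Cseq a1 a2 b2 b3 b4) l (Suc 1)
      = Some (l - a1 - (b3 - a2) * (b3 - b2) * (1 / ((l - a2) * (l - b2) / (l - a1))))"
    unfolding Phi.simps(2) Phi_crit_1[OF assms(1)] using assms by (simp add: aseq_def Cseq_def)
  moreover have "l - a1 - (b3 - a2) * (b3 - b2) * (1 / ((l - a2) * (l - b2) / (l - a1)))
      = (l - a1) * ((l - b3) * (l - (a2 + b2 - b3))) / ((l - a2) * (l - b2))"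
    using assms by (simp add: divide_simps) (simp add: algebra_simps)
  ultimately show ?thesis by (simp add: numeral_2_eq_2)
qed

context lush_tree
begin

lemma forced:
  assumes A: "A \<in> S_T n E" and per: "p = 2 \<or> p = 3 \<and> s \<ge> 1"
    and low: "\<And>v. \<lbrakk>v < n; lev v < s\<rbrakk> \<Longrightarrow> wt (F A l v) = 0"
    and R: "\<And>v. \<lbrakk>p = 3; v < n; lev v \<ge> 2; F A l v = Some 0\<rbrakk> \<Longrightarrow> \<exists>c\<in>ch v. wt (F A l c) = 0"
    and tot: "(\<Sum>v<n. tgt s p (lev v)) \<le> int (mult l A)"
    and v: "v < n"
  shows "wt (F A l v) = tgt s p (lev v)"
proof -
  interpret pattern n r H E par lev "\<lambda>v. wt (F A l v)" s p
  proof
    fix v assume "v < n"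
    show "wt (F A l v) \<in> {-1, 0, 1}" by (cases "F A l v") auto
    show "(wt (F A l v) = -1) = (\<exists>c\<in>ch v. wt (F A l c) = 1)"
      unfolding wt_eq_1 wt_eq_minus_1 using F_eq[of A l v] by auto
  qed (use per low R tot mult_eq_sum_wt[OF A] wt_eq_1 in auto)
  show ?thesis by (rule pattern_forced[OF v])
qed

lemma diag_of_poles:
  assumes "F A l v = Some 0" "\<And>c. c \<in> ch v \<Longrightarrow> F A l c = None"
  shows "A $$ (v, v) = l"
  using F_eq[of A l v] assms by auto

lemma weight_of_finite:
  assumes "v < n" "lev v \<noteq> 0" "F A l v = Some 0" "y \<noteq> 0" "\<And>c. c \<in> ch v \<Longrightarrow> F A l c = Some y"
  shows "(\<Sum>c\<in>ch v. (A $$ (v, c))^2) = (l - A $$ (v, v)) * y"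
proof -
  have "0 = l - A $$ (v, v) - (\<Sum>c\<in>ch v. (A $$ (v, c))^2 * (1 / y))"
    using F_eq[of A l v] assms by (auto split: if_splits)
  then show ?thesis using assms(4) by (simp add: sum_divide_distrib[symmetric] field_simps)
qed

end

locale critical = lush_tree +
  fixes A :: "real mat" and a1 a2 b2 b3 b4 :: real
  assumes A: "A \<in> S_T n E"
    and dist: "distinct [a1, a2, b2, b3, b4]"
    and tota1: "(\<Sum>v<n. tgt 0 2 (lev v)) \<le> int (mult a1 A)"
    and tota2: "(\<Sum>v<n. tgt 1 2 (lev v)) \<le> int (mult a2 A)"
    and totb2: "(\<Sum>v<n. tgt 1 3 (lev v)) \<le> int (mult b2 A)"
    and totb3: "(\<Sum>v<n. tgt 2 3 (lev v)) \<le> int (mult b3 A)"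
    and totb4: "(\<Sum>v<n. tgt 3 3 (lev v)) \<le> int (mult b4 A)"
    and small: "int (mult b4 A) < el 3"
begin

abbreviation "a \<equiv> aseq a1 a2 b2"
abbreviation "C \<equiv> Cseq a1 a2 b2 b3 b4"

lemma ne: "a1 \<noteq> a2" "a1 \<noteq> b2" "a1 \<noteq> b3" "a1 \<noteq> b4" "a2 \<noteq> b2" "a2 \<noteq> b3" "a2 \<noteq> b4"
    "b2 \<noteq> b3" "b2 \<noteq> b4" "b3 \<noteq> b4" "a2 \<noteq> a1" "b2 \<noteq> a1" "b3 \<noteq> a1" "b4 \<noteq> a1" "b2 \<noteq> a2"
    "b3 \<noteq> a2" "b4 \<noteq> a2" "b3 \<noteq> b2" "b4 \<noteq> b2" "b4 \<noteq> b3"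
  using dist by auto

lemma wt_a1: "v < n \<Longrightarrow> wt (F A a1 v) = tgt 0 2 (lev v)"
  by (rule forced[OF A _ _ _ tota1]) auto

lemma diag_even:
  assumes "v < n" "even (lev v)"
  shows "A $$ (v, v) = a1"
proof (rule diag_of_poles)
  show "F A a1 v = Some 0" using wt_a1[OF assms(1)] assms(2) by (simp add: tgt_def wt_eq_1)
  fix c assume "c \<in> ch v"
  then have "c < n" "odd (lev c)" using assms chD by auto
  then show "F A a1 c = None"
    using wt_a1[of c] by (simp add: tgt_def wt_eq_minus_1 odd_iff_mod_2_eq_one)
qed

lemma F_leaf: "v < n \<Longrightarrow> lev v = 0 \<Longrightarrow> F A l v = Some (l - a1)"
  using F_eq[of A l v] diag_even[of v] ch_leaf[of v] by simp

lemma wt_a2: "v < n \<Longrightarrow> wt (F A a2 v) = tgt 1 2 (lev v)"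
  by (rule forced[OF A _ _ _ tota2]) (use F_leaf ne in auto)

lemma diag_odd:
  assumes "v < n" "odd (lev v)" "lev v \<noteq> 1"
  shows "A $$ (v, v) = a2"
proof (rule diag_of_poles)
  obtain k where k: "lev v = Suc (2 * Suc k)"
    using assms by (metis One_nat_def oddE Suc_eq_plus1 mult_0_right not0_implies_Suc)
  then show "F A a2 v = Some 0" using wt_a2[OF assms(1)] by (simp add: tgt_def wt_eq_1)
  fix c assume "c \<in> ch v"
  then have "c < n" "lev c = 2 * Suc k" using k chD by auto
  then show "F A a2 c = None"
    using wt_a2[of c] by (simp add: tgt_def wt_eq_minus_1)
qed

text \<open>If all children were poles, l would be the diagonal entry at v, which on levels >= 2 is
  a1 or a2.\<close>

lemma zero_has_finite_child:
  assumes "l \<noteq> a1" "l \<noteq> a2" "v < n" "lev v \<ge> 2" "F A l v = Some 0"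
  shows "\<exists>c\<in>ch v. wt (F A l c) = 0"
proof (rule ccontr)
  assume no: "\<not> ?thesis"
  have "F A l c = None" if "c \<in> ch v" for c
  proof -
    have "F A l c \<noteq> Some 0" using F_eq[of A l v] assms(5) that by (auto split: if_splits)
    moreover have "wt (F A l c) \<noteq> 0" using no that by blast
    ultimately show ?thesis by (cases "F A l c") auto
  qed
  then have "A $$ (v, v) = l" using diag_of_poles assms(5) by blast
  then show False using diag_even[OF assms(3)] diag_odd[OF assms(3)] assms by auto
qed

lemma forced3:
  assumes "l \<noteq> a1" "l \<noteq> a2" "s \<ge> 1" "(\<Sum>v<n. tgt s 3 (lev v)) \<le> int (mult l A)"
    and "\<And>v. \<lbrakk>v < n; lev v < s\<rbrakk> \<Longrightarrow> wt (F A l v) = 0" "v < n"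
  shows "wt (F A l v) = tgt s 3 (lev v)"
  by (rule forced[OF A _ _ _ assms(4)]) (use assms zero_has_finite_child in auto)

lemma wt_b2: "v < n \<Longrightarrow> wt (F A b2 v) = tgt 1 3 (lev v)"
  by (rule forced3[OF _ _ _ totb2]) (use F_leaf ne in auto)

text \<open>The level 1 pivots vanish at both a2 and b2, and all leaf pivots are x - a1. This gives
  two linear equations for the diagonal entry and the weight sum.\<close>

lemma uniform_1: "uniform A a C 1"
  unfolding uniform_def
proof (intro allI impI)
  fix v assume v: "v < n" "lev v \<le> 1"
  show "A $$ (v, v) = a (lev v) \<and> (lev v \<noteq> 0 \<longrightarrow> (\<Sum>c\<in>ch v. (A $$ (v, c))^2) = C (lev v))"
  proof (cases "lev v = 0")
    case True
    then show ?thesis using diag_even[of v] v by (simp add: aseq_def)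
  next
    case False
    then have l: "lev v = 1" using v by simp
    have "F A a2 v = Some 0" "F A b2 v = Some 0"
      using wt_a2[OF v(1)] wt_b2[OF v(1)] l by (simp_all add: tgt_def wt_eq_1)
    moreover have "F A x c = Some (x - a1)" if "c \<in> ch v" for c x using F_leaf[of c] chD[OF that] l by simp
    ultimately have e: "(\<Sum>c\<in>ch v. (A $$ (v, c))^2) = (a2 - A $$ (v, v)) * (a2 - a1)"
      "(\<Sum>c\<in>ch v. (A $$ (v, c))^2) = (b2 - A $$ (v, v)) * (b2 - a1)"
      using weight_of_finite[of v A a2] weight_of_finite[of v A b2] v False ne by auto
    then have "(a2 - A $$ (v, v)) * (a2 - a1) = (b2 - A $$ (v, v)) * (b2 - a1)" by simp
    then have "(a2 - b2) * (a2 + b2 - a1 - A $$ (v, v)) = 0" by (simp add: algebra_simps)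
    then have "A $$ (v, v) = a2 + b2 - a1" using ne by simp
    then have "a2 - A $$ (v, v) = a1 - b2" "A $$ (v, v) = a (lev v)" using l by (simp_all add: aseq_def)
    moreover from this(1) e(1) have "(\<Sum>c\<in>ch v. (A $$ (v, c))^2) = (a1 - b2) * (a2 - a1)" by simp
    ultimately show ?thesis using l by (simp add: Cseq_def algebra_simps)
  qed
qed

lemma uniform_Suc:
  assumes "uniform A a C k" "k \<ge> 1" "\<And>v. v < n \<Longrightarrow> lev v = Suc k \<Longrightarrow> (\<Sum>c\<in>ch v. (A $$ (v, c))^2) = C (Suc k)"
  shows "uniform A a C (Suc k)"
  unfolding uniform_def
proof (intro allI impI)
  fix v assume v: "v < n" "lev v \<le> Suc k"
  show "A $$ (v, v) = a (lev v) \<and> (lev v \<noteq> 0 \<longrightarrow> (\<Sum>c\<in>ch v. (A $$ (v, c))^2) = C (lev v))"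
  proof (cases "lev v = Suc k")
    case True
    then show ?thesis using assms diag_even[OF v(1)] diag_odd[OF v(1)] v(1) by (auto simp: aseq_def)
  next
    case False
    then show ?thesis using assms(1) v by (auto simp: uniform_def)
  qed
qed

text \<open>A bootstrap: the pattern starting at level s requires finite nonzero pivots below s. The
  closed forms provide them once the data up to level s - 1 are known, and the pattern in turn gives
  the weights of level s.\<close>

lemma wt_b3: "v < n \<Longrightarrow> wt (F A b3 v) = tgt 2 3 (lev v)"
proof (rule forced3[OF _ _ _ totb3])
  fix v assume v: "v < n" "lev v < 2"
  then consider "lev v = 0" | "lev v = 1" by linarith
  then show "wt (F A b3 v) = 0"
  proof cases
    case 1
    then show ?thesis using F_leaf[OF v(1)] ne by simp
  next
    case 2
    then show ?thesis using F_uniform[OF uniform_1 v(1), of b3] Phi_crit_1[of b3 a1 a2 b2 b3 b4] ne by auto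
  qed
qed (use ne in auto)

lemma uniform_2: "uniform A a C 2"
proof -
  have "uniform A a C (Suc 1)"
  proof (rule uniform_Suc[OF uniform_1])
    fix v assume v: "v < n" "lev v = Suc 1"
    let ?y = "(b3 - a2) * (b3 - b2) / (b3 - a1)"
    have "F A b3 c = Some ?y" if "c \<in> ch v" for c
      using F_uniform[OF uniform_1, of c b3] chD[OF that] v Phi_crit_1[of b3 a1 a2 b2 b3 b4] ne by auto
    moreover have "F A b3 v = Some 0" using wt_b3[OF v(1)] v by (simp add: tgt_def wt_eq_1)
    moreover have "?y \<noteq> 0" using ne by simp
    ultimately have "(\<Sum>c\<in>ch v. (A $$ (v, c))^2) = (b3 - A $$ (v, v)) * ?y"
      using weight_of_finite[of v A b3 ?y] v by simp
    then show "(\<Sum>c\<in>ch v. (A $$ (v, c))^2) = C (Suc 1)"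
      using diag_even[of v] v ne by (simp add: Cseq_def)
  qed simp
  then show ?thesis by (simp add: numeral_2_eq_2)
qed

text \<open>Otherwise all of level 2 would vanish at b4, and its multiplicity would reach ell_3.
  This is the purpose of the strict bound on mult(beta_4).\<close>

lemma b4_ne: "b4 \<noteq> a2 + b2 - b3"
proof
  assume "b4 = a2 + b2 - b3"
  then have "F A b4 v = Some 0" if "v \<in> V 2" for v
    using F_uniform[OF uniform_2, of v b4] that Phi_crit_2[of b4 a1 a2 b2 b3 b4] ne by (simp add: V_def)
  then have "int (mult b4 A) \<ge> el (Suc 2)" by (rule mult_ge_level[OF A])
  then show False using small by (simp add: eval_nat_numeral)
qed

lemma wt_b4: "v < n \<Longrightarrow> wt (F A b4 v) = tgt 3 3 (lev v)"
proof (rule forced3[OF _ _ _ totb4])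
  fix v assume v: "v < n" "lev v < 3"
  then consider "lev v = 0" | "lev v = 1" | "lev v = 2" by linarith
  then show "wt (F A b4 v) = 0"
  proof cases
    case 1
    then show ?thesis using F_leaf[OF v(1)] ne by simp
  next
    case 2
    then show ?thesis using F_uniform[OF uniform_1 v(1), of b4] Phi_crit_1[of b4 a1 a2 b2 b3 b4] ne by auto
  next
    case 3
    then show ?thesis
      using F_uniform[OF uniform_2 v(1), of b4] Phi_crit_2[of b4 a1 a2 b2 b3 b4] ne b4_ne by auto
  qed
qed (use ne in auto)

lemma uniform_3: "uniform A a C 3"
proof -
  have "uniform A a C (Suc 2)"
  proof (rule uniform_Suc[OF uniform_2])
    fix v assume v: "v < n" "lev v = Suc 2"
    let ?y = "(b4 - a1) * ((b4 - b3) * (b4 - (a2 + b2 - b3))) / ((b4 - a2) * (b4 - b2))"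
    have "F A b4 c = Some ?y" if "c \<in> ch v" for c
      using F_uniform[OF uniform_2, of c b4] chD[OF that] v Phi_crit_2[of b4 a1 a2 b2 b3 b4] ne by auto
    moreover have "F A b4 v = Some 0" using wt_b4[OF v(1)] v by (simp add: tgt_def wt_eq_1)
    moreover have "?y \<noteq> 0" using ne b4_ne by auto
    ultimately have "(\<Sum>c\<in>ch v. (A $$ (v, c))^2) = (b4 - A $$ (v, v)) * ?y"
      using weight_of_finite[of v A b4 ?y] v by simp
    also have "A $$ (v, v) = a2" using diag_odd[of v] v by simp
    finally show "(\<Sum>c\<in>ch v. (A $$ (v, c))^2) = C (Suc 2)"
      using ne by (simp add: Cseq_def eval_nat_numeral)
  qed simp
  then show ?thesis by (simp add: eval_nat_numeral)
qed

text \<open>Write k = s + 3 (m + 1) with s the first zero level of this beta. Then level k - 2 comes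
  one step and level k - 1 two steps after the zero level s + 3 m.\<close>

lemma wt_bseq:
  assumes "v < n" "lev v < k" "k \<le> lev v + 2" "k \<ge> 4"
  shows "wt (F A (bseq b2 b3 b4 k) v) = (if Suc (lev v) = k then 0 else -1)"
proof -
  define s where "s = (if k mod 3 = 1 then 1 else if k mod 3 = 2 then 2 else 3 :: nat)"
  have w: "wt (F A (bseq b2 b3 b4 k) v) = tgt s 3 (lev v)"
    using wt_b2[OF assms(1)] wt_b3[OF assms(1)] wt_b4[OF assms(1)] by (simp add: bseq_def s_def)
  have "(k - s) mod 3 = 0" "s < k" using assms(4) unfolding s_def by presburger+
  then obtain j where "k - s = 3 * j" by (metis mod_0_imp_dvd dvd_def)
  then have "k = s + 3 * Suc (j - 1)" using \<open>s < k\<close> by (cases j) auto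
  then obtain m where m: "k = s + 3 * Suc m" by blast
  have t: "(3 * m + 2) mod 3 = 2" "(3 * m + 1) mod 3 = 1" by presburger+
  have "lev v = s + (3 * m + 2) \<or> lev v = s + (3 * m + 1)" using m assms by arith
  then consider "lev v = s + (3 * m + 2)" | "lev v = s + (3 * m + 1)" by blast
  then show ?thesis
  proof cases
    case 1
    then show ?thesis unfolding w using m t(1) by (simp add: tgt_def)
  next
    case 2
    then show ?thesis unfolding w using m t(2) by (simp add: tgt_def)
  qed
qed

lemma wt_bseq_zero:
  assumes "v < n" "lev v = k" "k \<ge> 4"
  shows "F A (bseq b2 b3 b4 k) v = Some 0"
proof -
  define s where "s = (if k mod 3 = 1 then 1 else if k mod 3 = 2 then 2 else 3 :: nat)"
  have w: "wt (F A (bseq b2 b3 b4 k) v) = tgt s 3 (lev v)"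
    using wt_b2[OF assms(1)] wt_b3[OF assms(1)] wt_b4[OF assms(1)] by (simp add: bseq_def s_def)
  have "(k - s) mod 3 = 0" "\<not> k < s" using assms(3) unfolding s_def by presburger+
  then have "tgt s 3 (lev v) = 1" unfolding tgt_def assms(2) by simp
  then show ?thesis using w wt_eq_1 by simp
qed

theorem uniform_H: "uniform A a C H"
proof -
  have "uniform A a C (3 + k)" for k
  proof (induction k)
    case 0
    show ?case using uniform_3 by simp
  next
    case (Suc k)
    have "uniform A a C (Suc (3 + k))"
    proof (rule uniform_Suc[OF Suc])
      fix v assume v: "v < n" "lev v = Suc (3 + k)"
      let ?l = "bseq b2 b3 b4 (Suc (3 + k))"
      let ?y = "?l - a (3 + k)"
      have Fc: "F A ?l c = Some ?y \<and> ?y \<noteq> 0" if c: "c \<in> ch v" for c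
      proof -
        have c': "c < n" "lev c = 3 + k" using chD[OF c] v by auto
        have "F A ?l d = None" if "d \<in> ch c" for d
          using wt_bseq[of d "Suc (3 + k)"] chD[OF that] c' by (simp add: wt_eq_minus_1)
        then have "F A ?l c = Some (?l - A $$ (c, c))" using F_eq[of A ?l c] by simp
        moreover have "A $$ (c, c) = a (3 + k)" using Suc c' by (auto simp: uniform_def)
        moreover have "wt (F A ?l c) = 0" using wt_bseq[of c "Suc (3 + k)"] c' by simp
        ultimately show ?thesis by (auto split: if_splits)
      qed
      have Fv: "F A ?l v = Some 0" using wt_bseq_zero[OF v] by simp
      obtain c where c: "c \<in> ch v" using ch_nonempty[OF v(1)] v by auto
      have "(\<Sum>c\<in>ch v. (A $$ (v, c))^2) = (?l - A $$ (v, v)) * ?y"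
        using weight_of_finite[of v A ?l ?y] v Fv Fc c by auto
      also have "A $$ (v, v) = a (Suc (3 + k))"
        using diag_even[of v] diag_odd[of v] v by (auto simp: aseq_def)
      finally show "(\<Sum>c\<in>ch v. (A $$ (v, c))^2) = C (Suc (3 + k))"
        by (simp add: Cseq_def)
    qed simp
    then show ?case by simp
  qed
  from this[of "H - 3"] show ?thesis using H_ge by simp
qed

end

section \<open>The equations forced by three further eigenvalues\<close>

lemma monic_cubic_roots:
  fixes u v w c d e :: real
  assumes dist: "u \<noteq> v" "u \<noteq> w" "v \<noteq> w"
    and u: "u * u * u - c * (u * u) + d * u + e = 0"
    and v: "v * v * v - c * (v * v) + d * v + e = 0"
    and w: "w * w * w - c * (w * w) + d * w + e = 0"
  shows "u + v + w = c" and "x * x * x - c * (x * x) + d * x + e = (x - u) * (x - v) * (x - w)"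
proof -
  have "(u - v) * (u * u + u * v + v * v - c * (u + v) + d) = 0"
    using u v by (simp add: algebra_simps)
  then have uv: "u * u + u * v + v * v - c * (u + v) + d = 0" using dist by simp
  have "(u - w) * (u * u + u * w + w * w - c * (u + w) + d) = 0"
    using u w by (simp add: algebra_simps)
  then have uw: "u * u + u * w + w * w - c * (u + w) + d = 0" using dist by simp
  have "(v - w) * (u + v + w - c) = 0" using uv uw by (simp add: algebra_simps)
  then show s: "u + v + w = c" using dist by simp
  have d: "d = u * v + u * w + v * w" using uv unfolding s[symmetric] by (simp add: algebra_simps)
  have e: "e = - (u * v * w)" using u unfolding s[symmetric] d by (simp add: algebra_simps)
  show "x * x * x - c * (x * x) + d * x + e = (x - u) * (x - v) * (x - w)"
    unfolding s[symmetric] d e by (simp add: algebra_simps)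
qed

lemma seq_values:
  "aseq 0 1 b 2 = 0" "aseq 0 1 b 3 = 1" "aseq 0 1 b 4 = 0" "aseq 0 1 b 5 = 1" "aseq 0 1 b 6 = 0"
  "aseq 0 1 b 7 = 1" "aseq 0 1 b 8 = 0"
  "Cseq 0 1 b t u 1 = - b" "Cseq 0 1 b t u 2 = (t - 1) * (t - b)"
  "Cseq 0 1 b t u 3 = u * (u - t) * (u - (1 + b - t)) / (u - b)"
  "Cseq 0 1 b t u 4 = b * (b - 1)" "Cseq 0 1 b t u 5 = t * (t - 1)" "Cseq 0 1 b t u 6 = u * (u - 1)"
  "Cseq 0 1 b t u 7 = b * (b - 1)" "Cseq 0 1 b t u 8 = t * (t - 1)"
  by (simp_all add: aseq_def Cseq_def bseq_def)

locale normalized =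
  fixes b t u :: real
begin

definition "P x k = Phi (aseq 0 1 b) (Cseq 0 1 b t u) x k"
definition "c3 = u * (u - t) * (u - (1 + b - t)) / (u - b)"
text \<open>The level 3 pivot has numerator (x - 1) Q x, see \<open>P_3\<close>. This monic cubic
  has the root u, and its other two roots will be v and w.\<close>

definition "Q x = x * ((x - t) * (x - (1 + b - t))) - c3 * (x - b)"

lemma P_0: "P x 0 = Some x"
  by (simp add: P_def aseq_def)

lemma P_Suc: "P x (Suc k) = (if P x k = Some 0 then None
   else Some (x - aseq 0 1 b (Suc k) - Cseq 0 1 b t u (Suc k) * oinv (P x k)))"
  by (simp add: P_def)

lemma P_1: "x \<noteq> 0 \<Longrightarrow> P x 1 = Some ((x - 1) * (x - b) / x)"
  using Phi_crit_1[of x 0 1 b t u] by (simp add: P_def)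

lemma P_2: "\<lbrakk>x \<noteq> 0; x \<noteq> 1; x \<noteq> b\<rbrakk>
    \<Longrightarrow> P x 2 = Some (x * ((x - t) * (x - (1 + b - t))) / ((x - 1) * (x - b)))"
  using Phi_crit_2[of x 0 1 b t u] by (simp add: P_def)

lemma P_3:
  assumes "x \<noteq> 0" "x \<noteq> 1" "x \<noteq> b" "x \<noteq> t" "x \<noteq> 1 + b - t"
  shows "P x 3 = Some ((x - 1) * Q x / (x * ((x - t) * (x - (1 + b - t)))))"
proof -
  define z where "z = x * ((x - t) * (x - (1 + b - t)))"
  have z: "z \<noteq> 0" using assms by (simp add: z_def)
  have "P x (Suc 2) = Some (x - 1 - c3 * (1 / (z / ((x - 1) * (x - b)))))"
    unfolding P_Suc[of x 2] P_2[OF assms(1-3)] z_def[symmetric]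
    using assms z seq_values(2)[of b] seq_values(10)[of b t u] by (simp add: c3_def)
  moreover have "x - 1 - c3 * (1 / (z / ((x - 1) * (x - b)))) = (x - 1) * Q x / z"
    using z unfolding Q_def z_def[symmetric] by (simp add: divide_simps) (simp add: algebra_simps)
  ultimately show ?thesis unfolding z_def by simp
qed

lemma Q_expand: "Q x = x * x * x - (1 + b) * (x * x) + (t * (1 + b - t) - c3) * x + c3 * b"
  by (simp add: Q_def algebra_simps)

lemma Q_u: "u \<noteq> b \<Longrightarrow> Q u = 0"
  by (simp add: Q_def c3_def)

text \<open>A pole has reciprocal 0, so two levels above a zero the recursion restarts with x minus
  the diagonal entry. This keeps the conditions on levels 6, 7 and 8 low in degree.\<close>

lemma after_zero_2:
  assumes "P x 2 = Some 0" "x \<noteq> 0"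
  shows "P x 3 = None" "P x 4 = Some x" "P x 5 = Some (x - 1 - t * (t - 1) / x)"
    "x - 1 - t * (t - 1) / x \<noteq> 0 \<Longrightarrow> P x 6 = Some (x - u * (u - 1) / (x - 1 - t * (t - 1) / x))"
proof -
  show 3: "P x 3 = None" using P_Suc[of x 2] assms by simp
  show 4: "P x 4 = Some x" using P_Suc[of x 3] 3 seq_values(3)[of b] by simp
  show 5: "P x 5 = Some (x - 1 - t * (t - 1) / x)"
    using P_Suc[of x 4] 4 assms seq_values(4)[of b] seq_values(12)[of b t u] by simp
  assume "x - 1 - t * (t - 1) / x \<noteq> 0"
  then show "P x 6 = Some (x - u * (u - 1) / (x - 1 - t * (t - 1) / x))"
    using P_Suc[of x 5] 5 seq_values(5)[of b] seq_values(13)[of b t u] by simp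
qed

lemma after_zero_3:
  assumes "P x 3 = Some 0" "x \<noteq> 1"
  shows "P x 4 = None" "P x 5 = Some (x - 1)" "P x 6 = Some (x - u * (u - 1) / (x - 1))"
    "x - u * (u - 1) / (x - 1) \<noteq> 0 \<Longrightarrow> P x 7 = Some (x - 1 - b * (b - 1) / (x - u * (u - 1) / (x - 1)))"
    "\<lbrakk>x - u * (u - 1) / (x - 1) \<noteq> 0; x - 1 - b * (b - 1) / (x - u * (u - 1) / (x - 1)) \<noteq> 0\<rbrakk>
      \<Longrightarrow> P x 8 = Some (x - t * (t - 1) / (x - 1 - b * (b - 1) / (x - u * (u - 1) / (x - 1))))"
proof -
  show 4: "P x 4 = None" using P_Suc[of x 3] assms by simp
  show 5: "P x 5 = Some (x - 1)" using P_Suc[of x 4] 4 seq_values(4)[of b] by simp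
  show 6: "P x 6 = Some (x - u * (u - 1) / (x - 1))"
    using P_Suc[of x 5] 5 assms seq_values(5)[of b] seq_values(13)[of b t u] by simp
  assume n6: "x - u * (u - 1) / (x - 1) \<noteq> 0"
  then show 7: "P x 7 = Some (x - 1 - b * (b - 1) / (x - u * (u - 1) / (x - 1)))"
    using P_Suc[of x 6] 6 seq_values(6)[of b] seq_values(14)[of b t u] by simp
  assume "x - 1 - b * (b - 1) / (x - u * (u - 1) / (x - 1)) \<noteq> 0"
  then show "P x 8 = Some (x - t * (t - 1) / (x - 1 - b * (b - 1) / (x - u * (u - 1) / (x - 1))))"
    using P_Suc[of x 7] 7 seq_values(7)[of b] seq_values(15)[of b t u] by simp
qed

lemma zero_6_after_3:
  assumes "P x 3 = Some 0" "x \<noteq> 1"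
  shows "P x 6 = Some 0 \<longleftrightarrow> x * (x - 1) = u * (u - 1)"
  using after_zero_3(3)[OF assms] assms(2) by (auto simp: field_simps)

lemma zero_7_after_3:
  assumes "P x 3 = Some 0" "x \<noteq> 1" "x * (x - 1) \<noteq> u * (u - 1)"
  shows "P x 7 = Some 0 \<longleftrightarrow> x * (x - 1) = u * (u - 1) + b * (b - 1)"
proof -
  define y where "y = x - u * (u - 1) / (x - 1)"
  have y: "y * (x - 1) = x * (x - 1) - u * (u - 1)" using assms(2) by (simp add: y_def field_simps)
  then have y0: "y \<noteq> 0" using assms(3) by auto
  have "P x 7 = Some 0 \<longleftrightarrow> x - 1 = b * (b - 1) / y"
    using after_zero_3(4)[OF assms(1,2), folded y_def] y0 by simp
  also have "\<dots> \<longleftrightarrow> y * (x - 1) = b * (b - 1)" using y0 by (simp add: eq_divide_eq mult.commute)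
  finally show ?thesis unfolding y by auto
qed

lemma zero_8_after_3:
  assumes "P x 3 = Some 0" "x \<noteq> 1" "x * (x - 1) \<noteq> u * (u - 1)" "x * (x - 1) \<noteq> u * (u - 1) + b * (b - 1)"
  shows "P x 8 = Some 0 \<longleftrightarrow> x * (x - 1) * (x * (x - 1) - (u * (u - 1) + b * (b - 1)))
    = t * (t - 1) * (x * (x - 1) - u * (u - 1))"
proof -
  define y where "y = x - u * (u - 1) / (x - 1)"
  define z where "z = x - 1 - b * (b - 1) / y"
  have y: "y * (x - 1) = x * (x - 1) - u * (u - 1)" using assms(2) by (simp add: y_def field_simps)
  then have y0: "y \<noteq> 0" using assms(3) by auto
  have z: "z * y = x * (x - 1) - (u * (u - 1) + b * (b - 1))"
  proof -
    have "(c - d / y) * y = y * c - d" for c d using y0 by (simp add: left_diff_distrib)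
    then have "z * y = y * (x - 1) - b * (b - 1)" unfolding z_def .
    then show ?thesis using y by simp
  qed
  then have z0: "z \<noteq> 0" using assms(4) by auto
  have "P x 8 = Some 0 \<longleftrightarrow> x = t * (t - 1) / z"
    using after_zero_3(5)[OF assms(1,2), folded y_def, folded z_def] y0 z0 by simp
  also have "\<dots> \<longleftrightarrow> x * z = t * (t - 1)" using z0 by (simp add: eq_divide_eq)
  also have "\<dots> \<longleftrightarrow> x * z * (y * (x - 1)) = t * (t - 1) * (y * (x - 1))"
    using y0 assms(2) by simp
  also have "x * z * (y * (x - 1)) = x * (x - 1) * (z * y)" by simp
  finally show ?thesis unfolding y z .
qed

lemma zero_6_after_2:
  assumes "P x 2 = Some 0" "x \<noteq> 0" "x * (x - 1) \<noteq> t * (t - 1)"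
  shows "P x 6 = Some 0 \<longleftrightarrow> x * (x - 1) = t * (t - 1) + u * (u - 1)"
proof -
  define y where "y = x - 1 - t * (t - 1) / x"
  have y: "x * y = x * (x - 1) - t * (t - 1)" using assms(2) by (simp add: y_def field_simps)
  then have y0: "y \<noteq> 0" using assms(3) by auto
  have "P x 6 = Some 0 \<longleftrightarrow> x = u * (u - 1) / y"
    using after_zero_2(4)[OF assms(1,2), folded y_def] y0 by simp
  also have "\<dots> \<longleftrightarrow> x * y = u * (u - 1)" using y0 by (simp add: eq_divide_eq)
  finally show ?thesis unfolding y by auto
qed

text \<open>The signs leave two orders of the roots of Q besides the one in the definition of rigid.
  The one with w < b contradicts the equation for Q b once t is eliminated from it, and the one with
  u < 0 < w contradicts e3.\<close>
lemma rigid_of_signs: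
  fixes v w :: real
  assumes b: "b < 0" and t: "(t - 1) * (t - b) > 0" and U: "u * (u - 1) > 0" and T: "t * (t - 1) > 0" and c: "c3 > 0"
    and dist: "u \<noteq> v" "u \<noteq> w" "v \<noteq> w" "b \<noteq> u"
    and Qv: "Q v = 0" and Qw: "Q w = 0"
    and e1: "u * (u - 1) = b * (1 + b - 2 * t)"
    and e2: "v * (v - 1) = u * (u - 1) + b * (b - 1)"
    and e3: "w * (w - 1) * (w * (w - 1) - v * (v - 1)) = t * (t - 1) * (w * (w - 1) - u * (u - 1))"
  shows "rigid b t u v w"
proof -
  have Qu: "Q u = 0" using Q_u dist by auto
  note roots = monic_cubic_roots[OF dist(1-3) Qu[unfolded Q_expand] Qv[unfolded Q_expand] Qw[unfolded Q_expand]]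
  have sum: "u + v + w = 1 + b" by (rule roots(1))
  have Q: "Q x = (x - u) * (x - v) * (x - w)" for x using roots(2)[of x] Q_expand[of x] by simp
  have "b * (1 + b - 2 * t) > 0" using U e1 by simp
  then have "1 + b - 2 * t < 0" using b by (simp add: zero_less_mult_iff)
  \<comment> \<open>t exceeds the midpoint of b and 1, and (t - 1) (t - b) > 0 keeps it outside the
    interval between them.\<close>
  then have t1: "t > 1" using t b by (auto simp: zero_less_mult_iff)
  have e4: "(b - u) * (b - v) * (b - w) = b * (b - t) * (t - 1)"
    using Q[of b] by (simp add: Q_def)
  \<comment> \<open>The signs of Q at 0, t and b can be read off because one of the two terms of Q
    vanishes at each of these points.\<close>
  have "c3 * b < 0" using c b by (rule mult_pos_neg)
  then have Q0: "(- u) * (- v) * (- w) < 0" using Q[of 0] by (simp add: Q_def)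
  have "c3 * (t - b) > 0" using c t1 b by simp
  then have Qt: "(t - u) * (t - v) * (t - w) < 0" using Q[of t] by (simp add: Q_def)
  have "b * (b - t) * (t - 1) > 0" using b t1 by (simp add: mult_neg_neg)
  then have Qb: "(b - u) * (b - v) * (b - w) > 0" using e4 by simp
  have B: "b * (b - 1) > 0" using b by (simp add: mult_neg_neg)
  have bwuv: "b - w = u + v - 1" using sum by simp
  have "(v - u) * (b - w) = v * (v - 1) - u * (u - 1)" unfolding bwuv by (simp add: algebra_simps)
  then have vu: "(v - u) * (b - w) > 0" using e2 B by simp
  have bw: "b < w"
  proof (rule ccontr)
    assume "\<not> b < w"
    then have "w < b" using vu by (cases "w = b") auto
    then have v: "u < v" using vu by (simp add: zero_less_mult_iff)
    have "(b - u) * (b - v) > 0" using Qb \<open>w < b\<close> by (simp add: zero_less_mult_iff)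
    have "u * v < 0"
      using Q0 \<open>w < b\<close> b by (simp add: mult_less_0_iff zero_less_mult_iff)
    then have uv: "u < 0" "0 < v" using v by (auto simp: mult_less_0_iff)
    then have ub: "b < u" using \<open>(b - u) * (b - v) > 0\<close> b by (auto simp: zero_less_mult_iff)
    have "w = 1 + b - u - v" using sum by simp
    then have "4 * b * (b - v) * (b - w) = (b + u - 1) * (v * (v - 1))"
      using eliminate_t(1)[OF _ _ _ e1 e2, of w] e4 dist b by auto
    moreover have "4 * b * (b - v) * (b - w) > 0"
      using b uv \<open>w < b\<close> by (intro mult_pos_pos mult_neg_neg) (auto simp: mult_neg_neg)
    moreover have "v * (v - 1) > 0" using e2 U B by simp
    then have "(b + u - 1) * (v * (v - 1)) < 0" using b uv by (intro mult_neg_pos) auto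
    ultimately show False by simp
  qed
  then have v: "v < u" using vu by (simp add: zero_less_mult_iff)
  have "(b - u) * (b - v) < 0" using Qb bw by (simp add: zero_less_mult_iff mult_less_0_iff)
  then have vb: "v < b" "b < u" using v by (auto simp: mult_less_0_iff)
  have "u * w < 0"
  proof -
    have "(u * w) * v > 0" using Q0 by (simp add: mult_ac)
    then show ?thesis using vb b by (simp add: zero_less_mult_iff)
  qed
  moreover have "(t - u) * (t - w) < 0"
  proof -
    have "((t - u) * (t - w)) * (t - v) < 0" using Qt by (simp add: mult_ac)
    moreover have "t - v > 0" using vb b t1 by simp
    ultimately show ?thesis by (simp add: mult_less_0_iff)
  qed
  moreover have "\<not> (u < 0 \<and> w > t)"
  proof
    assume uw: "u < 0 \<and> w > t"
    have W: "w * (w - 1) > 0" using uw t1 by simp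
    have w: "w = 1 + b - u - v" using sum by simp
    have "w * (w - 1) - v * (v - 1) = (b - u) * (w - v)" "w * (w - 1) - u * (u - 1) = (b - v) * (w - u)"
      unfolding w by (simp_all add: algebra_simps)
    then have "w * (w - 1) * ((b - u) * (w - v)) = t * (t - 1) * ((b - v) * (w - u))" using e3 by simp
    moreover have "w * (w - 1) * ((b - u) * (w - v)) < 0"
      using W uw vb b t1 by (intro mult_pos_neg mult_neg_pos) auto
    moreover have "t * (t - 1) * ((b - v) * (w - u)) > 0"
      using T uw vb t1 by (intro mult_pos_pos) auto
    ultimately show False by simp
  qed
  ultimately have "u > 1" "w < 0" using t1 by (auto simp: mult_less_0_iff)
  then show ?thesis unfolding rigid_def using b t1 vb bw sum e1 e2 e3 e4 by blast
qed

text \<open>The zeros of the pivots on levels 0, 1 and 2 are explicit, so distinctness moves the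
  first zero of s to level 2 and those of v and w to level 3. The second zeros must lie on levels 6,
  7 and 8: any other level in the range carries a pole or would make two of the eight reals
  coincide.\<close>

theorem rigid_of_zeros:
  assumes C: "\<And>k. \<lbrakk>1 \<le> k; k \<le> 8\<rbrakk> \<Longrightarrow> Cseq 0 1 b t u k > 0"
    and dist: "distinct [0, 1, b, t, u, s, v, w]"
    and s: "\<exists>k\<le>2. P s k = Some 0" "\<exists>k\<in>{3..6}. P s k = Some 0"
    and v: "\<exists>k\<le>3. P v k = Some 0" "\<exists>k\<in>{4..7}. P v k = Some 0"
    and w: "\<exists>k\<le>3. P w k = Some 0" "\<exists>k\<in>{4..8}. P w k = Some 0"
  shows "rigid b t u v w"
proof -
  have ne: "(0::real) \<noteq> 1" "b \<noteq> 0" "t \<noteq> 0" "u \<noteq> 0" "s \<noteq> 0" "v \<noteq> 0" "w \<noteq> 0"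
    "b \<noteq> 1" "t \<noteq> 1" "u \<noteq> 1" "s \<noteq> 1" "v \<noteq> 1" "w \<noteq> 1" "t \<noteq> b" "u \<noteq> b" "s \<noteq> b" "v \<noteq> b" "w \<noteq> b"
    "u \<noteq> t" "s \<noteq> t" "v \<noteq> t" "w \<noteq> t" "s \<noteq> u" "v \<noteq> u" "w \<noteq> u" "v \<noteq> s" "w \<noteq> s" "w \<noteq> v"
    using dist by auto
  have pos: "b < 0" "(t - 1) * (t - b) > 0" "c3 > 0" "t * (t - 1) > 0" "u * (u - 1) > 0" "b * (b - 1) > 0"
    using C[of 1, unfolded seq_values] C[of 2, unfolded seq_values] C[of 3, unfolded seq_values]
      C[of 4, unfolded seq_values] C[of 5, unfolded seq_values] C[of 6, unfolded seq_values]
    by (simp_all add: c3_def)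
  have low: "P x 0 \<noteq> Some 0" "P x 1 \<noteq> Some 0" if "x \<noteq> 0" "x \<noteq> 1" "x \<noteq> b" for x
    using P_0[of x] P_1[OF that(1)] that by auto
  have cases2: "k = 0 \<or> k = 1 \<or> k = 2" if "k \<le> 2" for k :: nat using that by linarith
  have cases3: "k = 0 \<or> k = 1 \<or> k = 2 \<or> k = 3" if "k \<le> 3" for k :: nat using that by linarith
  have zs: "P s 2 = Some 0" using s(1) low[of s] ne cases2 by metis
  then have ss: "s = 1 + b - t" using P_2[of s] ne by auto
  have two: "x = s" if "P x 2 = Some 0" "x \<noteq> 0" "x \<noteq> 1" "x \<noteq> b" "x \<noteq> t" for x
    using P_2[OF that(2-4)] that ss by auto
  have zv: "P v 3 = Some 0" using v(1) low[of v] two[of v] ne cases3 by metis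
  have zw: "P w 3 = Some 0" using w(1) low[of w] two[of w] ne cases3 by metis
  have Qv: "Q v = 0" using P_3[of v] zv ne ss by auto
  have Qw: "Q w = 0" using P_3[of w] zw ne ss by auto
  have Qu: "Q u = 0" using Q_u ne by auto
  note roots = monic_cubic_roots[OF _ _ _ Qu[unfolded Q_expand] Qv[unfolded Q_expand] Qw[unfolded Q_expand]]
  have sum: "u + v + w = 1 + b" by (rule roots(1)) (use ne in auto)
  have Qx: "Q x = (x - u) * (x - v) * (x - w)" for x
    unfolding Q_expand by (rule roots(2)) (use ne in auto)
  have e1: "u * (u - 1) = b * (1 + b - 2 * t)"
  proof -
    have st: "s * (s - 1) - t * (t - 1) = b * (1 + b - 2 * t)" unfolding ss by (simp add: algebra_simps)
    have "s - t = 1 + b - 2 * t" using ss by simp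
    then have "b * (1 + b - 2 * t) \<noteq> 0" using ne(2,20) by auto
    then have nt: "s * (s - 1) \<noteq> t * (t - 1)" using st by auto
    then have "s - 1 - t * (t - 1) / s \<noteq> 0" using ne by (simp add: field_simps)
    then have "P s 5 \<noteq> Some 0" using after_zero_2(3)[OF zs] ne by simp
    moreover have "P s 3 \<noteq> Some 0" "P s 4 \<noteq> Some 0" using after_zero_2(1,2)[OF zs] ne by simp_all
    moreover have "k = 3 \<or> k = 4 \<or> k = 5 \<or> k = 6" if "k \<in> {3..6}" for k :: nat using that by auto
    ultimately have "P s 6 = Some 0" using s(2) by metis
    then show ?thesis using zero_6_after_2[OF zs ne(5) nt] st by simp
  qed
  have n6: "x * (x - 1) \<noteq> u * (u - 1)" if "x = v \<or> x = w" for x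
  proof
    assume "x * (x - 1) = u * (u - 1)"
    \<comment> \<open>If x + u = 1, the root sum 1 + b makes the third root equal to b, but Q b is
      nonzero.\<close>
    then have "(x - u) * (x + u - 1) = 0" by (simp add: algebra_simps)
    then have xu: "x + u = 1" using that ne by auto
    have "Q b = 0" using that xu sum Qx[of b] by auto
    then show False using ne ss by (auto simp: Q_def)
  qed
  have n45: "P x 4 \<noteq> Some 0" "P x 5 \<noteq> Some 0" if "P x 3 = Some 0" "x \<noteq> 1" for x
    using after_zero_3(1,2)[OF that] that by simp_all
  have zv7: "P v 7 = Some 0"
  proof -
    have "k = 4 \<or> k = 5 \<or> k = 6 \<or> k = 7" if "k \<in> {4..7}" for k :: nat using that by auto
    moreover have "P v 6 \<noteq> Some 0" using zero_6_after_3[OF zv] n6[of v] ne by blast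
    ultimately show ?thesis using v(2) n45[OF zv] ne by metis
  qed
  then have e2: "v * (v - 1) = u * (u - 1) + b * (b - 1)"
    using zero_7_after_3[OF zv] n6[of v] ne by blast
  have w7: "w * (w - 1) \<noteq> u * (u - 1) + b * (b - 1)"
  proof
    assume "w * (w - 1) = u * (u - 1) + b * (b - 1)"
    then have "(w - v) * (w + v - 1) = 0" using e2 by (simp add: algebra_simps)
    then have "w + v = 1" using ne by auto
    then have "u = b" using sum by linarith
    then show False using ne by simp
  qed
  have "P w 8 = Some 0"
  proof -
    have "k = 4 \<or> k = 5 \<or> k = 6 \<or> k = 7 \<or> k = 8" if "k \<in> {4..8}" for k :: nat using that by auto
    moreover have "P w 6 \<noteq> Some 0" using zero_6_after_3[OF zw] n6[of w] ne by blast
    moreover have "P w 7 \<noteq> Some 0" using zero_7_after_3[OF zw] n6[of w] w7 ne by blast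
    ultimately show ?thesis using w(2) n45[OF zw] ne by metis
  qed
  then have e3: "w * (w - 1) * (w * (w - 1) - v * (v - 1)) = t * (t - 1) * (w * (w - 1) - u * (u - 1))"
    using zero_8_after_3[OF zw] n6[of w] w7 ne e2 by auto
  show ?thesis
    by (rule rigid_of_signs[OF pos(1,2,5,4,3) _ _ _ _ Qv Qw e1 e2 e3]) (use ne in auto)
qed

end

section \<open>Zeros of the pivots at a rigid solution\<close>

locale rigid_solution = normalized +
  fixes v w :: real
  assumes rigid: "rigid b t u v w"
begin

definition "s = 1 + b - t"

lemma signs: "b < 0" "t > 1" "u > 1" "v < b" "b < w" "w < 0" "s < b"
  and sum: "u + v + w = 1 + b"
  and e1: "u * (u - 1) = b * (1 + b - 2 * t)"
  and e2: "v * (v - 1) = u * (u - 1) + b * (b - 1)"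
  and e3: "w * (w - 1) * (w * (w - 1) - v * (v - 1)) = t * (t - 1) * (w * (w - 1) - u * (u - 1))"
  and e4: "(b - u) * (b - v) * (b - w) = b * (b - t) * (t - 1)"
  using rigid by (auto simp: rigid_def s_def)

text \<open>Both cubics are monic with root sum 1 + b, as t + s = 1 + b, so the difference has no
  quadratic term.\<close>

lemma Q_linear: "x * ((x - t) * (x - s)) - (x - u) * (x - v) * (x - w) = (t * s - (u * v + u * w + v * w)) * x + u * v * w"
proof -
  have "x * ((x - t) * (x - s)) - (x - u) * (x - v) * (x - w)
      = (u + v + w - (t + s)) * (x * x) + (t * s - (u * v + u * w + v * w)) * x + u * v * w"
    by (simp add: algebra_simps)
  moreover have "u + v + w - (t + s) = 0" using sum by (simp add: s_def)
  ultimately show ?thesis by simp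
qed

text \<open>The linear difference vanishes at b by \<open>e4\<close>, and its value at u then
  determines its slope, which is \<open>c3\<close> by the definition of \<open>c3\<close>.\<close>

lemma c3: "c3 = t * s - (u * v + u * w + v * w)" "c3 * b = - (u * v * w)"
proof -
  define \<alpha> where "\<alpha> = t * s - (u * v + u * w + v * w)"
  have "b * ((b - t) * (b - s)) - (b - u) * (b - v) * (b - w) = 0" using e4 by (simp add: s_def)
  then have ab: "\<alpha> * b = - (u * v * w)" using Q_linear[of b] by (simp add: \<alpha>_def)
  have "c3 * (u - b) = u * ((u - t) * (u - s))" using signs by (simp add: c3_def s_def)
  also have "\<dots> = \<alpha> * u + u * v * w" using Q_linear[of u] by (simp add: \<alpha>_def)
  also have "\<dots> = \<alpha> * (u - b)" using ab by (simp add: algebra_simps)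
  finally have "c3 = \<alpha>" using signs by simp
  then show "c3 = t * s - (u * v + u * w + v * w)" "c3 * b = - (u * v * w)" using ab by (simp_all add: \<alpha>_def)
qed

lemma c3_pos: "c3 > 0"
proof -
  have "u * v * w > 0" using signs by (intro mult_neg_neg mult_pos_neg) auto
  then have "c3 * b < 0" using c3(2) by simp
  then show ?thesis using signs by (simp add: mult_less_0_iff)
qed

lemma Q: "Q x = (x - u) * (x - v) * (x - w)"
proof -
  have "x * ((x - t) * (x - s)) - (x - u) * (x - v) * (x - w) = c3 * x - c3 * b"
    using Q_linear[of x] c3 by simp
  then show ?thesis by (simp add: Q_def s_def right_diff_distrib)
qed

text \<open>The signs separate all other pairs among the eight witnesses; the coincidences t = u and
  s = v remain to be excluded.\<close>

lemma not_root: "u \<noteq> t" "v \<noteq> s"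
proof -
  have "Q t = c3 * (b - t)" "Q s = c3 * (b - s)" by (simp_all add: Q_def s_def algebra_simps)
  moreover have "c3 * (b - t) \<noteq> 0" "c3 * (b - s) \<noteq> 0" using c3_pos signs by auto
  ultimately show "u \<noteq> t" "v \<noteq> s" using Q[of t] Q[of s] by auto
qed

lemma distinct_witnesses: "distinct [0, 1, b, t, u, s, v, w]"
  using signs not_root by auto

lemma aseq_alt: "k \<ge> 2 \<Longrightarrow> aseq 0 1 b k = (if even k then 0 else 1)"
  by (simp add: aseq_def)

lemma C_ge_4: "k \<ge> 4 \<Longrightarrow> Cseq 0 1 b t u k = bseq b t u k * (bseq b t u k - 1)"
proof -
  assume k: "k \<ge> 4"
  then have "even (k - 1) \<longleftrightarrow> odd k" by simp
  then show ?thesis using k by (simp add: Cseq_def aseq_alt)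
qed

lemma C_pos: "k \<ge> 1 \<Longrightarrow> Cseq 0 1 b t u k > 0"
proof -
  assume "k \<ge> 1"
  then consider "k = 1" | "k = 2" | "k = 3" | "k \<ge> 4" by linarith
  then show ?thesis
  proof cases
    case 1
    show ?thesis unfolding 1 seq_values(8) using signs by simp
  next
    case 2
    then show ?thesis unfolding 2 seq_values(9) using signs by simp
  next
    case 3
    then show ?thesis unfolding 3 seq_values(10) using c3_pos by (simp add: c3_def)
  next
    case 4
    have "x * (x - 1) > 0" if "x < 0 \<or> x > 1" for x :: real
      using that by (auto intro: mult_pos_pos mult_neg_neg)
    then show ?thesis unfolding C_ge_4[OF 4] using signs by (simp add: bseq_def)
  qed
qed

lemma zeros_0: "P 0 (2 * m) = Some 0"
proof (induction m)
  case (Suc m)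
  have "P 0 (Suc (2 * m)) = None" using P_Suc[of 0 "2 * m"] Suc by simp
  then show ?case using P_Suc[of 0 "Suc (2 * m)"] by (simp add: aseq_alt)
qed (simp add: P_0)

lemma zeros_1: "P 1 (Suc (2 * m)) = Some 0"
proof (induction m)
  case 0
  show ?case using P_1[of 1] by simp
next
  case (Suc m)
  have "P 1 (Suc (Suc (2 * m))) = None" using P_Suc[of 1 "Suc (2 * m)"] Suc by simp
  then show ?case using P_Suc[of 1 "Suc (Suc (2 * m))"] by (simp add: aseq_alt)
qed

text \<open>A zero is followed by a pole, then by x - c, then by x - c' - x (x - 1) / (x - c). Here
  c and c' are 0 and 1 in some order, and either order gives 0.\<close>

lemma zeros_step:
  assumes z: "P x k = Some 0" and k: "k \<ge> 1" and x: "x \<noteq> 0" "x \<noteq> 1" and b: "bseq b t u (k + 3) = x"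
  shows "P x (k + 3) = Some 0"
proof -
  have 1: "P x (Suc k) = None" using P_Suc[of x k] z by simp
  have 2: "P x (Suc (Suc k)) = Some (x - aseq 0 1 b (Suc (Suc k)))"
    using P_Suc[of x "Suc k"] 1 by simp
  define \<alpha> where "\<alpha> = aseq 0 1 b (Suc (Suc k))"
  have \<alpha>: "x - \<alpha> \<noteq> 0" "\<alpha> = 0 \<and> aseq 0 1 b (k + 3) = 1 \<or> \<alpha> = 1 \<and> aseq 0 1 b (k + 3) = 0"
    using x by (auto simp: aseq_alt \<alpha>_def)
  have "P x (Suc (Suc (Suc k))) = Some (x - aseq 0 1 b (k + 3) - x * (x - 1) * (1 / (x - \<alpha>)))"
    using P_Suc[of x "Suc (Suc k)"] 2[folded \<alpha>_def] \<alpha>(1) C_ge_4[of "k + 3"] k b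
    by (simp add: eval_nat_numeral)
  also have "x - aseq 0 1 b (k + 3) - x * (x - 1) * (1 / (x - \<alpha>)) = 0"
    using \<alpha> by auto
  finally show ?thesis by (simp add: eval_nat_numeral)
qed

lemma zeros_b: "P b (1 + 3 * m) = Some 0"
proof (induction m)
  case 0
  show ?case using P_1[of b] signs by simp
next
  case (Suc m)
  have "(1 + 3 * m + 3) mod 3 = 1" by presburger
  then have "P b (1 + 3 * m + 3) = Some 0"
    using Suc signs by (intro zeros_step) (auto simp: bseq_def)
  then show ?case by (simp add: algebra_simps)
qed

lemma zeros_t: "P t (2 + 3 * m) = Some 0"
proof (induction m)
  case 0
  show ?case using P_2[of t] signs by simp
next
  case (Suc m)
  have "(2 + 3 * m + 3) mod 3 = 2" by presburger
  then have "P t (2 + 3 * m + 3) = Some 0"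
    using Suc signs by (intro zeros_step) (auto simp: bseq_def)
  then show ?case by (simp add: algebra_simps)
qed

lemma zero_3: "Q x = 0 \<Longrightarrow> x \<in> {u, v, w} \<Longrightarrow> P x 3 = Some 0"
  using P_3[of x] distinct_witnesses by (auto simp: s_def)

lemma zeros_u: "P u (3 + 3 * m) = Some 0"
proof (induction m)
  case 0
  show ?case using zero_3[of u] Q[of u] by simp
next
  case (Suc m)
  have "(3 + 3 * m + 3) mod 3 = 0" by presburger
  then have "P u (3 + 3 * m + 3) = Some 0"
    using Suc signs by (intro zeros_step) (auto simp: bseq_def)
  then show ?case by (simp add: algebra_simps)
qed

lemma nonzero_u: "k < 3 \<Longrightarrow> P u k \<noteq> Some 0"
proof -
  assume "k < 3"
  then have "k = 0 \<or> k = 1 \<or> k = 2" by linarith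
  then show ?thesis
    using P_0[of u] P_1[of u] P_2[of u] signs not_root by (auto simp: s_def)
qed

lemma zeros_s: "P s 2 = Some 0" "P s 6 = Some 0"
proof -
  show z: "P s 2 = Some 0" using P_2[of s] signs by (simp add: s_def)
  have eq: "s * (s - 1) - t * (t - 1) = u * (u - 1)" using e1 by (simp add: s_def algebra_simps)
  have "u * (u - 1) > 0" using signs by simp
  then have "s * (s - 1) \<noteq> t * (t - 1)" using eq by auto
  then show "P s 6 = Some 0" using zero_6_after_2[OF z] eq signs by auto
qed

lemma n6: "v * (v - 1) \<noteq> u * (u - 1)" "w * (w - 1) \<noteq> u * (u - 1)" "w * (w - 1) \<noteq> u * (u - 1) + b * (b - 1)"
proof -
  have B: "b * (b - 1) > 0" using signs by (simp add: mult_neg_neg)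
  show "v * (v - 1) \<noteq> u * (u - 1)" using e2 B by linarith
  have "w * (w - 1) - u * (u - 1) = (w - u) * (w + u - 1)" by (simp add: algebra_simps)
  moreover have "w + u - 1 = b - v" using sum by simp
  ultimately show "w * (w - 1) \<noteq> u * (u - 1)" using signs by auto
  have "w * (w - 1) - v * (v - 1) = (w - v) * (w + v - 1)" by (simp add: algebra_simps)
  moreover have "w + v - 1 = b - u" using sum by simp
  ultimately show "w * (w - 1) \<noteq> u * (u - 1) + b * (b - 1)" using e2 signs by auto
qed

lemma zeros_v: "P v 3 = Some 0" "P v 7 = Some 0"
proof -
  show z: "P v 3 = Some 0" using zero_3[of v] Q[of v] by simp
  show "P v 7 = Some 0" using zero_7_after_3[OF z] n6(1) e2 signs by auto
qed

lemma zeros_w: "P w 3 = Some 0" "P w 8 = Some 0"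
proof -
  show z: "P w 3 = Some 0" using zero_3[of w] Q[of w] by simp
  show "P w 8 = Some 0" using zero_8_after_3[OF z _ n6(2,3)] e3 e2 signs by auto
qed

end

section \<open>Rigidity\<close>

lemma aseq_affine: "aseq d (m + d) (m * b + d) = (\<lambda>k. m * aseq 0 1 b k + d)"
  by (auto simp: aseq_def algebra_simps)

lemma Cseq_affine:
  assumes "m \<noteq> 0"
  shows "Cseq d (m + d) (m * b + d) (m * t + d) (m * u + d) = (\<lambda>k. m^2 * Cseq 0 1 b t u k)"
proof
  fix k
  have b: "bseq (m * b + d) (m * t + d) (m * u + d) k = m * bseq b t u k + d" by (simp add: bseq_def)
  have "(m * u + d - d) * (m * u + d - (m * t + d)) * (m * u + d - (m + d + (m * b + d) - (m * t + d))) / (m * u + d - (m * b + d))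
      = (m * u * (m * (u - t)) * (m * (u - (1 + b - t)))) / (m * (u - b))"
    by (simp add: algebra_simps)
  also have "\<dots> = m^2 * (u * (u - t) * (u - (1 + b - t)) / (u - b))"
    using assms by (simp add: power2_eq_square mult_ac)
  finally have 3: "(m * u + d - d) * (m * u + d - (m * t + d)) * (m * u + d - (m + d + (m * b + d) - (m * t + d)))
      / (m * u + d - (m * b + d)) = m^2 * (u * (u - t) * (u - (1 + b - t)) / (u - b))" .
  show "Cseq d (m + d) (m * b + d) (m * t + d) (m * u + d) k = m^2 * Cseq 0 1 b t u k"
    unfolding Cseq_def b aseq_affine 3
    by (simp add: power2_eq_square algebra_simps)
qed

lemma count_image_mset_inj: "inj f \<Longrightarrow> count (image_mset f M) (f x) = count M x"
  by (induction M) (auto simp: inj_eq)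

lemma mult_list_image:
  assumes f: "strict_mono f" and M: "spec_mset B = image_mset f (spec_mset A)"
  shows "mult_list B = mult_list A"
proof -
  have inj: "inj f" using f by (rule strict_mono_imp_inj_on)
  have c: "mult (f x) B = mult x A" for x
    unfolding mult_def M by (rule count_image_mset_inj[OF inj])
  let ?S = "set_mset (spec_mset A)"
  have "sorted_list_of_set (f ` ?S) = map f (sorted_list_of_set ?S)"
  proof (rule sorted_distinct_set_unique)
    show "sorted (map f (sorted_list_of_set ?S))"
      using sorted_sorted_list_of_set[of ?S] strict_mono_less_eq[OF f]
      by (simp add: sorted_map sorted_wrt_iff_nth_less)
    show "distinct (map f (sorted_list_of_set ?S))"
      using inj_on_subset[OF inj subset_UNIV] by (simp add: distinct_map)
  qed simp_all
  then show ?thesis by (simp add: mult_list_def M c)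
qed

text \<open>Eigenvalues are matched by their position in the sorted spectra.\<close>

lemma mult_list_eq_strict_mono:
  assumes eq: "mult_list B = mult_list A" and X: "X \<subseteq> set_mset (spec_mset A)"
  shows "\<exists>\<psi>. (\<forall>x\<in>X. mult (\<psi> x) B = mult x A) \<and> (\<forall>x\<in>X. \<forall>y\<in>X. x < y \<longrightarrow> \<psi> x < \<psi> y)"
proof -
  define xs ys where "xs = sorted_list_of_set (set_mset (spec_mset A))"
    and "ys = sorted_list_of_set (set_mset (spec_mset B))"
  have m: "map (\<lambda>x. mult x B) ys = map (\<lambda>x. mult x A) xs"
    using eq by (simp add: mult_list_def xs_def ys_def)
  then have len: "length ys = length xs" by (metis length_map)
  have sx: "sorted xs" "distinct xs" and sy: "sorted ys" "distinct ys" by (auto simp: xs_def ys_def)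
  have "X \<subseteq> set xs" using X by (simp add: xs_def)
  then have "\<forall>x\<in>X. \<exists>i<length xs. xs ! i = x" unfolding in_set_conv_nth[symmetric] by blast
  then obtain g where g: "\<And>x. x \<in> X \<Longrightarrow> g x < length xs \<and> xs ! g x = x" by metis
  have "mult (ys ! g x) B = mult x A" if "x \<in> X" for x
    using arg_cong[OF m, of "\<lambda>l. l ! g x"] g[OF that] len by simp
  moreover have "ys ! g x < ys ! g y" if "x \<in> X" "y \<in> X" "x < y" for x y
  proof -
    have "g x < g y"
    proof (rule ccontr)
      assume "\<not> g x < g y"
      then have "xs ! g y \<le> xs ! g x" using g that by (intro sorted_nth_mono[OF sx(1)]) auto
      then show False using g that by simp
    qed
    then have "ys ! g x \<le> ys ! g y" "ys ! g x \<noteq> ys ! g y"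
      using g that len sorted_nth_mono[OF sy(1), of "g x" "g y"] nth_eq_iff_index_eq[OF sy(2)] by auto
    then show ?thesis by simp
  qed
  ultimately show ?thesis by (intro exI[of _ "\<lambda>x. ys ! g x"]) blast
qed

context lush_tree
begin

lemma H_less: "H < n"
proof -
  have "{..H} \<subseteq> lev ` {..<n}"
  proof
    fix k assume "k \<in> {..H}"
    then have "V k \<noteq> {}" using card_V_pos[of k] by auto
    then show "k \<in> lev ` {..<n}" by (auto simp: V_def)
  qed
  then have "card {..H} \<le> card (lev ` {..<n})" by (intro card_mono) auto
  also have "\<dots> \<le> n" using card_image_le[of "{..<n}" lev] by simp
  finally show ?thesis by simp
qed

text \<open>ell_i belongs to level i - 1, so residue classes of indices become the zero levels of
  \<open>tgt\<close>. The cut-off at n + 1 loses nothing because H < n.\<close>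

lemma sum_el_residue:
  assumes "p = 2 \<or> p = 3"
  shows "(\<Sum>i\<in>{i. Suc s \<le> i \<and> i \<le> n + 1 \<and> i mod p = Suc s mod p}. el i) = (\<Sum>v<n. tgt s p (lev v))"
proof -
  have t: "tgt s p k = 1 \<longleftrightarrow> s \<le> k \<and> Suc k mod p = Suc s mod p" for k
  proof (cases "s \<le> k")
    case True
    have "Suc k mod p = Suc s mod p \<longleftrightarrow> p dvd Suc k - Suc s" using True by (intro mod_eq_dvd_iff_nat) simp
    then show ?thesis using True by (auto simp: tgt_def dvd_eq_mod_eq_0)
  qed (simp add: tgt_def)
  have "(\<Sum>v<n. tgt s p (lev v)) = (\<Sum>k\<le>H. if tgt s p k = 1 then el (Suc k) else 0)"
    by (rule sum_tgt[OF assms])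
  also have "\<dots> = (\<Sum>k\<le>n. if tgt s p k = 1 then el (Suc k) else 0)"
    using H_less V_above by (intro sum.mono_neutral_left) (auto simp: el_def)
  also have "\<dots> = (\<Sum>k\<in>{k. k \<le> n \<and> tgt s p k = 1}. el (Suc k))"
    by (simp add: sum.If_cases Collect_conj_eq atMost_def)
  also have "\<dots> = (\<Sum>i\<in>Suc ` {k. k \<le> n \<and> tgt s p k = 1}. el i)"
    by (simp add: sum.reindex)
  also have "Suc ` {k. k \<le> n \<and> tgt s p k = 1} = {i. Suc s \<le> i \<and> i \<le> n + 1 \<and> i mod p = Suc s mod p}"
  proof (intro equalityI subsetI)
    fix i assume "i \<in> {i. Suc s \<le> i \<and> i \<le> n + 1 \<and> i mod p = Suc s mod p}"
    then show "i \<in> Suc ` {k. k \<le> n \<and> tgt s p k = 1}" unfolding t by (cases i) auto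
  qed (auto simp: t)
  finally show ?thesis by simp
qed

lemma el_pos: "k \<le> H \<Longrightarrow> el (Suc k) > 0"
  using card_V_less_el[of k] card_V_ge(1)[of 0] card_V_pos[of 1] H_ge
  by (cases "k = 0") (auto simp: el_def)

lemma sum_zero_levels_le:
  assumes "\<And>k. k < m \<Longrightarrow> \<not> z k" "m \<le> Suc H"
  shows "(\<Sum>k\<le>H. if z k then el (Suc k) else 0) \<le> int (card (V m))"
proof -
  have "(\<Sum>k\<le>H. if z k then el (Suc k) else 0) = (\<Sum>k\<in>{m..H}. if z k then el (Suc k) else 0)"
    by (rule sum.mono_neutral_right) (use assms(1) in auto)
  also have "\<dots> \<le> (\<Sum>k\<in>{m..H}. el (Suc k))" using el_nonneg by (intro sum_mono) auto
  finally show ?thesis using sum_el_from[OF assms(2)] by simp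
qed

text \<open>Without a zero level up to i the sum is at most |V_{i+1}| < ell_{i+1}. If the levels
  below i carry no zeros and neither do the levels i + 1 to j, it is at most ell_{i+1} + |V_{j+1}| <
  ell_{i+1} + ell_{j+1}.\<close>

lemma zero_levels:
  assumes X: "el (Suc i) + el (Suc j) \<le> (\<Sum>k\<le>H. if z k then el (Suc k) else 0)"
    and ij: "1 \<le> i" "i < j" "j \<le> H"
  shows "\<exists>k\<le>i. z k" and "\<forall>k<i. \<not> z k \<Longrightarrow> \<exists>k\<in>{Suc i..j}. z k"
proof -
  show "\<exists>k\<le>i. z k"
  proof (rule ccontr)
    assume "\<not> ?thesis"
    then have "(\<Sum>k\<le>H. if z k then el (Suc k) else 0) \<le> int (card (V (Suc i)))"
      using ij by (intro sum_zero_levels_le) auto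
    then show False using X card_V_less_el[of i] el_nonneg[of j] ij by simp
  qed
  assume low: "\<forall>k<i. \<not> z k"
  show "\<exists>k\<in>{Suc i..j}. z k"
  proof (rule ccontr)
    assume no: "\<not> ?thesis"
    have "(\<Sum>k\<le>H. if z k then el (Suc k) else 0)
        \<le> (\<Sum>k\<le>H. (if k = i then el (Suc k) else 0) + (if z k \<and> k \<noteq> i then el (Suc k) else 0))"
      using el_nonneg by (intro sum_mono) auto
    also have "\<dots> = el (Suc i) + (\<Sum>k\<le>H. if z k \<and> k \<noteq> i then el (Suc k) else 0)"
      using ij by (simp add: sum.distrib)
    also have "(\<Sum>k\<le>H. if z k \<and> k \<noteq> i then el (Suc k) else 0) \<le> int (card (V (Suc j)))"
    proof (rule sum_zero_levels_le)
      fix k assume "k < Suc j"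
      then have "k < i \<or> k = i \<or> k \<in> {Suc i..j}" by auto
      then show "\<not> (z k \<and> k \<noteq> i)" using no low by auto
    qed (use ij in simp)
    finally show False using X card_V_less_el[of j] ij by simp
  qed
qed

definition witnesses :: "real mat \<Rightarrow> real \<Rightarrow> real \<Rightarrow> real \<Rightarrow> real \<Rightarrow> real \<Rightarrow> real \<Rightarrow> real \<Rightarrow> real \<Rightarrow> bool" where
  "witnesses B a1 a2 b2 b3 b4 l37 l48 l49 \<longleftrightarrow>
     distinct [a1, a2, b2, b3, b4, l37, l48, l49]
     \<and> (\<Sum>v<n. tgt 0 2 (lev v)) \<le> int (mult a1 B)
     \<and> (\<Sum>v<n. tgt 1 2 (lev v)) \<le> int (mult a2 B)
     \<and> (\<Sum>v<n. tgt 1 3 (lev v)) \<le> int (mult b2 B)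
     \<and> (\<Sum>v<n. tgt 2 3 (lev v)) \<le> int (mult b3 B)
     \<and> (\<Sum>v<n. tgt 3 3 (lev v)) \<le> int (mult b4 B)
     \<and> int (mult b4 B) < el 3
     \<and> el 3 + el 7 \<le> int (mult l37 B) \<and> el 4 + el 8 \<le> int (mult l48 B) \<and> el 4 + el 9 \<le> int (mult l49 B)"

definition witnessed :: "real mat \<Rightarrow> bool" where
  "witnessed B \<longleftrightarrow> (\<exists>a1 a2 b2 b3 b4 l37 l48 l49. witnesses B a1 a2 b2 b3 b4 l37 l48 l49)"

text \<open>B has the level data of the normalised parameters transported by x -> m x + d. The
  factor m may be negative, which reverses the spectrum.\<close>

definition model :: "real mat \<Rightarrow> real \<Rightarrow> real \<Rightarrow> real \<Rightarrow> real \<Rightarrow> real \<Rightarrow> bool" where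
  "model B m d b t u \<longleftrightarrow> B \<in> S_T n E \<and> m \<noteq> 0
     \<and> uniform B (\<lambda>k. m * aseq 0 1 b k + d) (\<lambda>k. m^2 * Cseq 0 1 b t u k) H"

lemma mult_model:
  assumes "model B m d b t u"
  shows "int (mult (m * x + d) B) = (\<Sum>k\<le>H. if normalized.P b t u x k = Some 0 then el (Suc k) else 0)"
  using assms unfolding model_def normalized.P_def
  by (subst mult_uniform) (auto simp: Phi_affine_zero)

text \<open>The multiplicity at m x + d depends on b, t, u and x only, so composing one
  normalisation with the inverse of the other matches the spectra.\<close>

lemma model_spec:
  assumes A: "model A m d b t u" and B: "model B m' d' b t u"
  shows "spec_mset B = image_mset (\<lambda>x. m' / m * x + (d' - m' / m * d)) (spec_mset A)" (is "_ = image_mset ?f _")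
proof (rule multiset_eqI)
  fix y
  have m: "m \<noteq> 0" "m' \<noteq> 0" using A B by (auto simp: model_def)
  define x where "x = (y - d') / m'"
  have y: "y = m' * x + d'" using m by (simp add: x_def)
  have f: "?f (m * x + d) = y" using m unfolding y by (simp add: field_simps)
  have "inj ?f" using m by (intro injI) auto
  then have "count (image_mset ?f (spec_mset A)) y = mult (m * x + d) A"
    using count_image_mset_inj[of ?f "spec_mset A" "m * x + d"] unfolding f mult_def by simp
  also have "\<dots> = mult y B" using mult_model[OF A, of x] mult_model[OF B, of x] unfolding y by simp
  finally show "count (spec_mset B) y = count (image_mset ?f (spec_mset A)) y" by (simp add: mult_def)
qed

lemma model_uminus:
  assumes B: "model B m d b t u"
  shows "model (- B) (- m) (- d) b t u"
proof -
  have BS: "B \<in> S_T n E" using B by (simp add: model_def)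
  note BD = S_T_D[OF BS]
  have "- B \<in> S_T n E"
    unfolding S_T_def
  proof (intro CollectI conjI allI impI)
    show "- B \<in> carrier_mat n n" using BD(1) by simp
    show "(- B)\<^sup>T = - B" by (rule eq_matI) (use BD in auto)
    show "((- B) $$ (i, j) \<noteq> 0) = E i j" if "i < n" "j < n" "i \<noteq> j" for i j
      using BD(1) BD(3)[OF that] that by (simp add: E_iff_ch)
  qed
  moreover have "uniform (- B) (\<lambda>k. - m * aseq 0 1 b k + - d) (\<lambda>k. (- m)^2 * Cseq 0 1 b t u k) H"
    unfolding uniform_def
  proof (intro allI impI conjI)
    fix v assume v: "v < n" "lev v \<le> H"
    then show "(- B) $$ (v, v) = - m * aseq 0 1 b (lev v) + - d"
      using B BD(1) by (auto simp: model_def uniform_def)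
    assume "lev v \<noteq> 0"
    have "(\<Sum>c\<in>ch v. ((- B) $$ (v, c))^2) = (\<Sum>c\<in>ch v. (B $$ (v, c))^2)"
      by (rule sum.cong) (use v BD(1) chD in auto)
    then show "(\<Sum>c\<in>ch v. ((- B) $$ (v, c))^2) = (- m)^2 * Cseq 0 1 b t u (lev v)"
      using v \<open>lev v \<noteq> 0\<close> B by (auto simp: model_def uniform_def)
  qed
  ultimately show ?thesis using B by (simp add: model_def)
qed

theorem witnesses_rigid:
  assumes B: "B \<in> S_T n E" and W: "witnesses B a1 a2 b2 b3 b4 l37 l48 l49"
  shows "\<exists>b t u v w. rigid b t u v w \<and> model B (a2 - a1) a1 b t u"
proof -
  interpret critical n r H E par lev B a1 a2 b2 b3 b4
    by unfold_locales (use B W in \<open>auto simp: witnesses_def\<close>)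
  define m where "m = a2 - a1"
  have m: "m \<noteq> 0" using ne by (simp add: m_def)
  define N where "N x = (x - a1) / m" for x
  have N: "m * N x + a1 = x" for x using m by (simp add: N_def)
  define b t u s v w where "b = N b2" and "t = N b3" and "u = N b4" and "s = N l37" and "v = N l48" and "w = N l49"
  have \<beta>: "m * b + a1 = b2" "m * t + a1 = b3" "m * u + a1 = b4" "m + a1 = a2"
    by (simp_all add: b_def t_def u_def N) (simp add: m_def)
  have mod: "model B m a1 b t u"
    unfolding model_def aseq_affine[symmetric] Cseq_affine[OF m, of a1 b t u, symmetric] \<beta>
    using uniform_H B m by simp
  interpret N: normalized b t u .
  have "rigid b t u v w"
  proof (rule N.rigid_of_zeros)
    show "Cseq 0 1 b t u k > 0" if "1 \<le> k" "k \<le> 8" for k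
    proof -
      have "m^2 * Cseq 0 1 b t u k > 0"
        using C_pos_uniform[OF B, of _ "\<lambda>k. m^2 * Cseq 0 1 b t u k" k] mod that H_ge by (auto simp: model_def)
      then show ?thesis using m by (simp add: zero_less_mult_iff)
    qed
    have eqs: "map N [a1, a2, b2, b3, b4, l37, l48, l49] = [0, 1, b, t, u, s, v, w]"
      using m by (simp add: b_def t_def u_def s_def v_def w_def N_def m_def)
    have "inj N" using N by (metis injI)
    then have "distinct (map N [a1, a2, b2, b3, b4, l37, l48, l49])"
      using W unfolding distinct_map witnesses_def by (blast intro: inj_on_subset)
    then show dist: "distinct [0, 1, b, t, u, s, v, w]" unfolding eqs .
    have low: "N.P x 0 \<noteq> Some 0" "N.P x (Suc 0) \<noteq> Some 0" if "x \<noteq> 0" "x \<noteq> 1" "x \<noteq> b" for x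
      using N.P_0[of x] N.P_1[of x] that by auto
    have s: "el (Suc 2) + el (Suc 6) \<le> (\<Sum>k\<le>H. if N.P s k = Some 0 then el (Suc k) else 0)"
      and v: "el (Suc 3) + el (Suc 7) \<le> (\<Sum>k\<le>H. if N.P v k = Some 0 then el (Suc k) else 0)"
      and w: "el (Suc 3) + el (Suc 8) \<le> (\<Sum>k\<le>H. if N.P w k = Some 0 then el (Suc k) else 0)"
      unfolding mult_model[OF mod, symmetric] using W by (simp_all add: s_def v_def w_def N witnesses_def)
    have lt: "k < 2 \<Longrightarrow> k = 0 \<or> k = Suc 0" "k < 3 \<Longrightarrow> k = 0 \<or> k = Suc 0 \<or> k = 2" for k :: nat by auto
    show s2: "\<exists>k\<le>2. N.P s k = Some 0" using zero_levels(1)[OF s] H_ge by auto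
    have "\<forall>k<2. N.P s k \<noteq> Some 0" using low[of s] dist lt(1) by auto
    then show "\<exists>k\<in>{3..6}. N.P s k = Some 0" using zero_levels(2)[OF s] H_ge by auto
    have "N.P s 2 = Some 0" using s2 \<open>\<forall>k<2. N.P s k \<noteq> Some 0\<close> by (metis le_neq_implies_less)
    then have ss: "s = 1 + b - t" using N.P_2[of s] dist by auto
    have "\<forall>k<3. N.P x k \<noteq> Some 0" if "x \<in> {v, w}" for x
    proof -
      have ne: "x \<noteq> 0" "x \<noteq> 1" "x \<noteq> b" "x \<noteq> t" "x \<noteq> s" using that dist by auto
      then have "N.P x 2 \<noteq> Some 0" using N.P_2[of x] ss by auto
      then show ?thesis using low[OF ne(1-3)] lt(2) by blast
    qed
    then have low3: "\<forall>k<3. N.P v k \<noteq> Some 0" "\<forall>k<3. N.P w k \<noteq> Some 0" by blast+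
    show "\<exists>k\<le>3. N.P v k = Some 0" using zero_levels(1)[OF v] H_ge by auto
    show "\<exists>k\<in>{4..7}. N.P v k = Some 0" using zero_levels(2)[OF v] H_ge low3 by auto
    show "\<exists>k\<le>3. N.P w k = Some 0" using zero_levels(1)[OF w] H_ge by auto
    show "\<exists>k\<in>{4..8}. N.P w k = Some 0" using zero_levels(2)[OF w] H_ge low3 by auto
  qed
  then show ?thesis using mod unfolding m_def by blast
qed

lemma mult_ge_of_zeros:
  assumes "model B m d b t u" "finite K" "K \<subseteq> {..H}" "\<And>k. k \<in> K \<Longrightarrow> normalized.P b t u x k = Some 0"
  shows "(\<Sum>k\<in>K. el (Suc k)) \<le> int (mult (m * x + d) B)"
proof -
  have "(\<Sum>k\<in>K. el (Suc k)) = (\<Sum>k\<in>K. if normalized.P b t u x k = Some 0 then el (Suc k) else 0)"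
    by (rule sum.cong) (use assms in auto)
  also have "\<dots> \<le> (\<Sum>k\<le>H. if normalized.P b t u x k = Some 0 then el (Suc k) else 0)"
    using assms(3) el_nonneg by (intro sum_mono2) auto
  finally show ?thesis using mult_model[OF assms(1)] by simp
qed

theorem rigid_witnesses:
  assumes R: "rigid b t u v w" and M: "model A 1 0 b t u"
  shows "witnesses A 0 1 b t u (1 + b - t) v w"
proof -
  interpret rigid_solution b t u v w by unfold_locales (rule R)
  have tot: "(\<Sum>v<n. tgt i p (lev v)) \<le> int (mult x A)"
    if "p = 2 \<or> p = 3" "\<And>k. tgt i p k = 1 \<Longrightarrow> P x k = Some 0" for i p x
  proof -
    have "(\<Sum>v<n. tgt i p (lev v)) = (\<Sum>k\<in>{k. k \<le> H \<and> tgt i p k = 1}. el (Suc k))"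
      unfolding sum_tgt[OF that(1)] by (simp add: sum.If_cases Collect_conj_eq atMost_def)
    also have "\<dots> \<le> int (mult (1 * x + 0) A)"
      by (rule mult_ge_of_zeros[OF M]) (use that in auto)
    finally show ?thesis by simp
  qed
  have tgtD: "\<exists>j. k = i + p * j" if "tgt i p k = 1" for i p k
  proof -
    have "i \<le> k" "(k - i) mod p = 0" using that by (auto simp: tgt_def split: if_splits)
    then have "p dvd k - i" by (simp add: dvd_eq_mod_eq_0)
    then obtain j where "k - i = p * j" by (auto simp: dvd_def)
    then show ?thesis using \<open>i \<le> k\<close> by (intro exI[of _ j]) simp
  qed
  have pair: "el (Suc i) + el (Suc j) \<le> int (mult x A)"
    if "i < j" "j \<le> H" "P x i = Some 0" "P x j = Some 0" for i j x
    using mult_ge_of_zeros[OF M, of "{i, j}" x] that by auto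
  \<comment> \<open>At u no level below 3 vanishes, so the multiplicity is at most |V_3|, which is
    less than ell_3.\<close>
  have "int (mult (1 * u + 0) A) \<le> int (card (V 3))"
    unfolding mult_model[OF M] using nonzero_u H_ge by (intro sum_zero_levels_le) auto
  then have "int (mult u A) < el 3" using card_V_less_el[of 2] H_ge by (simp add: eval_nat_numeral)
  moreover have "(\<Sum>v<n. tgt 0 2 (lev v)) \<le> int (mult 0 A)"
    by (rule tot) (use zeros_0 tgtD[of 0 2] in auto)
  moreover have "(\<Sum>v<n. tgt 1 2 (lev v)) \<le> int (mult 1 A)"
    by (rule tot) (use zeros_1 tgtD[of 1 2] in auto)
  moreover have "(\<Sum>v<n. tgt 1 3 (lev v)) \<le> int (mult b A)"
    by (rule tot) (use zeros_b tgtD[of 1 3] in auto)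
  moreover have "(\<Sum>v<n. tgt 2 3 (lev v)) \<le> int (mult t A)"
    by (rule tot) (use zeros_t tgtD[of 2 3] in auto)
  moreover have "(\<Sum>v<n. tgt 3 3 (lev v)) \<le> int (mult u A)"
    by (rule tot) (use zeros_u tgtD[of 3 3] in auto)
  moreover have "el 3 + el 7 \<le> int (mult s A)" "el 4 + el 8 \<le> int (mult v A)" "el 4 + el 9 \<le> int (mult w A)"
    using pair[of 2 6 s] pair[of 3 7 v] pair[of 3 8 w] zeros_s zeros_v zeros_w H_ge by (simp_all add: eval_nat_numeral)
  ultimately show ?thesis using distinct_witnesses unfolding witnesses_def s_def by blast
qed

lemma witnesses_mult_pos:
  assumes "witnesses B a1 a2 b2 b3 b4 l37 l48 l49"
  shows "{a1, a2, b2, b3, b4, l37, l48, l49} \<subseteq> set_mset (spec_mset B)"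
proof -
  have t: "0 < (\<Sum>v<n. tgt i p (lev v))" if "p = 2 \<or> p = 3" "i \<le> H" for i p
  proof -
    have "0 < el (Suc i)" using el_pos[OF that(2)] .
    also have "\<dots> \<le> (\<Sum>k\<le>H. if tgt i p k = 1 then el (Suc k) else 0)"
      using member_le_sum[of i "{..H}" "\<lambda>k. if tgt i p k = 1 then el (Suc k) else 0"] that el_nonneg
      by (simp add: tgt_start)
    finally show ?thesis using sum_tgt[OF that(1)] by simp
  qed
  have "x \<in># spec_mset B" if "0 < int (mult x B)" for x
    using that by (simp add: mult_def)
  moreover have "0 < el 3" "0 < el 4" "0 < el 7" "0 < el 8" "0 < el 9"
    using el_pos[of 2] el_pos[of 3] el_pos[of 6] el_pos[of 7] el_pos[of 8] H_ge by (simp_all add: eval_nat_numeral)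
  ultimately show ?thesis
    using assms t[of 2 0] t[of 2 1] t[of 3 1] t[of 3 2] t[of 3 3] H_ge unfolding witnesses_def by auto
qed

theorem rigid_tree:
  "\<exists>A\<in>S_T n E. witnessed A
    \<and> (\<forall>B\<in>S_T n E. witnessed B \<longrightarrow> mult_list B = mult_list A \<or> mult_list (- B) = mult_list A)
    \<and> (\<forall>B\<in>S_T n E. mult_list B = mult_list A \<longrightarrow>
        (\<exists>a c. a > 0 \<and> spec_mset B = image_mset (\<lambda>\<mu>. a * \<mu> + c) (spec_mset A)))"
proof -
  obtain b t u v w where R: "rigid b t u v w" using rigid_exists by blast
  interpret rigid_solution b t u v w by unfold_locales (rule R)
  obtain A where A: "A \<in> S_T n E" "uniform A (aseq 0 1 b) (Cseq 0 1 b t u) H"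
    using ex_uniform[of "Cseq 0 1 b t u" "aseq 0 1 b"] C_pos by blast
  then have M: "model A 1 0 b t u" by (simp add: model_def)
  have WA: "witnesses A 0 1 b t u (1 + b - t) v w" by (rule rigid_witnesses[OF R M])
  \<comment> \<open>By \<open>rigid_unique\<close> every witnessed matrix is a model with the same
    b, t, u as A, and so is its negative.\<close>
  have forced: "spec_mset B = image_mset (\<lambda>x. (a2 - a1) * x + a1) (spec_mset A) \<and> a2 - a1 \<noteq> 0
      \<and> spec_mset (- B) = image_mset (\<lambda>x. - (a2 - a1) * x + - a1) (spec_mset A)"
    if B: "B \<in> S_T n E" and W: "witnesses B a1 a2 b2 b3 b4 l37 l48 l49" for B a1 a2 b2 b3 b4 l37 l48 l49
  proof -
    obtain b' t' u' v' w' where R': "rigid b' t' u' v' w'" and M': "model B (a2 - a1) a1 b' t' u'"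
      using witnesses_rigid[OF B W] by blast
    have M': "model B (a2 - a1) a1 b t u" using M' rigid_unique[OF R R'] by simp
    then show ?thesis
      using model_spec[OF M M'] model_spec[OF M model_uminus[OF M']] by (simp add: model_def)
  qed
  have mono: "strict_mono (\<lambda>x. a * x + c)" if "a > 0" for a c :: real
    using that by (intro strict_monoI) simp
  show ?thesis
  proof (intro bexI[OF _ A(1)] conjI ballI impI)
    show "witnessed A" using WA unfolding witnessed_def by blast
  next
    fix B assume B: "B \<in> S_T n E" and "witnessed B"
    then obtain a1 a2 b2 b3 b4 l37 l48 l49 where W: "witnesses B a1 a2 b2 b3 b4 l37 l48 l49"
      unfolding witnessed_def by blast
    note f = forced[OF B W]
    \<comment> \<open>The affine map from the spectrum of A to that of B has slope a2 - a1. If this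
      is negative, the map to the spectrum of -B is increasing.\<close>
    show "mult_list B = mult_list A \<or> mult_list (- B) = mult_list A"
    proof (cases "a2 - a1 > 0")
      case True
      then show ?thesis using mult_list_image[OF mono] f by blast
    next
      case False
      then have "- (a2 - a1) > 0" using f by simp
      then show ?thesis using mult_list_image[OF mono] f by blast
    qed
  next
    fix B assume B: "B \<in> S_T n E" and eq: "mult_list B = mult_list A"
    let ?X = "{0, 1, b, t, u, 1 + b - t, v, w}"
    \<comment> \<open>The conditions in \<open>witnesses\<close> concern only distinctness and
      multiplicities, so \<psi> carries the witnesses of A to witnesses of B. As \<psi> is
      increasing, the slope \<psi> 1 - \<psi> 0 is positive.\<close>
    obtain \<psi> where \<psi>: "\<forall>x\<in>?X. mult (\<psi> x) B = mult x A" "\<forall>x\<in>?X. \<forall>y\<in>?X. x < y \<longrightarrow> \<psi> x < \<psi> y"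
      using mult_list_eq_strict_mono[OF eq witnesses_mult_pos[OF WA]] by blast
    have inj: "inj_on \<psi> ?X"
    proof (rule inj_onI)
      fix x y assume xy: "x \<in> ?X" "y \<in> ?X" "\<psi> x = \<psi> y"
      show "x = y"
      proof (rule ccontr)
        assume "x \<noteq> y"
        then have "x < y \<or> y < x" by auto
        then have "\<psi> x < \<psi> y \<or> \<psi> y < \<psi> x" using \<psi>(2) xy(1,2) by blast
        then show False using xy(3) by simp
      qed
    qed
    have "distinct (map \<psi> [0, 1, b, t, u, 1 + b - t, v, w])"
      unfolding distinct_map using inj WA by (auto simp only: witnesses_def set_simps)
    then have "witnesses B (\<psi> 0) (\<psi> 1) (\<psi> b) (\<psi> t) (\<psi> u) (\<psi> (1 + b - t)) (\<psi> v) (\<psi> w)"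
      using WA \<psi>(1) unfolding witnesses_def by (simp only: list.map) simp
    then have "spec_mset B = image_mset (\<lambda>x. (\<psi> 1 - \<psi> 0) * x + \<psi> 0) (spec_mset A)"
      using forced[OF B] by blast
    moreover have "(0::real) < 1" by simp
    then have "\<psi> 0 < \<psi> 1" using \<psi>(2) by blast
    ultimately show "\<exists>a c. a > 0 \<and> spec_mset B = image_mset (\<lambda>\<mu>. a * \<mu> + c) (spec_mset A)"
      by (intro exI[of _ "\<psi> 1 - \<psi> 0"] exI[of _ "\<psi> 0"]) simp
  qed
qed

end

theorem mainTheorem17:
  fixes n :: nat and E :: "nat \<Rightarrow> nat \<Rightarrow> bool" and r :: nat
  assumes "is_lush n E r"
    and "hedge_height n E r \<ge> 8"
  shows "\<exists>A \<in> S_T n E. rig_prop n E r A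
     \<and> (\<forall>B \<in> S_T n E. rig_prop n E r B \<longrightarrow>
            mult_list B = mult_list A \<or> mult_list (- B) = mult_list A)
     \<and> (\<forall>B \<in> S_T n E. mult_list B = mult_list A \<longrightarrow>
            (\<exists>a b. a > 0 \<and> spec_mset B = image_mset (\<lambda>\<mu>. a * \<mu> + b) (spec_mset A)))"
proof -
  obtain par where "lush_tree n r (hedge_height n E r) E par (hgt n E r)"
    using lush_hedge_lush_tree[OF assms] by blast
  then interpret lush_tree n r "hedge_height n E r" E par "hgt n E r" .
  have el: "ell n E r k = el k" for k
    by (simp add: ell_def el_def V_def Vlev_def)
  have sum: "ell_sum n E r p (Suc i) = (\<Sum>v<n. tgt i p (hgt n E r v))" if "p = 2 \<or> p = 3" for p i
    unfolding ell_sum_def el by (rule sum_el_residue[OF that])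
  have sums: "ell_sum n E r 2 1 = (\<Sum>v<n. tgt 0 2 (hgt n E r v))" "ell_sum n E r 2 2 = (\<Sum>v<n. tgt 1 2 (hgt n E r v))"
    "ell_sum n E r 3 2 = (\<Sum>v<n. tgt 1 3 (hgt n E r v))" "ell_sum n E r 3 3 = (\<Sum>v<n. tgt 2 3 (hgt n E r v))"
    "ell_sum n E r 3 4 = (\<Sum>v<n. tgt 3 3 (hgt n E r v))"
    using sum[of 2 0] sum[of 2 1] sum[of 3 1] sum[of 3 2] sum[of 3 3] by (simp_all add: eval_nat_numeral)
  have "rig_prop n E r B \<longleftrightarrow> witnessed B" for B
    unfolding rig_prop_def crit_witness_def witnessed_def witnesses_def el sums
    by (intro ex_cong1) auto
  then show ?thesis using rigid_tree by simp
qed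

end
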